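(* Let $(d,h)$ be a higher matrix factorization with respect to a regular sequence $f_1,\dots,f_c$ in a ring $S$. Choose splittings $A_s(p)=A_s(p-1)\oplus B_s(p)$ ($s=0,1$) and construct complexes $\mathbf L(1),\dots,\mathbf L(c)$ recursively as described in the context. Then for every $p=1,\dots,c$ the complex $\mathbf L(p)$ is an $S$-free resolution of $M(p)$ (so the recursive construction can be carried through to $\mathbf L(c)$). Moreover, if $S$ is local and $(d,h)$ is minimal, then the resolution $\mathbf L(p)$ is minimal.
   Context: All rings are commutative and Noetherian, all modules finitely generated. For elements $f_1,\dots,f_c$ of a ring $S$ put $R(p)=S/(f_1,\dots,f_p)$ for $0\le p\le c$ and $R=R(c)$. A higher matrix factorization (HMF) $(d,h)$ with respect to $f_1,\dots,f_c$ consists of: (1) finitely generated free $S$-modules $A_0,A_1$ with filtrations $0=A_s(0)\subseteq A_s(1)\subseteq\cdots\subseteq A_s(c)=A_s$ ($s=0,1$) such that each $A_s(p-1)$ is a free summand of $A_s(p)$; (2) $S$-linear maps $d:A_1\to A_0$ and $h:\bigoplus_{q=1}^cA_0(q)\to A_1$ preserving filtrations, where $\bigoplus_qA_0(q)$ is filtered by the submodules $\bigoplus_{q\le p}A_0(q)$; such that, writing $d_p:A_1(p)\to A_0(p)$ and $h_p:A_0(p)\to A_1(p)$ for the induced maps ($h_p$ is the restriction of $h$ to the $p$-th summand), $B_s(p)=A_s(p)/A_s(p-1)$ (free modules), and $\pi_p:A_1(p)\to B_1(p)$ for the projection, one has for all $1\le p\le c$: (a) $d_ph_p\equiv f_p\,\mathrm{Id}_{A_0(p)}$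 modulo $(f_1,\dots,f_{p-1})A_0(p)$; (b) $\pi_ph_pd_p\equiv f_p\,\pi_p$ modulo $(f_1,\dots,f_{p-1})B_1(p)$. Put $M(p)=\operatorname{coker}(R(p)\otimes d_p)$. If $S$ is local with maximal ideal $\mathfrak m$, $(d,h)$ is minimal if the images of $d$ and $h$ are contained in $\mathfrak m$ times their targets. Complexes: $\mathbf W[-1]_i=\mathbf W_{i+1}$ with differential $-\partial$. For a map of complexes $\varphi:\mathbf W[-1]\to\mathbf Y$ the mapping cone $\mathbf{Cone}(\varphi)$ has terms $Y_i\oplus W_i$ and differential $\begin{pmatrix}\partial^Y&\varphi\\0&\partial^W\end{pmatrix}$. A left complex is a complex zero in negative degrees. If $\mathbf B,\mathbf L$ are $S$-free left complexes, $\psi:\mathbf B[-1]\to\mathbf L$ is a map of complexes and $\mathbf K=\mathbf K(f_1,\dots,f_p)$ is the Koszul complex, an $(f_1,\dots,f_p)$-Koszul extension of $\psi$ is a map of complexes $\Psi:\mathbf K\otimes\mathbf B[-1]\to\mathbf L$ that extends $\psi$ on $\mathbf K_0\otimes\mathbf B[-1]=\mathbf B[-1]$ and vanishes on $\mathbf K\otimes B_0$. (One exists whenever $\mathbf L$ is a free resolution of a module annihilated by $f_1,\dots,f_p$.) Construction: let $\mathbf B(p)$ be the two-term complex $b_p:B_1(p)\to B_0(p)$ induced by $d$, and let $\psi_p:B_1(p)\to A_0(p-1)$ be the corresponding component of $d_p$. Set $\mathbf L(1)=\mathbf B(1)$. For $p\ge2$, given that $\mathbf L(p-1)$ is an $S$-free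 resolution of $M(p-1)$ with zeroth term $A_0(p-1)$, let $\psi_p':\mathbf B(p)[-1]\to\mathbf L(p-1)$ be the map of complexes induced by $\psi_p$, let $\Psi_p:\mathbf K(f_1,\dots,f_{p-1})\otimes\mathbf B(p)[-1]\to\mathbf L(p-1)$ be any $(f_1,\dots,f_{p-1})$-Koszul extension of $\psi'_p$, and set $\mathbf L(p)=\mathbf{Cone}(\Psi_p)$. *)

theory Defs
  imports "HOL-Algebra.Module" "HOL-Algebra.Ring_Divisibility"
begin

section \<open>Modules\<close>

text \<open>
  The record type of modules in HOL-Algebra extends that of rings; the inherited
  fields for multiplication and one play no role and are left undefined below.
\<close>

definition mod_hom ::
  "('a, 'c) ring_scheme \<Rightarrow> ('a, 'm) module \<Rightarrow> ('a, 'n) module \<Rightarrow> ('m \<Rightarrow> 'n) set" where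
  "mod_hom S M N =
     {\<phi> \<in> hom (add_monoid M) (add_monoid N).
        \<forall>a\<in>carrier S. \<forall>x\<in>carrier M. \<phi> (a \<odot>\<^bsub>M\<^esub> x) = a \<odot>\<^bsub>N\<^esub> \<phi> x}"

definition sub_mod :: "('a, 'm) module \<Rightarrow> 'm set \<Rightarrow> ('a, 'm) module" where
  "sub_mod M X = M\<lparr>carrier := X\<rparr>"

definition quot_mod :: "('a, 'm) module \<Rightarrow> 'm set \<Rightarrow> ('a, 'm set) module" where
  "quot_mod M N =
     \<lparr>carrier = a_rcosets\<^bsub>M\<^esub> N, mult = undefined, one = undefined,
      zero = N, add = (<+>\<^bsub>M\<^esub>),
      smult = (\<lambda>a X. \<Union>x\<in>X. N +>\<^bsub>M\<^esub> (a \<odot>\<^bsub>M\<^esub> x))\<rparr>"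

text \<open>Used for finite index sets only.\<close>

definition direct_sum :: "'i set \<Rightarrow> ('i \<Rightarrow> ('a, 'm) module) \<Rightarrow> ('a, 'i \<Rightarrow> 'm) module" where
  "direct_sum J M =
     \<lparr>carrier = (\<Pi>\<^sub>E j\<in>J. carrier (M j)), mult = undefined, one = undefined,
      zero = (\<lambda>j\<in>J. \<zero>\<^bsub>M j\<^esub>),
      add = (\<lambda>x y. \<lambda>j\<in>J. x j \<oplus>\<^bsub>M j\<^esub> y j),
      smult = (\<lambda>a x. \<lambda>j\<in>J. a \<odot>\<^bsub>M j\<^esub> x j)\<rparr>"

definition fg_free :: "('a, 'c) ring_scheme \<Rightarrow> ('a, 'm) module \<Rightarrow> bool" where
  "fg_free S M \<longleftrightarrow>
     module S M \<and>
     (\<exists>E. finite E \<and> E \<subseteq> carrier M \<and>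
        (\<forall>x\<in>carrier M. \<exists>!u. u \<in> E \<rightarrow>\<^sub>E carrier S \<and> x = (\<Oplus>\<^bsub>M\<^esub>e\<in>E. u e \<odot>\<^bsub>M\<^esub> e)))"

text \<open>Inside the module \<open>M\<close>: \<open>Y = X \<oplus> C\<close> as an internal direct sum of submodules.\<close>

definition internal_sum ::
  "('a, 'c) ring_scheme \<Rightarrow> ('a, 'm) module \<Rightarrow> 'm set \<Rightarrow> 'm set \<Rightarrow> 'm set \<Rightarrow> bool" where
  "internal_sum S M Y X C \<longleftrightarrow>
     submodule X S M \<and> submodule C S M \<and> X \<inter> C = {\<zero>\<^bsub>M\<^esub>} \<and> Y = X <+>\<^bsub>M\<^esub> C"

definition ideal_mod ::
  "('a, 'c) ring_scheme \<Rightarrow> 'a set \<Rightarrow> ('a, 'm) module \<Rightarrow> 'm set" where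
  "ideal_mod S I M =
     \<Inter>{X. submodule X S M \<and> (\<forall>a\<in>I. \<forall>x\<in>carrier M. a \<odot>\<^bsub>M\<^esub> x \<in> X)}"

definition coker ::
  "('a, 'm) module \<Rightarrow> ('a, 'n) module \<Rightarrow> ('m \<Rightarrow> 'n) \<Rightarrow> ('a, 'n set) module" where
  "coker M N \<phi> = quot_mod N (\<phi> ` carrier M)"

text \<open>
  \<open>S/I \<otimes> M\<close> as \<open>M/IM\<close>, regarded as an \<open>S\<close>-module, and the map
  \<open>S/I \<otimes> \<phi>\<close> for \<open>\<phi>\<close> with target \<open>N\<close>.
\<close>

definition base_change ::
  "('a, 'c) ring_scheme \<Rightarrow> 'a set \<Rightarrow> ('a, 'm) module \<Rightarrow> ('a, 'm set) module" where
  "base_change S I M = quot_mod M (ideal_mod S I M)"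

definition base_change_map ::
  "('a, 'c) ring_scheme \<Rightarrow> 'a set \<Rightarrow> ('a, 'n) module \<Rightarrow> ('m \<Rightarrow> 'n) \<Rightarrow> 'm set \<Rightarrow> 'n set" where
  "base_change_map S I N \<phi> X = (\<Union>x\<in>X. ideal_mod S I N +>\<^bsub>N\<^esub> \<phi> x)"


section \<open>Regular sequences and local rings\<close>

definition seq_ideal :: "('a, 'c) ring_scheme \<Rightarrow> (nat \<Rightarrow> 'a) \<Rightarrow> nat \<Rightarrow> 'a set" where
  "seq_ideal S f p = Idl\<^bsub>S\<^esub> (f ` {1..p})"

definition regular_sequence :: "('a, 'c) ring_scheme \<Rightarrow> (nat \<Rightarrow> 'a) \<Rightarrow> nat \<Rightarrow> bool" where
  "regular_sequence S f c \<longleftrightarrow>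
     (\<forall>p\<in>{1..c}. f p \<in> carrier S) \<and>
     (\<forall>p\<in>{1..c}. \<forall>a\<in>carrier S.
        f p \<otimes>\<^bsub>S\<^esub> a \<in> seq_ideal S f (p - 1) \<longrightarrow> a \<in> seq_ideal S f (p - 1)) \<and>
     seq_ideal S f c \<noteq> carrier S"

definition local_ring_with :: "('a, 'c) ring_scheme \<Rightarrow> 'a set \<Rightarrow> bool" where
  "local_ring_with S \<mm> \<longleftrightarrow> maximalideal \<mm> S \<and> (\<forall>\<nn>. maximalideal \<nn> S \<longrightarrow> \<nn> = \<mm>)"


section \<open>Complexes\<close>

text \<open>\<open>bdry C i\<close> is the differential from degree \<open>i\<close> to degree \<open>i - 1\<close>.\<close>

record ('a, 'x) cplx =
  cmod :: "int \<Rightarrow> ('a, 'x) module"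
  bdry :: "int \<Rightarrow> 'x \<Rightarrow> 'x"

definition is_complex :: "('a, 'c) ring_scheme \<Rightarrow> ('a, 'x) cplx \<Rightarrow> bool" where
  "is_complex S C \<longleftrightarrow>
     (\<forall>i. module S (cmod C i) \<and> bdry C i \<in> mod_hom S (cmod C i) (cmod C (i - 1)) \<and>
          (\<forall>x\<in>carrier (cmod C i). bdry C (i - 1) (bdry C i x) = \<zero>\<^bsub>cmod C (i - 2)\<^esub>))"

definition left_complex :: "('a, 'c) ring_scheme \<Rightarrow> ('a, 'x) cplx \<Rightarrow> bool" where
  "left_complex S C \<longleftrightarrow>
     is_complex S C \<and> (\<forall>i<0. carrier (cmod C i) = {\<zero>\<^bsub>cmod C i\<^esub>})"

definition chain_map ::
  "('a, 'c) ring_scheme \<Rightarrow> ('a, 'x) cplx \<Rightarrow> ('a, 'y) cplx \<Rightarrow> (int \<Rightarrow> 'x \<Rightarrow> 'y) \<Rightarrow> bool" where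
  "chain_map S C D \<phi> \<longleftrightarrow>
     (\<forall>i. \<phi> i \<in> mod_hom S (cmod C i) (cmod D i) \<and>
          (\<forall>x\<in>carrier (cmod C i). bdry D i (\<phi> i x) = \<phi> (i - 1) (bdry C i x)))"

text \<open>The complex \<open>W[-1]\<close>.\<close>

definition shift :: "('a, 'x) cplx \<Rightarrow> ('a, 'x) cplx" where
  "shift W =
     \<lparr>cmod = (\<lambda>i. cmod W (i + 1)),
      bdry = (\<lambda>i x. \<ominus>\<^bsub>cmod W i\<^esub> bdry W (i + 1) x)\<rparr>"

text \<open>
  The mapping cone of \<open>\<phi> : W[-1] \<rightarrow> Y\<close>.  An element \<open>(y, w)\<close> of \<open>Y\<^sub>i \<oplus> W\<^sub>i\<close> is coded as the
  list \<open>w # y\<close>, so that iterated cones all live in one type.  The map \<open>\<phi> (i - 1)\<close> goes from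
  \<open>W[-1]\<^bsub>i-1\<^esub> = W\<^sub>i\<close> to \<open>Y\<^bsub>i-1\<^esub>\<close>.
\<close>

definition cone ::
  "('a, 'w list) cplx \<Rightarrow> ('a, 'w) cplx \<Rightarrow> (int \<Rightarrow> 'w \<Rightarrow> 'w list) \<Rightarrow> ('a, 'w list) cplx" where
  "cone Y W \<phi> =
     \<lparr>cmod = (\<lambda>i.
        \<lparr>carrier = {w # y | w y. w \<in> carrier (cmod W i) \<and> y \<in> carrier (cmod Y i)},
         mult = undefined, one = undefined,
         zero = \<zero>\<^bsub>cmod W i\<^esub> # \<zero>\<^bsub>cmod Y i\<^esub>,
         add = (\<lambda>u v. (hd u \<oplus>\<^bsub>cmod W i\<^esub> hd v) # (tl u \<oplus>\<^bsub>cmod Y i\<^esub> tl v)),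
         smult = (\<lambda>a u. (a \<odot>\<^bsub>cmod W i\<^esub> hd u) # (a \<odot>\<^bsub>cmod Y i\<^esub> tl u))\<rparr>),
      bdry = (\<lambda>i u. bdry W i (hd u) #
                     (bdry Y i (tl u) \<oplus>\<^bsub>cmod Y (i - 1)\<^esub> \<phi> (i - 1) (hd u)))\<rparr>"

definition zero_list_cplx :: "('a, 'w list) cplx" where
  "zero_list_cplx =
     \<lparr>cmod = (\<lambda>i. \<lparr>carrier = {[]}, mult = undefined, one = undefined,
                   zero = [], add = (\<lambda>u v. []), smult = (\<lambda>a u. [])\<rparr>),
      bdry = (\<lambda>i u. [])\<rparr>"

definition free_resolution ::
  "('a, 'c) ring_scheme \<Rightarrow> ('a, 'x) cplx \<Rightarrow> ('a, 'm) module \<Rightarrow> bool" where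
  "free_resolution S C M \<longleftrightarrow>
     left_complex S C \<and>
     (\<forall>i. fg_free S (cmod C i)) \<and>
     (\<forall>i>0. {x \<in> carrier (cmod C i). bdry C i x = \<zero>\<^bsub>cmod C (i - 1)\<^esub>}
             = bdry C (i + 1) ` carrier (cmod C (i + 1))) \<and>
     (\<exists>\<epsilon>\<in>mod_hom S (cmod C 0) M.
        \<epsilon> ` carrier (cmod C 0) = carrier M \<and>
        {x \<in> carrier (cmod C 0). \<epsilon> x = \<zero>\<^bsub>M\<^esub>} = bdry C 1 ` carrier (cmod C 1))"

definition minimal_complex ::
  "('a, 'c) ring_scheme \<Rightarrow> 'a set \<Rightarrow> ('a, 'x) cplx \<Rightarrow> bool" where
  "minimal_complex S \<mm> C \<longleftrightarrow>
     (\<forall>i. bdry C i ` carrier (cmod C i) \<subseteq> ideal_mod S \<mm> (cmod C (i - 1)))"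


section \<open>Koszul complexes and Koszul extensions\<close>

definition signed :: "('a, 'm) module \<Rightarrow> nat \<Rightarrow> 'm \<Rightarrow> 'm" where
  "signed M k x = (if even k then x else \<ominus>\<^bsub>M\<^esub> x)"

text \<open>
  The tensor product \<open>K(f\<^sub>1, \<dots>, f\<^sub>p) \<otimes> B\<close>.  The Koszul complex has the basis \<open>e\<^sub>I\<close>, in degree
  \<open>card I\<close>, for \<open>I \<subseteq> {1..p}\<close>, so that an element of degree \<open>n\<close> is uniquely \<open>\<Sum>\<^sub>I e\<^sub>I \<otimes> x I\<close> with
  \<open>x I\<close> in degree \<open>n - card I\<close> of \<open>B\<close>; it is represented by the function \<open>x\<close>.
  The differential is
  \<open>e\<^sub>I \<otimes> b \<mapsto> (\<Sum>j\<in>I. (-1)^card {k\<in>I. k < j} f\<^sub>j e\<^bsub>I - {j}\<^esub> \<otimes> b) + (-1)^card I e\<^sub>I \<otimes> \<partial>b\<close>.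
\<close>

definition koszul_tensor ::
  "(nat \<Rightarrow> 'a) \<Rightarrow> nat \<Rightarrow> ('a, 'x) cplx \<Rightarrow> ('a, nat set \<Rightarrow> 'x) cplx" where
  "koszul_tensor f p B =
     \<lparr>cmod = (\<lambda>n. direct_sum (Pow {1..p}) (\<lambda>I. cmod B (n - int (card I)))),
      bdry = (\<lambda>n x. \<lambda>I\<in>Pow {1..p}.
        let N = cmod B (n - 1 - int (card I)) in
          (\<Oplus>\<^bsub>N\<^esub>j\<in>{1..p} - I. signed N (card {k\<in>I. k < j}) (f j \<odot>\<^bsub>N\<^esub> x (insert j I)))
          \<oplus>\<^bsub>N\<^esub> signed N (card I) (bdry B (n - int (card I)) (x I)))\<rparr>"

text \<open>The element \<open>1 \<otimes> b\<close> of \<open>K\<^sub>0 \<otimes> B\<^sub>n = B\<^sub>n\<close>.\<close>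

definition koszul_unit :: "nat \<Rightarrow> ('a, 'x) cplx \<Rightarrow> int \<Rightarrow> 'x \<Rightarrow> nat set \<Rightarrow> 'x" where
  "koszul_unit p B n b =
     (\<lambda>I\<in>Pow {1..p}. if I = {} then b else \<zero>\<^bsub>cmod B (n - int (card I))\<^esub>)"

text \<open>
  Here \<open>K \<otimes> B[-1]\<close> is \<open>(K \<otimes> B)[-1]\<close>, as needed to form the cone.  The last condition says that
  \<open>\<Psi>\<close> vanishes on \<open>K \<otimes> B\<^sub>0\<close>: in degree \<open>i + 1\<close> of \<open>K \<otimes> B\<close> this is the set of those \<open>x\<close>
  whose components in \<open>e\<^sub>I \<otimes> B\<^sub>j\<close>, \<open>j = i + 1 - card I\<close>, are zero for \<open>j \<noteq> 0\<close>.
\<close>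

definition koszul_extension ::
  "('a, 'c) ring_scheme \<Rightarrow> (nat \<Rightarrow> 'a) \<Rightarrow> nat \<Rightarrow> ('a, 'x) cplx \<Rightarrow> ('a, 'y) cplx \<Rightarrow>
   (int \<Rightarrow> 'x \<Rightarrow> 'y) \<Rightarrow> (int \<Rightarrow> (nat set \<Rightarrow> 'x) \<Rightarrow> 'y) \<Rightarrow> bool" where
  "koszul_extension S f p B L \<psi> \<Psi> \<longleftrightarrow>
     chain_map S (shift (koszul_tensor f p B)) L \<Psi> \<and>
     (\<forall>i. \<forall>b\<in>carrier (cmod B (i + 1)). \<Psi> i (koszul_unit p B (i + 1) b) = \<psi> i b) \<and>
     (\<forall>i. \<forall>x\<in>carrier (cmod (koszul_tensor f p B) (i + 1)).
        (\<forall>I\<in>Pow {1..p}. i + 1 - int (card I) \<noteq> 0 \<longrightarrow>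
            x I = \<zero>\<^bsub>cmod B (i + 1 - int (card I))\<^esub>) \<longrightarrow>
        \<Psi> i x = \<zero>\<^bsub>cmod L i\<^esub>)"


section \<open>Higher matrix factorizations\<close>

text \<open>
  For \<open>s = 0, 1\<close>, \<open>amb s\<close> is \<open>A\<^sub>s\<close> and \<open>fil s p\<close> is the underlying set of \<open>A\<^sub>s(p)\<close>; an element
  of the source \<open>\<Oplus>\<^sub>q A\<^sub>0(q)\<close> of \<open>hmap\<close> is a function of \<open>q\<close>.
\<close>

record ('a, 'm) hmf_data =
  amb :: "nat \<Rightarrow> ('a, 'm) module"
  fil :: "nat \<Rightarrow> nat \<Rightarrow> 'm set"
  dmap :: "'m \<Rightarrow> 'm"
  hmap :: "(nat \<Rightarrow> 'm) \<Rightarrow> 'm"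

definition Afil :: "('a, 'm) hmf_data \<Rightarrow> nat \<Rightarrow> nat \<Rightarrow> ('a, 'm) module" where
  "Afil X s p = sub_mod (amb X s) (fil X s p)"

definition Bquot :: "('a, 'm) hmf_data \<Rightarrow> nat \<Rightarrow> nat \<Rightarrow> ('a, 'm set) module" where
  "Bquot X s p = quot_mod (Afil X s p) (fil X s (p - 1))"

definition proj_quot :: "('a, 'm) hmf_data \<Rightarrow> nat \<Rightarrow> nat \<Rightarrow> 'm \<Rightarrow> 'm set" where
  "proj_quot X s p x = fil X s (p - 1) +>\<^bsub>amb X s\<^esub> x"

definition hsource :: "nat \<Rightarrow> ('a, 'm) hmf_data \<Rightarrow> ('a, nat \<Rightarrow> 'm) module" where
  "hsource c X = direct_sum {1..c} (Afil X 0)"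

definition hcomp :: "nat \<Rightarrow> ('a, 'm) hmf_data \<Rightarrow> nat \<Rightarrow> 'm \<Rightarrow> 'm" where
  "hcomp c X p x = hmap X (\<lambda>q\<in>{1..c}. if q = p then x else \<zero>\<^bsub>amb X 0\<^esub>)"

definition free_filtration ::
  "('a, 'c) ring_scheme \<Rightarrow> nat \<Rightarrow> ('a, 'm) module \<Rightarrow> (nat \<Rightarrow> 'm set) \<Rightarrow> bool" where
  "free_filtration S c M F \<longleftrightarrow>
     fg_free S M \<and> F 0 = {\<zero>\<^bsub>M\<^esub>} \<and> F c = carrier M \<and>
     (\<forall>p\<in>{1..c}.
        submodule (F p) S M \<and> F (p - 1) \<subseteq> F p \<and>
        fg_free S (sub_mod M (F (p - 1))) \<and>
        (\<exists>C. internal_sum S M (F p) (F (p - 1)) C) \<and>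
        fg_free S (quot_mod (sub_mod M (F p)) (F (p - 1))))"

definition hmf ::
  "('a, 'c) ring_scheme \<Rightarrow> (nat \<Rightarrow> 'a) \<Rightarrow> nat \<Rightarrow> ('a, 'm) hmf_data \<Rightarrow> bool" where
  "hmf S f c X \<longleftrightarrow>
     (\<forall>s\<in>{0, 1}. free_filtration S c (amb X s) (fil X s)) \<and>
     dmap X \<in> mod_hom S (amb X 1) (amb X 0) \<and>
     hmap X \<in> mod_hom S (hsource c X) (amb X 1) \<and>
     (\<forall>p\<in>{1..c}. dmap X ` fil X 1 p \<subseteq> fil X 0 p) \<and>
     (\<forall>p\<in>{1..c}. \<forall>y\<in>carrier (hsource c X).
        (\<forall>q\<in>{p<..c}. y q = \<zero>\<^bsub>amb X 0\<^esub>) \<longrightarrow> hmap X y \<in> fil X 1 p) \<and>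
     (\<forall>p\<in>{1..c}. \<forall>x\<in>fil X 0 p.
        dmap X (hcomp c X p x) \<ominus>\<^bsub>Afil X 0 p\<^esub> (f p \<odot>\<^bsub>Afil X 0 p\<^esub> x)
          \<in> ideal_mod S (seq_ideal S f (p - 1)) (Afil X 0 p)) \<and>
     (\<forall>p\<in>{1..c}. \<forall>x\<in>fil X 1 p.
        proj_quot X 1 p (hcomp c X p (dmap X x))
          \<ominus>\<^bsub>Bquot X 1 p\<^esub> (f p \<odot>\<^bsub>Bquot X 1 p\<^esub> proj_quot X 1 p x)
          \<in> ideal_mod S (seq_ideal S f (p - 1)) (Bquot X 1 p))"

definition minimal_hmf ::
  "('a, 'c) ring_scheme \<Rightarrow> 'a set \<Rightarrow> nat \<Rightarrow> ('a, 'm) hmf_data \<Rightarrow> bool" where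
  "minimal_hmf S \<mm> c X \<longleftrightarrow>
     dmap X ` carrier (amb X 1) \<subseteq> ideal_mod S \<mm> (amb X 0) \<and>
     hmap X ` carrier (hsource c X) \<subseteq> ideal_mod S \<mm> (amb X 1)"

text \<open>The module \<open>M(p) = coker (R(p) \<otimes> d\<^sub>p)\<close>, as an \<open>S\<close>-module.\<close>

definition hmf_module ::
  "('a, 'c) ring_scheme \<Rightarrow> (nat \<Rightarrow> 'a) \<Rightarrow> ('a, 'm) hmf_data \<Rightarrow> nat \<Rightarrow> ('a, 'm set set) module"
  where
  "hmf_module S f X p =
     coker (base_change S (seq_ideal S f p) (Afil X 1 p))
           (base_change S (seq_ideal S f p) (Afil X 0 p))
           (base_change_map S (seq_ideal S f p) (Afil X 0 p) (dmap X))"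


section \<open>The resolutions\<close>

text \<open>Splittings \<open>A\<^sub>s(p) = A\<^sub>s(p-1) \<oplus> B\<^sub>s(p)\<close>, with \<open>B\<^sub>s(p)\<close> realised as a submodule of \<open>A\<^sub>s(p)\<close>.\<close>

definition splitting ::
  "('a, 'c) ring_scheme \<Rightarrow> nat \<Rightarrow> ('a, 'm) hmf_data \<Rightarrow> (nat \<Rightarrow> nat \<Rightarrow> 'm set) \<Rightarrow> bool" where
  "splitting S c X B \<longleftrightarrow>
     (\<forall>s\<in>{0, 1}. \<forall>p\<in>{1..c}. internal_sum S (amb X s) (fil X s p) (fil X s (p - 1)) (B s p))"

definition compA ::
  "('a, 'm) hmf_data \<Rightarrow> (nat \<Rightarrow> nat \<Rightarrow> 'm set) \<Rightarrow> nat \<Rightarrow> nat \<Rightarrow> 'm \<Rightarrow> 'm" where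
  "compA X B s p x = (THE y. y \<in> fil X s (p - 1) \<and> (\<exists>b\<in>B s p. x = y \<oplus>\<^bsub>amb X s\<^esub> b))"

definition compB ::
  "('a, 'm) hmf_data \<Rightarrow> (nat \<Rightarrow> nat \<Rightarrow> 'm set) \<Rightarrow> nat \<Rightarrow> nat \<Rightarrow> 'm \<Rightarrow> 'm" where
  "compB X B s p x = (THE b. b \<in> B s p \<and> (\<exists>y\<in>fil X s (p - 1). x = y \<oplus>\<^bsub>amb X s\<^esub> b))"

definition Bterm ::
  "('a, 'm) hmf_data \<Rightarrow> (nat \<Rightarrow> nat \<Rightarrow> 'm set) \<Rightarrow> nat \<Rightarrow> int \<Rightarrow> ('a, 'm) module" where
  "Bterm X B p i =
     (if i = 0 then sub_mod (amb X 0) (B 0 p)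
      else if i = 1 then sub_mod (amb X 1) (B 1 p)
      else sub_mod (amb X 0) {\<zero>\<^bsub>amb X 0\<^esub>})"

text \<open>The two-term complex \<open>b\<^sub>p : B\<^sub>1(p) \<rightarrow> B\<^sub>0(p)\<close>.\<close>

definition Bcplx ::
  "('a, 'm) hmf_data \<Rightarrow> (nat \<Rightarrow> nat \<Rightarrow> 'm set) \<Rightarrow> nat \<Rightarrow> ('a, 'm) cplx" where
  "Bcplx X B p =
     \<lparr>cmod = Bterm X B p,
      bdry = (\<lambda>i x. if i = 1 then compB X B 0 p (dmap X x) else \<zero>\<^bsub>Bterm X B p (i - 1)\<^esub>)\<rparr>"

text \<open>
  The identification of \<open>A\<^sub>0(p) = B\<^sub>0(1) \<oplus> \<dots> \<oplus> B\<^sub>0(p)\<close> with the zeroth term of \<open>L(p)\<close>, which is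
  the direct sum of the \<open>K(f\<^sub>1, \<dots>, f\<^bsub>q-1\<^esub>)\<^sub>0 \<otimes> B\<^sub>0(q)\<close>, \<open>q \<le> p\<close>.
\<close>

fun ident0 ::
  "('a, 'm) hmf_data \<Rightarrow> (nat \<Rightarrow> nat \<Rightarrow> 'm set) \<Rightarrow> nat \<Rightarrow> 'm \<Rightarrow> (nat set \<Rightarrow> 'm) list" where
  "ident0 X B 0 x = []"
| "ident0 X B (Suc p) x =
     koszul_unit p (Bcplx X B (Suc p)) 0 (compB X B 0 (Suc p) x)
     # ident0 X B p (compA X B 0 (Suc p) x)"

text \<open>The map \<open>\<psi>'\<^sub>p : B(p)[-1] \<rightarrow> L\<close> for \<open>L = L(p-1)\<close>.\<close>

definition psi' ::
  "('a, 'm) hmf_data \<Rightarrow> (nat \<Rightarrow> nat \<Rightarrow> 'm set) \<Rightarrow> nat \<Rightarrow> ('a, (nat set \<Rightarrow> 'm) list) cplx \<Rightarrow>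
   int \<Rightarrow> 'm \<Rightarrow> (nat set \<Rightarrow> 'm) list" where
  "psi' X B p L i x =
     (if i = 0 then ident0 X B (p - 1) (compA X B 0 p (dmap X x)) else \<zero>\<^bsub>cmod L i\<^esub>)"

text \<open>
  \<open>hmf_cplx S f X B p L\<close>: the complex \<open>L\<close> is a possible result \<open>L(p)\<close> of the construction, for
  some choice of Koszul extensions.  \<open>L(1)\<close> is \<open>B(1) = K() \<otimes> B(1)\<close>, written as a cone over the
  zero complex merely to have its elements coded as one-element lists.
\<close>

inductive hmf_cplx ::
  "('a, 'c) ring_scheme \<Rightarrow> (nat \<Rightarrow> 'a) \<Rightarrow> ('a, 'm) hmf_data \<Rightarrow> (nat \<Rightarrow> nat \<Rightarrow> 'm set) \<Rightarrow>
   nat \<Rightarrow> ('a, (nat set \<Rightarrow> 'm) list) cplx \<Rightarrow> bool"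
  for S f X B where
  first: "hmf_cplx S f X B 1
            (cone zero_list_cplx (koszul_tensor f 0 (Bcplx X B 1)) (\<lambda>i w. []))"
| step: "hmf_cplx S f X B p L \<Longrightarrow>
         koszul_extension S f p (Bcplx X B (p + 1)) L (psi' X B (p + 1) L) \<Psi> \<Longrightarrow>
         hmf_cplx S f X B (p + 1) (cone L (koszul_tensor f p (Bcplx X B (p + 1))) \<Psi>)"

end

theory Submission
  imports Defs
begin

text \<open>
  The proof is an induction on \<open>p\<close>. Write \<open>K\<close> for the Koszul complex of \<open>f\<^sub>1, \<dots>, f\<^bsub>p-1\<^esub>\<close>; the
  mapping cone \<open>L(p)\<close> sits in an exact sequence \<open>0 \<rightarrow> L(p-1) \<rightarrow> L(p) \<rightarrow> K \<otimes> B(p) \<rightarrow> 0\<close>. As the sequence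
  is regular on free modules, \<open>K \<otimes> B(p)\<close> has no homology in degrees above \<open>1\<close>, and a cycle of
  degree \<open>1\<close> is a boundary as soon as its component in \<open>B\<^sub>1(p)\<close> lies in \<open>(f\<^sub>1, \<dots>, f\<^bsub>p-1\<^esub>)B\<^sub>1(p)\<close>
  (\<open>koszul_exact\<close>, \<open>two_term_exact\<close>). So \<open>L(p)\<close> is acyclic in positive degrees if the connecting map
  from the first homology of \<open>K \<otimes> B(p)\<close> to \<open>M(p-1)\<close> is injective (\<open>cone_acyclic\<close>), and condition (b)
  of a higher matrix factorization, together with the regularity of \<open>f\<^sub>p\<close> modulo its predecessors,
  gives exactly this (\<open>connecting_map_injective\<close>). The zeroth homology of \<open>L(p)\<close> is the quotient
  of \<open>A\<^sub>0(p)\<close> by \<open>d A\<^sub>1(p) + (f\<^sub>1, \<dots>, f\<^bsub>p-1\<^esub>)A\<^sub>0(p)\<close> (\<open>step_relations\<close>); by condition (a) this submodule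
  contains \<open>f\<^sub>p A\<^sub>0(p)\<close>, and the quotient is \<open>M(p)\<close> (\<open>relations_eq\<close>). The induction hypothesis
  \<open>resolves\<close> records the identification of \<open>A\<^sub>0(p)\<close> with the zeroth term of \<open>L(p)\<close>.

  Koszul extensions of all maps \<open>\<psi>\<close> come from a single one. By the comparison theorem for complexes
  of free modules the identity of \<open>L\<^sub>0\<close> extends to a map \<open>\<Phi> : K \<otimes> L\<^sub>0 \<rightarrow> L\<close>, and \<open>\<Phi> \<circ> (K \<otimes> \<psi>)\<close> is a Koszul
  extension of \<open>\<psi>\<close> (\<open>koszul_map_extending_identity\<close>, \<open>koszul_extension_from_identity\<close>).

  The same map proves minimality for every choice of the Koszul extension \<open>\<Psi>\<close>. The difference of \<open>\<Psi>\<close>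
  and \<open>\<Phi> \<circ> (K \<otimes> \<psi>)\<close> is zero in degree \<open>0\<close>, hence null-homotopic, hence zero modulo the maximal
  ideal because the differentials of \<open>K \<otimes> B(p)\<close> and of \<open>L(p-1)\<close> are. And \<open>K \<otimes> \<psi>\<close> is zero modulo the
  maximal ideal since \<open>d\<close> is (\<open>koszul_extension_minimal\<close>).
\<close>


section \<open>Linear maps, submodules and quotients\<close>

text \<open>
  The submodules and quotients of a module do not inherit further record fields; fixing the
  plain record type makes them available in one locale.
\<close>

locale smod = module S M for S :: "('a, 'c) ring_scheme" (structure) and M :: "('a, 'm) module" (structure)

lemma smodI: "module S M \<Longrightarrow> smod S M"
  by (simp add: smod_def)

context smod
begin

lemma neg_zero [simp]: "\<ominus>\<^bsub>M\<^esub> \<zero>\<^bsub>M\<^esub> = \<zero>\<^bsub>M\<^esub>"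
  by (rule minus_equality) simp_all

lemma diff_zero [simp]: "x \<in> carrier M \<Longrightarrow> x \<ominus>\<^bsub>M\<^esub> \<zero>\<^bsub>M\<^esub> = x"
  by (simp add: a_minus_def)

lemma diff_self [simp]: "x \<in> carrier M \<Longrightarrow> x \<ominus>\<^bsub>M\<^esub> x = \<zero>\<^bsub>M\<^esub>"
  by (simp add: a_minus_def r_neg)

lemma diff_eq_zero_iff: "x \<in> carrier M \<Longrightarrow> y \<in> carrier M \<Longrightarrow> x \<ominus>\<^bsub>M\<^esub> y = \<zero>\<^bsub>M\<^esub> \<longleftrightarrow> x = y"
  by (metis M.a_inv_closed M.minus_equality M.minus_minus a_minus_def diff_self)

lemma add_cancel:
  assumes "x \<in> carrier M" "y \<in> carrier M"
  shows "x \<oplus>\<^bsub>M\<^esub> (y \<oplus>\<^bsub>M\<^esub> \<ominus>\<^bsub>M\<^esub> x) = y" and "\<ominus>\<^bsub>M\<^esub> x \<oplus>\<^bsub>M\<^esub> (y \<oplus>\<^bsub>M\<^esub> x) = y"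
  using assms by (simp_all add: a_comm[of y] r_neg1 r_neg2)

lemma add_eq_add_imp:
  assumes "x \<in> carrier M" "b \<in> carrier M" "x' \<in> carrier M" "b' \<in> carrier M"
    and "x \<oplus>\<^bsub>M\<^esub> b = x' \<oplus>\<^bsub>M\<^esub> b'"
  shows "x \<ominus>\<^bsub>M\<^esub> x' = b' \<ominus>\<^bsub>M\<^esub> b"
proof -
  have "(x \<ominus>\<^bsub>M\<^esub> x') \<oplus>\<^bsub>M\<^esub> (x' \<oplus>\<^bsub>M\<^esub> b) = x \<oplus>\<^bsub>M\<^esub> b"
    using assms(1-4) by (simp add: a_minus_def a_assoc r_neg1)
  also have "\<dots> = b' \<oplus>\<^bsub>M\<^esub> x'" using assms by (simp add: a_comm[of x'])
  also have "\<dots> = (b' \<ominus>\<^bsub>M\<^esub> b) \<oplus>\<^bsub>M\<^esub> (b \<oplus>\<^bsub>M\<^esub> x')"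
    using assms(1-4) by (simp add: a_minus_def a_assoc r_neg1)
  also have "b \<oplus>\<^bsub>M\<^esub> x' = x' \<oplus>\<^bsub>M\<^esub> b" using assms(1-4) by (simp add: a_comm)
  finally show ?thesis using assms(1-4) by simp
qed

end

text \<open>
  Bundling a linear map with the module laws of its source and its target lets one
  interpretation supply all three to the simplifier.
\<close>

locale lin = M: smod S M + N: smod S N
  for S :: "('a, 'c) ring_scheme" (structure) and M :: "('a, 'm) module" and N :: "('a, 'n) module"
    and \<phi> :: "'m \<Rightarrow> 'n" +
  assumes hom: "\<phi> \<in> mod_hom S M N"
begin

lemma closed [simp, intro]: "x \<in> carrier M \<Longrightarrow> \<phi> x \<in> carrier N"
  using hom by (auto simp: mod_hom_def hom_def)

lemma add [simp]: "x \<in> carrier M \<Longrightarrow> y \<in> carrier M \<Longrightarrow> \<phi> (x \<oplus>\<^bsub>M\<^esub> y) = \<phi> x \<oplus>\<^bsub>N\<^esub> \<phi> y"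
  using hom by (auto simp: mod_hom_def hom_def)

lemma smult [simp]: "a \<in> carrier S \<Longrightarrow> x \<in> carrier M \<Longrightarrow> \<phi> (a \<odot>\<^bsub>M\<^esub> x) = a \<odot>\<^bsub>N\<^esub> \<phi> x"
  using hom by (auto simp: mod_hom_def hom_def)

lemma zero [simp]: "\<phi> \<zero>\<^bsub>M\<^esub> = \<zero>\<^bsub>N\<^esub>"
proof -
  have "\<phi> (\<zero>\<^bsub>S\<^esub> \<odot>\<^bsub>M\<^esub> \<zero>\<^bsub>M\<^esub>) = \<zero>\<^bsub>S\<^esub> \<odot>\<^bsub>N\<^esub> \<phi> \<zero>\<^bsub>M\<^esub>"
    by (rule smult) auto
  then show ?thesis
    by simp
qed

lemma neg [simp]: "x \<in> carrier M \<Longrightarrow> \<phi> (\<ominus>\<^bsub>M\<^esub> x) = \<ominus>\<^bsub>N\<^esub> \<phi> x"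
  by (metis M.a_inv_closed M.l_neg N.minus_equality add closed zero)

lemma diff [simp]: "x \<in> carrier M \<Longrightarrow> y \<in> carrier M \<Longrightarrow> \<phi> (x \<ominus>\<^bsub>M\<^esub> y) = \<phi> x \<ominus>\<^bsub>N\<^esub> \<phi> y"
  by (simp add: a_minus_def)

lemma finsum: "g \<in> A \<rightarrow> carrier M \<Longrightarrow> \<phi> (\<Oplus>\<^bsub>M\<^esub>i\<in>A. g i) = (\<Oplus>\<^bsub>N\<^esub>i\<in>A. \<phi> (g i))"
proof (induction A rule: infinite_finite_induct)
  case (insert a A)
  then have "g a \<in> carrier M" "g \<in> A \<rightarrow> carrier M" "(\<lambda>i. \<phi> (g i)) \<in> A \<rightarrow> carrier N"
    by auto
  with insert show ?case
    by simp
qed (auto simp: M.finsum_infinite N.finsum_infinite)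

lemma vimage_submodule:
  assumes "submodule Y S N"
  shows "submodule {x \<in> carrier M. \<phi> x \<in> Y} S M"
  using N.submoduleE[OF assms] subgroup.one_closed[OF submodule.axioms(1)[OF assms]]
  by (intro M.submoduleI) auto

lemma image_submodule:
  assumes "submodule Y S M"
  shows "submodule (\<phi> ` Y) S N"
proof (rule N.submoduleI)
  note Y = M.submoduleE[OF assms]
  show "\<phi> ` Y \<subseteq> carrier N" using Y(1) by auto
  show "\<zero>\<^bsub>N\<^esub> \<in> \<phi> ` Y"
    using subgroup.one_closed[OF submodule.axioms(1)[OF assms]] by (auto intro!: image_eqI[of _ _ "\<zero>\<^bsub>M\<^esub>"])
  show "\<ominus>\<^bsub>N\<^esub> a \<in> \<phi> ` Y" if "a \<in> \<phi> ` Y" for a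
  proof -
    from that obtain x where "x \<in> Y" "a = \<phi> x" by blast
    with Y(1,3) show ?thesis by (intro image_eqI[of _ _ "\<ominus>\<^bsub>M\<^esub> x"]) auto
  qed
  show "a \<oplus>\<^bsub>N\<^esub> b \<in> \<phi> ` Y" if "a \<in> \<phi> ` Y" "b \<in> \<phi> ` Y" for a b
  proof -
    from that obtain x y where "x \<in> Y" "a = \<phi> x" "y \<in> Y" "b = \<phi> y" by blast
    with Y(1,5) show ?thesis by (intro image_eqI[of _ _ "x \<oplus>\<^bsub>M\<^esub> y"]) (auto simp: subset_iff)
  qed
  show "a \<odot>\<^bsub>N\<^esub> b \<in> \<phi> ` Y" if "a \<in> carrier S" "b \<in> \<phi> ` Y" for a b
  proof -
    from that obtain x where "x \<in> Y" "b = \<phi> x" by blast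
    with that Y(1,4) show ?thesis by (intro image_eqI[of _ _ "a \<odot>\<^bsub>M\<^esub> x"]) auto
  qed
qed

end

lemma linI:
  fixes S (structure)
  assumes "module S M" "module S N"
    and "\<And>x. x \<in> carrier M \<Longrightarrow> \<phi> x \<in> carrier N"
    and "\<And>x y. x \<in> carrier M \<Longrightarrow> y \<in> carrier M \<Longrightarrow> \<phi> (x \<oplus>\<^bsub>M\<^esub> y) = \<phi> x \<oplus>\<^bsub>N\<^esub> \<phi> y"
    and "\<And>a x. a \<in> carrier S \<Longrightarrow> x \<in> carrier M \<Longrightarrow> \<phi> (a \<odot>\<^bsub>M\<^esub> x) = a \<odot>\<^bsub>N\<^esub> \<phi> x"
  shows "lin S M N \<phi>"
  using assms by (auto simp: lin_def lin_axioms_def smod_def mod_hom_def hom_def)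

lemma mod_hom_lin: "\<phi> \<in> mod_hom S M N \<Longrightarrow> module S M \<Longrightarrow> module S N \<Longrightarrow> lin S M N \<phi>"
  by (simp add: lin_def lin_axioms_def smod_def)

lemma lin_comp:
  assumes "lin S M N \<phi>" and "lin S N P \<psi>"
  shows "lin S M P (\<lambda>x. \<psi> (\<phi> x))"
proof -
  interpret A: lin S M N \<phi> by fact
  interpret B: lin S N P \<psi> by fact
  show ?thesis
    by (rule linI) (auto intro: A.M.module_axioms B.N.module_axioms)
qed

lemma lin_cong:
  assumes "lin S M N \<phi>" and "\<And>x. x \<in> carrier M \<Longrightarrow> \<psi> x = \<phi> x"
  shows "lin S M N \<psi>"
proof -
  interpret A: lin S M N \<phi> by fact
  show ?thesis
    by (rule linI) (auto intro: A.M.module_axioms A.N.module_axioms simp: assms(2))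
qed

lemma lin_zero_map:
  assumes "module S M" "module S N"
  shows "lin S M N (\<lambda>x. \<zero>\<^bsub>N\<^esub>)"
proof -
  interpret N: smod S N by (rule smodI) fact
  show ?thesis
    by (rule linI) (auto intro: assms)
qed

lemma lin_add_map:
  assumes "lin S M N \<phi>" and "lin S M N \<psi>"
  shows "lin S M N (\<lambda>x. \<phi> x \<oplus>\<^bsub>N\<^esub> \<psi> x)"
proof -
  interpret A: lin S M N \<phi> by fact
  interpret B: lin S M N \<psi> by fact
  show ?thesis
    by (rule linI) (auto intro: A.M.module_axioms A.N.module_axioms simp: A.N.smult_r_distr A.N.M.a_ac)
qed

lemma lin_neg_map:
  assumes "lin S M N \<phi>"
  shows "lin S M N (\<lambda>x. \<ominus>\<^bsub>N\<^esub> \<phi> x)"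
proof -
  interpret A: lin S M N \<phi> by fact
  show ?thesis
    by (rule linI)
      (auto intro: A.M.module_axioms A.N.module_axioms simp: A.N.smult_r_minus A.N.minus_add)
qed

lemma lin_diff_map:
  assumes "lin S M N \<phi>" and "lin S M N \<psi>"
  shows "lin S M N (\<lambda>x. \<phi> x \<ominus>\<^bsub>N\<^esub> \<psi> x)"
  unfolding a_minus_def by (intro lin_add_map lin_neg_map assms)

lemma lin_id: "module S M \<Longrightarrow> lin S M M (\<lambda>x. x)"
  by (rule linI) auto

lemma lin_finsum_map:
  assumes "module S M" "module S N" and "finite A" and "\<And>j. j \<in> A \<Longrightarrow> lin S M N (\<phi> j)"
  shows "lin S M N (\<lambda>x. \<Oplus>\<^bsub>N\<^esub>j\<in>A. \<phi> j x)"
  using assms(3,4)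
proof (induction A)
  case empty
  interpret N: smod S N by (rule smodI) fact
  show ?case using lin_zero_map[OF assms(1,2)] by simp
next
  case (insert a A)
  interpret N: smod S N by (rule smodI) fact
  have "lin S M N (\<lambda>x. \<phi> a x \<oplus>\<^bsub>N\<^esub> (\<Oplus>\<^bsub>N\<^esub>j\<in>A. \<phi> j x))"
    using insert by (intro lin_add_map) auto
  moreover have "(\<Oplus>\<^bsub>N\<^esub>j\<in>insert a A. \<phi> j x) = \<phi> a x \<oplus>\<^bsub>N\<^esub> (\<Oplus>\<^bsub>N\<^esub>j\<in>A. \<phi> j x)" if "x \<in> carrier M" for x
    using insert lin.closed[OF insert.prems _] that by (intro N.finsum_insert) auto
  ultimately show ?case by (rule lin_cong)
qed

lemma lin_smult_map:
  assumes "module S M" and "a \<in> carrier S"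
  shows "lin S M M (\<lambda>x. a \<odot>\<^bsub>M\<^esub> x)"
proof -
  interpret M: smod S M by (rule smodI) fact
  show ?thesis
    using assms
    by (intro linI) (auto simp: M.smult_r_distr M.smult_assoc1[symmetric] M.R.m_comm)
qed

lemma (in lin) inverse_lin:
  assumes "bij_betw \<phi> (carrier M) (carrier N)"
  shows "lin S N M (the_inv_into (carrier M) \<phi>)"
proof (rule linI)
  let ?g = "the_inv_into (carrier M) \<phi>"
  have inj: "inj_on \<phi> (carrier M)" and img: "\<phi> ` carrier M = carrier N"
    using assms by (auto simp: bij_betw_def)
  have c: "?g y \<in> carrier M" and f: "\<phi> (?g y) = y" if "y \<in> carrier N" for y
    using that the_inv_into_into[OF inj] f_the_inv_into_f[OF inj] img by auto
  have u: "?g (\<phi> x) = x" if "x \<in> carrier M" for x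
    using the_inv_into_f_f[OF inj that] .
  show "?g (x \<oplus>\<^bsub>N\<^esub> y) = ?g x \<oplus>\<^bsub>M\<^esub> ?g y" if "x \<in> carrier N" "y \<in> carrier N" for x y
    using u[of "?g x \<oplus>\<^bsub>M\<^esub> ?g y"] that c f by simp
  show "?g (a \<odot>\<^bsub>N\<^esub> x) = a \<odot>\<^bsub>M\<^esub> ?g x" if "a \<in> carrier S" "x \<in> carrier N" for a x
    using u[of "a \<odot>\<^bsub>M\<^esub> ?g x"] that c f by simp
qed (use assms in \<open>auto intro: M.module_axioms N.module_axioms simp: bij_betw_def the_inv_into_into\<close>)

text \<open>
  The laws of a module consist of equations, so that they pass to an image under any map that
  respects the operations. This covers quotients.
\<close>

lemma module_surj_image:
  fixes S (structure) and M :: "('a, 'm) module" and Q :: "('a, 'n) module"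
  assumes "module S M"
    and carr: "carrier Q = \<pi> ` carrier M"
    and zero: "\<zero>\<^bsub>Q\<^esub> = \<pi> \<zero>\<^bsub>M\<^esub>"
    and add: "\<And>x y. x \<in> carrier M \<Longrightarrow> y \<in> carrier M \<Longrightarrow> \<pi> (x \<oplus>\<^bsub>M\<^esub> y) = \<pi> x \<oplus>\<^bsub>Q\<^esub> \<pi> y"
    and smult: "\<And>a x. a \<in> carrier S \<Longrightarrow> x \<in> carrier M \<Longrightarrow> \<pi> (a \<odot>\<^bsub>M\<^esub> x) = a \<odot>\<^bsub>Q\<^esub> \<pi> x"
  shows "module S Q"
proof -
  interpret M: smod S M by (rule smodI) fact
  note [simp] = add[symmetric] smult[symmetric]
  show ?thesis
  proof (rule moduleI)
    show "cring S" by (rule M.R.cring_axioms)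
    show "abelian_group Q"
    proof (rule abelian_groupI)
      show "\<exists>y\<in>carrier Q. y \<oplus>\<^bsub>Q\<^esub> x = \<zero>\<^bsub>Q\<^esub>" if "x \<in> carrier Q" for x
      proof -
        from that obtain u where "u \<in> carrier M" "x = \<pi> u" by (auto simp: carr)
        then have "\<pi> (\<ominus>\<^bsub>M\<^esub> u) \<in> carrier Q" "\<pi> (\<ominus>\<^bsub>M\<^esub> u) \<oplus>\<^bsub>Q\<^esub> x = \<zero>\<^bsub>Q\<^esub>"
          by (auto simp: carr zero M.l_neg)
        then show ?thesis by blast
      qed
    qed (auto simp: carr zero M.a_ac)
  qed (auto simp: carr M.smult_l_distr M.smult_r_distr M.smult_assoc1)
qed

context smod
begin

lemma submodule_zero_mem: "submodule H S M \<Longrightarrow> \<zero>\<^bsub>M\<^esub> \<in> H"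
  using subgroup.one_closed[OF submodule.axioms(1)] by force

lemma submodule_diff: "submodule H S M \<Longrightarrow> x \<in> H \<Longrightarrow> y \<in> H \<Longrightarrow> x \<ominus>\<^bsub>M\<^esub> y \<in> H"
  unfolding a_minus_def by (intro submoduleE(3,5))

lemma submodule_finsum:
  "submodule H S M \<Longrightarrow> g \<in> A \<rightarrow> H \<Longrightarrow> (\<Oplus>\<^bsub>M\<^esub>i\<in>A. g i) \<in> H"
proof (induction A rule: infinite_finite_induct)
  case (insert a A)
  then have "g a \<in> H" "g \<in> A \<rightarrow> H" and "H \<subseteq> carrier M"
    using submoduleE(1) by auto
  moreover from this have "g a \<in> carrier M" "g \<in> A \<rightarrow> carrier M" by auto
  ultimately show ?case
    using insert by (simp add: submoduleE(5))
qed (auto simp: finsum_infinite submodule_zero_mem)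

lemma sub_mod_module: "submodule H S M \<Longrightarrow> module S (sub_mod M H)"
  unfolding sub_mod_def by (rule submodule.submodule_is_module) (auto intro: module_axioms)

lemma singleton_zero_submodule: "submodule {\<zero>\<^bsub>M\<^esub>} S M"
  by (rule submoduleI) auto

lemma ideal_mod_submodule: "I \<subseteq> carrier S \<Longrightarrow> submodule (ideal_mod S I M) S M"
proof (rule submoduleI)
  assume "I \<subseteq> carrier S"
  then show "ideal_mod S I M \<subseteq> carrier M"
    unfolding ideal_mod_def by (intro Inter_lower) (auto simp: carrier_is_submodule subset_iff)
  show "\<zero>\<^bsub>M\<^esub> \<in> ideal_mod S I M"
    by (simp add: ideal_mod_def submodule_zero_mem)
  show "\<ominus>\<^bsub>M\<^esub> x \<in> ideal_mod S I M" if "x \<in> ideal_mod S I M" for x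
    using that by (auto simp: ideal_mod_def intro: submoduleE(3))
  show "x \<oplus>\<^bsub>M\<^esub> y \<in> ideal_mod S I M" if "x \<in> ideal_mod S I M" "y \<in> ideal_mod S I M" for x y
    using that by (auto simp: ideal_mod_def intro: submoduleE(5))
  show "a \<odot>\<^bsub>M\<^esub> x \<in> ideal_mod S I M" if "a \<in> carrier S" "x \<in> ideal_mod S I M" for a x
    using that by (auto simp: ideal_mod_def intro: submoduleE(4))
qed

lemma ideal_mod_closed: "I \<subseteq> carrier S \<Longrightarrow> x \<in> ideal_mod S I M \<Longrightarrow> x \<in> carrier M"
  using ideal_mod_submodule submoduleE(1) by blast

lemma ideal_mod_smult: "a \<in> I \<Longrightarrow> x \<in> carrier M \<Longrightarrow> a \<odot>\<^bsub>M\<^esub> x \<in> ideal_mod S I M"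
  by (auto simp: ideal_mod_def)

lemma ideal_mod_least:
  "submodule Y S M \<Longrightarrow> (\<And>a x. a \<in> I \<Longrightarrow> x \<in> carrier M \<Longrightarrow> a \<odot>\<^bsub>M\<^esub> x \<in> Y) \<Longrightarrow> ideal_mod S I M \<subseteq> Y"
  by (auto simp: ideal_mod_def)

lemmas ideal_mod_zero = submodule_zero_mem[OF ideal_mod_submodule]
lemmas ideal_mod_neg = submoduleE(3)[OF ideal_mod_submodule]
lemmas ideal_mod_add = submoduleE(5)[OF ideal_mod_submodule]
lemmas ideal_mod_diff = submodule_diff[OF ideal_mod_submodule]
lemmas ideal_mod_scale = submoduleE(4)[OF ideal_mod_submodule]
lemmas ideal_mod_finsum = submodule_finsum[OF ideal_mod_submodule]

end

lemma sub_mod_simps [simp]: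
  "carrier (sub_mod M H) = H" "zero (sub_mod M H) = zero M" "add (sub_mod M H) = add M"
  "smult (sub_mod M H) = smult M"
  by (simp_all add: sub_mod_def)

lemma (in smod) lin_inclusion: "submodule H S M \<Longrightarrow> lin S (sub_mod M H) M (\<lambda>x. x)"
  by (rule linI) (auto intro: sub_mod_module module_axioms dest: submoduleE(1))

lemma (in lin) ideal_mod_image:
  assumes "I \<subseteq> carrier S" and "x \<in> ideal_mod S I M"
  shows "\<phi> x \<in> ideal_mod S I N"
proof -
  have "ideal_mod S I M \<subseteq> {x \<in> carrier M. \<phi> x \<in> ideal_mod S I N}"
    using assms(1) by (intro M.ideal_mod_least vimage_submodule N.ideal_mod_submodule)
      (auto simp: subset_iff intro: N.ideal_mod_smult)
  then show ?thesis
    using assms(2) by auto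
qed

context smod
begin

lemma submodule_additive: "submodule H S M \<Longrightarrow> abelian_subgroup H M"
  by (intro abelian_subgroupI3 additive_subgroup.intro submodule.axioms(1) M.abelian_group_axioms)

lemma coset_eq_iff:
  assumes H: "submodule H S M" and x: "x \<in> carrier M" and y: "y \<in> carrier M"
  shows "H +>\<^bsub>M\<^esub> x = H +>\<^bsub>M\<^esub> y \<longleftrightarrow> x \<ominus>\<^bsub>M\<^esub> y \<in> H"
proof -
  interpret H: abelian_subgroup H M by (rule submodule_additive[OF H])
  have "x \<ominus>\<^bsub>M\<^esub> y \<in> H \<longleftrightarrow> x \<in> H +>\<^bsub>M\<^esub> y"
    using H.a_rcos_module_minus[OF ring.intro] x y
    by (metis H.a_rcos_module a_minus_def)
  also have "\<dots> \<longleftrightarrow> H +>\<^bsub>M\<^esub> x = H +>\<^bsub>M\<^esub> y"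
    using H.a_rcos_self[OF x] H.a_repr_independence'[OF _ y] by auto
  finally show ?thesis by simp
qed

lemma coset_zero_iff:
  assumes H: "submodule H S M" and x: "x \<in> carrier M"
  shows "H +>\<^bsub>M\<^esub> x = H \<longleftrightarrow> x \<in> H"
  using coset_eq_iff[OF H x, of "\<zero>\<^bsub>M\<^esub>"] submoduleE(1)[OF H] x
  by simp

lemma coset_memE:
  assumes "submodule H S M" "x \<in> carrier M" "y \<in> H +>\<^bsub>M\<^esub> x"
  shows "y \<in> carrier M" and "y \<ominus>\<^bsub>M\<^esub> x \<in> H"
proof -
  interpret H: abelian_subgroup H M by (rule submodule_additive[OF assms(1)])
  show "y \<in> carrier M" using assms(2,3) H.a_elemrcos_carrier by blast
  then show "y \<ominus>\<^bsub>M\<^esub> x \<in> H" 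
    using assms(2,3) by (metis H.a_rcos_module a_minus_def)
qed

lemma coset_self: "submodule H S M \<Longrightarrow> x \<in> carrier M \<Longrightarrow> x \<in> H +>\<^bsub>M\<^esub> x"
  using abelian_subgroup.a_rcos_self[OF submodule_additive] .

lemma quot_mod_simps:
  assumes H: "submodule H S M"
  shows "carrier (quot_mod M H) = (\<lambda>x. H +>\<^bsub>M\<^esub> x) ` carrier M"
    and "\<zero>\<^bsub>quot_mod M H\<^esub> = H"
    and "\<And>x y. x \<in> carrier M \<Longrightarrow> y \<in> carrier M \<Longrightarrow>
           (H +>\<^bsub>M\<^esub> x) \<oplus>\<^bsub>quot_mod M H\<^esub> (H +>\<^bsub>M\<^esub> y) = H +>\<^bsub>M\<^esub> (x \<oplus>\<^bsub>M\<^esub> y)"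
    and "\<And>a x. a \<in> carrier S \<Longrightarrow> x \<in> carrier M \<Longrightarrow>
           a \<odot>\<^bsub>quot_mod M H\<^esub> (H +>\<^bsub>M\<^esub> x) = H +>\<^bsub>M\<^esub> (a \<odot>\<^bsub>M\<^esub> x)"
proof -
  interpret H: abelian_subgroup H M by (rule submodule_additive[OF H])
  show "carrier (quot_mod M H) = (\<lambda>x. H +>\<^bsub>M\<^esub> x) ` carrier M"
    by (auto simp: quot_mod_def A_RCOSETS_def RCOSETS_def a_r_coset_def)
  show "\<zero>\<^bsub>quot_mod M H\<^esub> = H" by (simp add: quot_mod_def)
  show "(H +>\<^bsub>M\<^esub> x) \<oplus>\<^bsub>quot_mod M H\<^esub> (H +>\<^bsub>M\<^esub> y) = H +>\<^bsub>M\<^esub> (x \<oplus>\<^bsub>M\<^esub> y)"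
    if "x \<in> carrier M" "y \<in> carrier M" for x y
    using H.a_rcos_sum[OF that] by (simp add: quot_mod_def)
  show "a \<odot>\<^bsub>quot_mod M H\<^esub> (H +>\<^bsub>M\<^esub> x) = H +>\<^bsub>M\<^esub> (a \<odot>\<^bsub>M\<^esub> x)"
    if a: "a \<in> carrier S" and x: "x \<in> carrier M" for a x
  proof -
    have "H +>\<^bsub>M\<^esub> (a \<odot>\<^bsub>M\<^esub> y) = H +>\<^bsub>M\<^esub> (a \<odot>\<^bsub>M\<^esub> x)" if "y \<in> H +>\<^bsub>M\<^esub> x" for y
    proof -
      note y = coset_memE[OF H x that]
      have "a \<odot>\<^bsub>M\<^esub> y \<ominus>\<^bsub>M\<^esub> a \<odot>\<^bsub>M\<^esub> x = a \<odot>\<^bsub>M\<^esub> (y \<ominus>\<^bsub>M\<^esub> x)"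
        using a x y(1) by (simp add: a_minus_def smult_r_distr smult_r_minus)
      then show ?thesis
        using a x y submoduleE(4)[OF H a y(2)] by (subst coset_eq_iff[OF H]) auto
    qed
    then have "(\<Union>y\<in>H +>\<^bsub>M\<^esub> x. H +>\<^bsub>M\<^esub> (a \<odot>\<^bsub>M\<^esub> y)) = (\<Union>y\<in>H +>\<^bsub>M\<^esub> x. H +>\<^bsub>M\<^esub> (a \<odot>\<^bsub>M\<^esub> x))"
      by (intro SUP_cong) simp_all
    also have "\<dots> = H +>\<^bsub>M\<^esub> (a \<odot>\<^bsub>M\<^esub> x)"
      using coset_self[OF H x] by (subst UN_constant) (metis empty_iff)
    finally show ?thesis
      by (simp only: quot_mod_def module.simps)
  qed
qed

lemma quot_mod_module: "submodule H S M \<Longrightarrow> module S (quot_mod M H)"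
  using coset_zero_iff[of H "\<zero>\<^bsub>M\<^esub>"]
  by (intro module_surj_image[OF module_axioms, where \<pi> = "\<lambda>x. H +>\<^bsub>M\<^esub> x"])
    (simp_all add: quot_mod_simps submodule_zero_mem)

lemma lin_proj: "submodule H S M \<Longrightarrow> lin S M (quot_mod M H) (\<lambda>x. H +>\<^bsub>M\<^esub> x)"
  by (rule linI) (auto simp: quot_mod_simps intro: quot_mod_module module_axioms)

end

lemma (in lin) factor_through_quotient:
  assumes H: "submodule H S M" and kill: "\<And>x. x \<in> H \<Longrightarrow> \<phi> x = \<zero>\<^bsub>N\<^esub>"
  obtains \<psi> where "lin S (quot_mod M H) N \<psi>" "\<And>x. x \<in> carrier M \<Longrightarrow> \<psi> (H +>\<^bsub>M\<^esub> x) = \<phi> x"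
proof
  let ?\<psi> = "\<lambda>C. \<phi> (SOME x. x \<in> C)"
  show *: "?\<psi> (H +>\<^bsub>M\<^esub> x) = \<phi> x" if x: "x \<in> carrier M" for x
  proof -
    define y where "y = (SOME y. y \<in> H +>\<^bsub>M\<^esub> x)"
    have "y \<in> H +>\<^bsub>M\<^esub> x" unfolding y_def
      by (rule someI[of "\<lambda>y. y \<in> H +>\<^bsub>M\<^esub> x" x]) (rule M.coset_self[OF H x])
    note y = M.coset_memE[OF H x this]
    from kill[OF y(2)] x y(1) have "\<phi> y \<ominus>\<^bsub>N\<^esub> \<phi> x = \<zero>\<^bsub>N\<^esub>" by simp
    then have "\<phi> y = \<phi> x" using x y(1) by (simp add: N.diff_eq_zero_iff)
    then show ?thesis by (simp add: y_def)
  qed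
  show "lin S (quot_mod M H) N ?\<psi>"
    by (rule linI)
      (auto simp: M.quot_mod_simps[OF H] * simp flip: smult intro: M.quot_mod_module H N.module_axioms)
qed

section \<open>Direct sums\<close>

lemma direct_sum_simps [simp]:
  "carrier (direct_sum J M) = (\<Pi>\<^sub>E j\<in>J. carrier (M j))"
  "zero (direct_sum J M) = (\<lambda>j\<in>J. \<zero>\<^bsub>M j\<^esub>)"
  "x \<oplus>\<^bsub>direct_sum J M\<^esub> y = (\<lambda>j\<in>J. x j \<oplus>\<^bsub>M j\<^esub> y j)"
  "a \<odot>\<^bsub>direct_sum J M\<^esub> x = (\<lambda>j\<in>J. a \<odot>\<^bsub>M j\<^esub> x j)"
  by (simp_all add: direct_sum_def)

lemma direct_sum_module:
  fixes S (structure)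
  assumes "cring S" and M: "\<And>j. j \<in> J \<Longrightarrow> module S (M j)"
  shows "module S (direct_sum J M)"
proof -
  note ag = module.axioms(2)[OF M, THEN abelian_groupE(1)] module.axioms(2)[OF M, THEN abelian_groupE(2)]
  note sc = module.smult_closed[OF M]
  show ?thesis
  proof (rule moduleI)
  show "abelian_group (direct_sum J M)"
  proof (rule abelian_groupI)
    show "\<exists>y\<in>carrier (direct_sum J M). y \<oplus>\<^bsub>direct_sum J M\<^esub> x = \<zero>\<^bsub>direct_sum J M\<^esub>"
      if "x \<in> carrier (direct_sum J M)" for x
    proof (rule bexI[of _ "\<lambda>j\<in>J. \<ominus>\<^bsub>M j\<^esub> x j"])
      show "(\<lambda>j\<in>J. \<ominus>\<^bsub>M j\<^esub> x j) \<in> carrier (direct_sum J M)"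
        using that by (auto simp: PiE_iff intro!: abelian_group.a_inv_closed[OF module.axioms(2)[OF M]])
      show "(\<lambda>j\<in>J. \<ominus>\<^bsub>M j\<^esub> x j) \<oplus>\<^bsub>direct_sum J M\<^esub> x = \<zero>\<^bsub>direct_sum J M\<^esub>"
        using that by (auto simp: PiE_iff abelian_group.l_neg[OF module.axioms(2)[OF M]] intro!: restrict_ext)
    qed
    show "(x \<oplus>\<^bsub>direct_sum J M\<^esub> y) \<oplus>\<^bsub>direct_sum J M\<^esub> z = x \<oplus>\<^bsub>direct_sum J M\<^esub> (y \<oplus>\<^bsub>direct_sum J M\<^esub> z)"
      if "x \<in> carrier (direct_sum J M)" "y \<in> carrier (direct_sum J M)" "z \<in> carrier (direct_sum J M)" for x y z
      using that by (auto simp: PiE_iff abelian_groupE(3)[OF module.axioms(2)[OF M]] intro!: restrict_ext)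
    show "x \<oplus>\<^bsub>direct_sum J M\<^esub> y = y \<oplus>\<^bsub>direct_sum J M\<^esub> x"
      if "x \<in> carrier (direct_sum J M)" "y \<in> carrier (direct_sum J M)" for x y
      using that by (auto simp: PiE_iff intro!: restrict_ext abelian_groupE(4)[OF module.axioms(2)[OF M]])
    show "\<zero>\<^bsub>direct_sum J M\<^esub> \<oplus>\<^bsub>direct_sum J M\<^esub> x = x" if "x \<in> carrier (direct_sum J M)" for x
      by (rule extensionalityI[of _ J])
        (use that in \<open>auto simp: PiE_iff abelian_groupE(5)[OF module.axioms(2)[OF M]]\<close>)
  qed (use ag in \<open>auto simp: PiE_iff\<close>)
qed (use assms(1) ag sc in \<open>auto simp: PiE_iff fun_eq_iff extensional_def module.smult_l_distr[OF M]
        module.smult_r_distr[OF M] module.smult_assoc1[OF M] module.smult_one[OF M]\<close>)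
qed

lemma lin_component:
  assumes "cring S" "\<And>j. j \<in> J \<Longrightarrow> module S (M j)" "i \<in> J"
  shows "lin S (direct_sum J M) (M i) (\<lambda>x. x i)"
  by (rule linI) (use assms in \<open>auto intro!: direct_sum_module\<close>)

lemma lin_into_direct_sum:
  assumes "cring S" "module S N" and \<phi>: "\<And>j. j \<in> J \<Longrightarrow> lin S N (M j) (\<lambda>x. \<phi> x j)"
    and ext: "\<And>x. x \<in> carrier N \<Longrightarrow> \<phi> x \<in> extensional J"
  shows "lin S N (direct_sum J M) \<phi>"
proof (rule linI)
  show "module S (direct_sum J M)"
    using assms(1) lin.axioms(2)[OF \<phi>, unfolded smod_def] by (rule direct_sum_module)
  interpret N: smod S N by (rule smodI) fact
  show "\<phi> x \<in> carrier (direct_sum J M)" if "x \<in> carrier N" for x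
    using that lin.closed[OF \<phi>] ext by (auto simp: PiE_iff)
  show "\<phi> (x \<oplus>\<^bsub>N\<^esub> y) = \<phi> x \<oplus>\<^bsub>direct_sum J M\<^esub> \<phi> y" if "x \<in> carrier N" "y \<in> carrier N" for x y
    by (rule extensionalityI[of _ J]) (use that ext lin.add[OF \<phi>] in auto)
  show "\<phi> (a \<odot>\<^bsub>N\<^esub> x) = a \<odot>\<^bsub>direct_sum J M\<^esub> \<phi> x" if "a \<in> carrier S" "x \<in> carrier N" for a x
    by (rule extensionalityI[of _ J]) (use that ext lin.smult[OF \<phi>] in auto)
qed (rule assms)

definition single :: "'i set \<Rightarrow> ('i \<Rightarrow> ('a, 'm) module) \<Rightarrow> 'i \<Rightarrow> 'm \<Rightarrow> 'i \<Rightarrow> 'm" where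
  "single J M i x = (\<lambda>j\<in>J. if j = i then x else \<zero>\<^bsub>M j\<^esub>)"

lemma lin_single:
  assumes "cring S" "\<And>j. j \<in> J \<Longrightarrow> module S (M j)" "i \<in> J"
  shows "lin S (M i) (direct_sum J M) (single J M i)"
proof (rule lin_into_direct_sum)
  show "lin S (M i) (M j) (\<lambda>x. single J M i x j)" if "j \<in> J" for j
    using that assms by (cases "j = i") (auto simp: single_def intro!: lin_id lin_zero_map)
qed (use assms in \<open>auto simp: single_def\<close>)

lemma direct_sum_finsum:
  assumes "cring S" "\<And>j. j \<in> J \<Longrightarrow> module S (M j)" "g \<in> A \<rightarrow> carrier (direct_sum J M)" "j \<in> J"
  shows "(\<Oplus>\<^bsub>direct_sum J M\<^esub>i\<in>A. g i) j = (\<Oplus>\<^bsub>M j\<^esub>i\<in>A. g i j)"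
  using lin.finsum[OF lin_component[OF assms(1,2,4)] assms(3)] .

lemma (in abelian_monoid) finsum_only:
  assumes "finite A" "i \<in> A" "g i \<in> carrier G" "\<And>j. j \<in> A \<Longrightarrow> j \<noteq> i \<Longrightarrow> g j = \<zero>"
  shows "(\<Oplus>j\<in>A. g j) = g i"
proof -
  have "(\<Oplus>j\<in>A. g j) = (\<Oplus>j\<in>A. if i = j then g j else \<zero>)"
  proof (rule finsum_cong')
    show "(\<lambda>j. if i = j then g j else \<zero>) \<in> A \<rightarrow> carrier G"
      using assms(3) by (auto split: if_splits)
  qed (use assms(4) in \<open>auto split: if_splits\<close>)
  also have "\<dots> = g i"
  proof (rule add.finprod_singleton)
    show "g \<in> A \<rightarrow> carrier G" using assms(3,4) by (metis Pi_I zero_closed)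
  qed (use assms in auto)
  finally show ?thesis .
qed

lemma direct_sum_decompose:
  assumes S: "cring S" and M: "\<And>j. j \<in> J \<Longrightarrow> module S (M j)" and J: "finite J"
    and x: "x \<in> carrier (direct_sum J M)"
  shows "x = (\<Oplus>\<^bsub>direct_sum J M\<^esub>i\<in>J. single J M i (x i))"
proof (rule extensionalityI[of _ J])
  have l: "lin S (M i) (direct_sum J M) (single J M i)" if "i \<in> J" for i
    using that by (intro lin_single S M)
  interpret D: smod S "direct_sum J M" using S M by (rule smodI[OF direct_sum_module])
  have s: "single J M i (x i) \<in> carrier (direct_sum J M)" if "i \<in> J" for i
    using lin.closed[OF l[OF that], of "x i"] x that by (auto simp del: direct_sum_simps(2-))
  then have "(\<Oplus>\<^bsub>direct_sum J M\<^esub>i\<in>J. single J M i (x i)) \<in> carrier (direct_sum J M)"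
    by (intro D.finsum_closed) auto
  then show "(\<Oplus>\<^bsub>direct_sum J M\<^esub>i\<in>J. single J M i (x i)) \<in> extensional J"
    by (auto simp: PiE_iff)
  show "x j = (\<Oplus>\<^bsub>direct_sum J M\<^esub>i\<in>J. single J M i (x i)) j" if j: "j \<in> J" for j
  proof -
    interpret Mj: smod S "M j" by (rule smodI[OF M[OF j]])
    have "(\<Oplus>\<^bsub>direct_sum J M\<^esub>i\<in>J. single J M i (x i)) j = (\<Oplus>\<^bsub>M j\<^esub>i\<in>J. single J M i (x i) j)"
      using s by (intro direct_sum_finsum[OF S M _ j]) auto
    also have "\<dots> = single J M j (x j) j"
      using j x J by (intro Mj.finsum_only) (auto simp: single_def)
    finally show ?thesis using j by (simp add: single_def)
  qed
qed (use x in \<open>auto simp: PiE_iff\<close>)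

lemma ideal_mod_direct_sum:
  assumes S: "cring S" and M: "\<And>j. j \<in> J \<Longrightarrow> module S (M j)" and J: "finite J"
    and I: "I \<subseteq> carrier S"
    and x: "x \<in> carrier (direct_sum J M)" and xI: "\<And>j. j \<in> J \<Longrightarrow> x j \<in> ideal_mod S I (M j)"
  shows "x \<in> ideal_mod S I (direct_sum J M)"
proof -
  interpret D: smod S "direct_sum J M" using S M by (rule smodI[OF direct_sum_module])
  have l: "lin S (M i) (direct_sum J M) (single J M i)" if "i \<in> J" for i
    using that by (intro lin_single S M)
  have "(\<Oplus>\<^bsub>direct_sum J M\<^esub>i\<in>J. single J M i (x i)) \<in> ideal_mod S I (direct_sum J M)"
    using lin.ideal_mod_image[OF l I xI] by (intro D.ideal_mod_finsum I) auto
  then show ?thesis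
    using direct_sum_decompose[OF S M J x] by simp
qed

section \<open>Free modules\<close>

definition regular_module :: "('a, 'c) ring_scheme \<Rightarrow> ('a, 'a) module" where
  "regular_module S = \<lparr>carrier = carrier S, mult = undefined, one = undefined,
     zero = \<zero>\<^bsub>S\<^esub>, add = (\<oplus>\<^bsub>S\<^esub>), smult = (\<otimes>\<^bsub>S\<^esub>)\<rparr>"

lemma regular_module_simps [simp]:
  "carrier (regular_module S) = carrier S" "zero (regular_module S) = zero S"
  "add (regular_module S) = add S" "smult (regular_module S) = mult S"
  by (simp_all add: regular_module_def)

lemma regular_module_module:
  fixes S (structure)
  assumes "cring S"
  shows "module S (regular_module S)"
proof -
  interpret cring S by fact
  show ?thesis
    by (rule moduleI)
      (auto intro!: abelian_groupI cring_axioms simp: a_ac l_distr r_distr m_assoc intro: l_neg)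
qed

text \<open>
  A basis together with its coordinate functions. In this form freeness is a statement about
  linear maps, which can be composed, and the index set of the basis is arbitrary, which helps
  with direct sums.
\<close>

definition coordinates ::
  "('a, 'c) ring_scheme \<Rightarrow> ('a, 'm) module \<Rightarrow> 'j set \<Rightarrow> ('j \<Rightarrow> 'm) \<Rightarrow> ('j \<Rightarrow> 'm \<Rightarrow> 'a) \<Rightarrow> bool" where
  "coordinates S M J b t \<longleftrightarrow> finite J \<and> b \<in> J \<rightarrow> carrier M \<and>
     (\<forall>j\<in>J. lin S M (regular_module S) (t j)) \<and>
     (\<forall>i\<in>J. \<forall>j\<in>J. t i (b j) = (if i = j then \<one>\<^bsub>S\<^esub> else \<zero>\<^bsub>S\<^esub>)) \<and>
     (\<forall>x\<in>carrier M. x = (\<Oplus>\<^bsub>M\<^esub>j\<in>J. t j x \<odot>\<^bsub>M\<^esub> b j))"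

lemma fg_free_coordinates:
  fixes S :: "('a, 'c) ring_scheme" (structure) and M :: "('a, 'm) module"
  assumes "fg_free S M"
  obtains E t where "coordinates S M E (\<lambda>e. e) t"
proof -
  from assms have M: "module S M" unfolding fg_free_def by (rule conjunct1)
  from assms obtain E where "finite E \<and> E \<subseteq> carrier M \<and>
      (\<forall>x\<in>carrier M. \<exists>!u. u \<in> E \<rightarrow>\<^sub>E carrier S \<and> x = (\<Oplus>\<^bsub>M\<^esub>e\<in>E. u e \<odot>\<^bsub>M\<^esub> e))"
    unfolding fg_free_def by (elim conjE[of "module S M"] exE)
  note * = this
  have E: "finite E" "E \<subseteq> carrier M"
    by (rule *[THEN conjunct1], rule *[THEN conjunct2, THEN conjunct1])
  have uniq: "\<exists>!u. u \<in> E \<rightarrow>\<^sub>E carrier S \<and> x = (\<Oplus>\<^bsub>M\<^esub>e\<in>E. u e \<odot>\<^bsub>M\<^esub> e)" if "x \<in> carrier M" for x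
    by (rule bspec[OF *[THEN conjunct2, THEN conjunct2] that])
  interpret M: smod S M by (rule smodI[OF M])
  define t where "t e x = (THE u. u \<in> E \<rightarrow>\<^sub>E carrier S \<and> x = (\<Oplus>\<^bsub>M\<^esub>e\<in>E. u e \<odot>\<^bsub>M\<^esub> e)) e" for e x
  have tE: "(THE u. u \<in> E \<rightarrow>\<^sub>E carrier S \<and> x = (\<Oplus>\<^bsub>M\<^esub>e\<in>E. u e \<odot>\<^bsub>M\<^esub> e)) \<in> E \<rightarrow>\<^sub>E carrier S"
    and tx: "x = (\<Oplus>\<^bsub>M\<^esub>e\<in>E. t e x \<odot>\<^bsub>M\<^esub> e)" if "x \<in> carrier M" for x
    using theI'[OF uniq[OF that]] unfolding t_def by (rule conjunct1, rule conjunct2)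
  have tu: "t e x = u e" if "x \<in> carrier M" "u \<in> E \<rightarrow> carrier S" "x = (\<Oplus>\<^bsub>M\<^esub>e\<in>E. u e \<odot>\<^bsub>M\<^esub> e)" "e \<in> E" for x u e
  proof -
    have "(\<Oplus>\<^bsub>M\<^esub>e\<in>E. restrict u E e \<odot>\<^bsub>M\<^esub> e) = (\<Oplus>\<^bsub>M\<^esub>e\<in>E. u e \<odot>\<^bsub>M\<^esub> e)"
      using that E by (intro M.finsum_cong') auto
    with that have "restrict u E \<in> E \<rightarrow>\<^sub>E carrier S \<and> x = (\<Oplus>\<^bsub>M\<^esub>e\<in>E. restrict u E e \<odot>\<^bsub>M\<^esub> e)"
      by auto
    from the1_equality[OF uniq[OF that(1)], OF this] show ?thesis
      using that(4) by (simp add: t_def)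
  qed
  have t: "t e x \<in> carrier S" if "x \<in> carrier M" "e \<in> E" for x e
    using tE[OF that(1)] that(2) unfolding t_def by (rule PiE_mem)
  have summand: "(\<lambda>e. t e x \<odot>\<^bsub>M\<^esub> e) \<in> E \<rightarrow> carrier M" if "x \<in> carrier M" for x
    using t[OF that] E by auto
  have "lin S M (regular_module S) (t e)" if e: "e \<in> E" for e
  proof (rule linI[OF M regular_module_module[OF M.R.cring_axioms]])
    show "t e (x \<oplus>\<^bsub>M\<^esub> y) = t e x \<oplus>\<^bsub>regular_module S\<^esub> t e y" if x: "x \<in> carrier M" and y: "y \<in> carrier M" for x y
    proof -
      have "x \<oplus>\<^bsub>M\<^esub> y = (\<Oplus>\<^bsub>M\<^esub>e\<in>E. t e x \<odot>\<^bsub>M\<^esub> e) \<oplus>\<^bsub>M\<^esub> (\<Oplus>\<^bsub>M\<^esub>e\<in>E. t e y \<odot>\<^bsub>M\<^esub> e)"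
        by (rule arg_cong2[where f = "(\<oplus>\<^bsub>M\<^esub>)"]) (rule tx[OF x], rule tx[OF y])
      also have "\<dots> = (\<Oplus>\<^bsub>M\<^esub>e\<in>E. t e x \<odot>\<^bsub>M\<^esub> e \<oplus>\<^bsub>M\<^esub> t e y \<odot>\<^bsub>M\<^esub> e)"
        using summand x y by (simp add: M.finsum_addf)
      also have "\<dots> = (\<Oplus>\<^bsub>M\<^esub>e\<in>E. (t e x \<oplus> t e y) \<odot>\<^bsub>M\<^esub> e)"
        using E t x y by (intro M.finsum_cong') (auto simp: M.smult_l_distr subset_iff)
      finally have "t e (x \<oplus>\<^bsub>M\<^esub> y) = t e x \<oplus> t e y"
        by (rule tu[OF M.a_closed[OF x y] _ _ e, rotated]) (use x y t in auto)
      then show ?thesis by simp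
    qed
    show "t e (a \<odot>\<^bsub>M\<^esub> x) = a \<odot>\<^bsub>regular_module S\<^esub> t e x" if a: "a \<in> carrier S" and x: "x \<in> carrier M" for a x
    proof -
      have "a \<odot>\<^bsub>M\<^esub> x = a \<odot>\<^bsub>M\<^esub> (\<Oplus>\<^bsub>M\<^esub>e\<in>E. t e x \<odot>\<^bsub>M\<^esub> e)"
        by (rule arg_cong[where f = "\<lambda>y. a \<odot>\<^bsub>M\<^esub> y"]) (rule tx[OF x])
      also have "\<dots> = (\<Oplus>\<^bsub>M\<^esub>e\<in>E. a \<odot>\<^bsub>M\<^esub> (t e x \<odot>\<^bsub>M\<^esub> e))"
        using summand[OF x] a E(1) by (simp add: M.finsum_smult_ldistr)
      also have "\<dots> = (\<Oplus>\<^bsub>M\<^esub>e\<in>E. (a \<otimes> t e x) \<odot>\<^bsub>M\<^esub> e)"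
        using E t x a by (intro M.finsum_cong') (auto simp: M.smult_assoc1 subset_iff)
      finally have "t e (a \<odot>\<^bsub>M\<^esub> x) = a \<otimes> t e x"
        by (rule tu[OF M.smult_closed[OF a x] _ _ e, rotated]) (use x a t in auto)
      then show ?thesis by simp
    qed
  qed (use t e in auto)
  moreover have "t i j = (if i = j then \<one> else \<zero>)" if "i \<in> E" "j \<in> E" for i j
  proof (rule tu)
    have "(\<Oplus>\<^bsub>M\<^esub>e\<in>E. (if e = j then \<one> else \<zero>) \<odot>\<^bsub>M\<^esub> e) = (if j = j then \<one> else \<zero>) \<odot>\<^bsub>M\<^esub> j"
      using that E by (intro M.finsum_only) (auto simp: subset_iff)
    then show "j = (\<Oplus>\<^bsub>M\<^esub>e\<in>E. (if e = j then \<one> else \<zero>) \<odot>\<^bsub>M\<^esub> e)"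
      using that E by auto
  qed (use that E in auto)
  ultimately have "coordinates S M E (\<lambda>e. e) t"
    using E tx unfolding coordinates_def by auto
  then show thesis by (rule that)
qed

lemma fg_freeI:
  fixes S :: "('a, 'c) ring_scheme" (structure) and M :: "('a, 'm) module"
  assumes M: "module S M" and nz: "\<one>\<^bsub>S\<^esub> \<noteq> \<zero>\<^bsub>S\<^esub>" and co: "coordinates S M J b t"
  shows "fg_free S M"
proof -
  interpret M: smod S M by (rule smodI[OF M])
  have J: "finite J" and b: "b \<in> J \<rightarrow> carrier M" and t: "\<And>j. j \<in> J \<Longrightarrow> lin S M (regular_module S) (t j)"
    and delta: "\<And>i j. i \<in> J \<Longrightarrow> j \<in> J \<Longrightarrow> t i (b j) = (if i = j then \<one> else \<zero>)"
    and span: "\<And>x. x \<in> carrier M \<Longrightarrow> x = (\<Oplus>\<^bsub>M\<^esub>j\<in>J. t j x \<odot>\<^bsub>M\<^esub> b j)"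
    using co unfolding coordinates_def by blast+
  have inj: "inj_on b J"
    using delta nz by (metis inj_onI)
  have reindex: "(\<Oplus>\<^bsub>M\<^esub>e\<in>b ` J. g e) = (\<Oplus>\<^bsub>M\<^esub>j\<in>J. g (b j))" if "g \<in> b ` J \<rightarrow> carrier M" for g
    using that inj by (rule M.finsum_reindex)
  have "\<exists>!u. u \<in> b ` J \<rightarrow>\<^sub>E carrier S \<and> x = (\<Oplus>\<^bsub>M\<^esub>e\<in>b ` J. u e \<odot>\<^bsub>M\<^esub> e)" if x: "x \<in> carrier M" for x
  proof (rule ex1I)
    define u where "u = (\<lambda>e\<in>b ` J. t (the_inv_into J b e) x)"
    have ub: "u (b j) = t j x" if "j \<in> J" for j
      using that inj by (simp add: u_def the_inv_into_f_f)
    have tj: "t j x \<in> carrier S" if "j \<in> J" for j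
      using lin.closed[OF t[OF that] x] by simp
    have "u \<in> b ` J \<rightarrow>\<^sub>E carrier S"
      using ub tj by (auto simp: u_def the_inv_into_f_f[OF inj])
    moreover have "(\<Oplus>\<^bsub>M\<^esub>e\<in>b ` J. u e \<odot>\<^bsub>M\<^esub> e) = (\<Oplus>\<^bsub>M\<^esub>j\<in>J. u (b j) \<odot>\<^bsub>M\<^esub> b j)"
      using ub tj b by (intro reindex) auto
    moreover have "\<dots> = (\<Oplus>\<^bsub>M\<^esub>j\<in>J. t j x \<odot>\<^bsub>M\<^esub> b j)"
      using ub tj b by (intro M.finsum_cong') auto
    ultimately show "u \<in> b ` J \<rightarrow>\<^sub>E carrier S \<and> x = (\<Oplus>\<^bsub>M\<^esub>e\<in>b ` J. u e \<odot>\<^bsub>M\<^esub> e)"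
      using span[OF x] by simp
    fix v
    assume v: "v \<in> b ` J \<rightarrow>\<^sub>E carrier S \<and> x = (\<Oplus>\<^bsub>M\<^esub>e\<in>b ` J. v e \<odot>\<^bsub>M\<^esub> e)"
    have vJ: "v (b j) \<in> carrier S" if "j \<in> J" for j
      using v that by auto
    have "v (b i) = t i x" if i: "i \<in> J" for i
    proof -
      interpret ti: lin S M "regular_module S" "t i" by (rule t[OF i])
      have "x = (\<Oplus>\<^bsub>M\<^esub>j\<in>J. v (b j) \<odot>\<^bsub>M\<^esub> b j)"
        using v vJ b by (subst reindex[symmetric]) auto
      then have "t i x = t i (\<Oplus>\<^bsub>M\<^esub>j\<in>J. v (b j) \<odot>\<^bsub>M\<^esub> b j)" by simp
      also have "\<dots> = (\<Oplus>\<^bsub>regular_module S\<^esub>j\<in>J. t i (v (b j) \<odot>\<^bsub>M\<^esub> b j))"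
        using vJ b by (intro ti.finsum) auto
      also have "\<dots> = t i (v (b i) \<odot>\<^bsub>M\<^esub> b i)"
      proof (rule ti.N.finsum_only)
        show "t i (v (b i) \<odot>\<^bsub>M\<^esub> b i) \<in> carrier (regular_module S)"
          using vJ[OF i] i b by (intro ti.closed) auto
        show "t i (v (b j) \<odot>\<^bsub>M\<^esub> b j) = \<zero>\<^bsub>regular_module S\<^esub>" if "j \<in> J" "j \<noteq> i" for j
        proof -
          have "b j \<in> carrier M" using b that by auto
          then show ?thesis
            using vJ[OF that(1)] delta[OF i that(1)] that(2) by (simp del: M.smult_closed)
        qed
      qed (use J i in auto)
      also have "\<dots> = v (b i)"
      proof -
        have "b i \<in> carrier M" using b i by auto
        then show ?thesis
          using vJ[OF i] delta[OF i i] by simp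
      qed
      finally show ?thesis by simp
    qed
    then have "v (b i) = u (b i)" if "i \<in> J" for i
      using ub that by simp
    then show "v = u"
      using v \<open>u \<in> b ` J \<rightarrow>\<^sub>E carrier S\<close> by (intro extensionalityI[of v "b ` J" u]) (auto simp: PiE_iff)
  qed
  then show ?thesis
    using M J b unfolding fg_free_def by (intro conjI exI[of _ "b ` J"]) auto
qed

lemma fg_free_module: "fg_free S M \<Longrightarrow> module S M"
  by (simp add: fg_free_def)

lemma fg_free_trivial:
  assumes "module S M" "carrier M = {\<zero>\<^bsub>M\<^esub>}"
  shows "fg_free S M"
proof -
  interpret M: smod S M by (rule smodI) fact
  show ?thesis
    using assms unfolding fg_free_def by (intro conjI exI[of _ "{}"]) auto
qed

text \<open>
  The two bases are indexed by a disjoint union, because their images in \<open>P\<close> need not be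
  disjoint as sets before linear independence is known.
\<close>

lemma fg_free_biproduct:
  fixes S :: "('a, 'c) ring_scheme" (structure) and M :: "('a, 'm) module"
    and N :: "('a, 'n) module" and P :: "('a, 'p) module"
  assumes nz: "\<one>\<^bsub>S\<^esub> \<noteq> \<zero>\<^bsub>S\<^esub>" and free: "fg_free S M" "fg_free S N"
    and i1: "lin S M P i\<^sub>1" and i2: "lin S N P i\<^sub>2" and p1: "lin S P M p\<^sub>1" and p2: "lin S P N p\<^sub>2"
    and "\<And>x. x \<in> carrier M \<Longrightarrow> p\<^sub>1 (i\<^sub>1 x) = x" "\<And>x. x \<in> carrier M \<Longrightarrow> p\<^sub>2 (i\<^sub>1 x) = \<zero>\<^bsub>N\<^esub>"
    and "\<And>y. y \<in> carrier N \<Longrightarrow> p\<^sub>1 (i\<^sub>2 y) = \<zero>\<^bsub>M\<^esub>" "\<And>y. y \<in> carrier N \<Longrightarrow> p\<^sub>2 (i\<^sub>2 y) = y"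
    and split: "\<And>z. z \<in> carrier P \<Longrightarrow> z = i\<^sub>1 (p\<^sub>1 z) \<oplus>\<^bsub>P\<^esub> i\<^sub>2 (p\<^sub>2 z)"
  shows "fg_free S P"
proof -
  interpret i1: lin S M P i\<^sub>1 by fact
  interpret i2: lin S N P i\<^sub>2 by fact
  interpret p1: lin S P M p\<^sub>1 by fact
  interpret p2: lin S P N p\<^sub>2 by fact
  obtain E t where E: "coordinates S M E (\<lambda>e. e) t" by (rule fg_free_coordinates[OF free(1)])
  obtain F s where F: "coordinates S N F (\<lambda>e. e) s" by (rule fg_free_coordinates[OF free(2)])
  define b where "b = case_sum i\<^sub>1 i\<^sub>2"
  define r where "r = case_sum (\<lambda>e z. t e (p\<^sub>1 z)) (\<lambda>e z. s e (p\<^sub>2 z))"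
  note EF = E[unfolded coordinates_def] F[unfolded coordinates_def]
  have fin: "finite E" "finite F" and sub: "E \<subseteq> carrier M" "F \<subseteq> carrier N"
    using EF by auto
  have t: "lin S M (regular_module S) (t e)" if "e \<in> E" for e using EF that by auto
  have s: "lin S N (regular_module S) (s e)" if "e \<in> F" for e using EF that by auto
  have "z = (\<Oplus>\<^bsub>P\<^esub>j\<in>E <+> F. r j z \<odot>\<^bsub>P\<^esub> b j)" if z: "z \<in> carrier P" for z
  proof -
    have tz: "t e (p\<^sub>1 z) \<in> carrier S" if "e \<in> E" for e
      using lin.closed[OF t[OF that] p1.closed[OF z]] by simp
    have sz: "s e (p\<^sub>2 z) \<in> carrier S" if "e \<in> F" for e
      using lin.closed[OF s[OF that] p2.closed[OF z]] by simp
    have ec: "\<And>e. e \<in> E \<Longrightarrow> e \<in> carrier M" "\<And>e. e \<in> F \<Longrightarrow> e \<in> carrier N" using sub by auto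
    have 1: "(\<lambda>e. t e (p\<^sub>1 z) \<odot>\<^bsub>P\<^esub> i\<^sub>1 e) \<in> E \<rightarrow> carrier P" using tz ec by auto
    have 2: "(\<lambda>e. s e (p\<^sub>2 z) \<odot>\<^bsub>P\<^esub> i\<^sub>2 e) \<in> F \<rightarrow> carrier P" using sz ec by auto
    have "i\<^sub>1 (p\<^sub>1 z) = i\<^sub>1 (\<Oplus>\<^bsub>M\<^esub>e\<in>E. t e (p\<^sub>1 z) \<odot>\<^bsub>M\<^esub> e)"
      using EF p1.closed[OF z] by (intro arg_cong[where f = i\<^sub>1]) blast
    also have "\<dots> = (\<Oplus>\<^bsub>P\<^esub>e\<in>E. i\<^sub>1 (t e (p\<^sub>1 z) \<odot>\<^bsub>M\<^esub> e))"
      using tz ec by (intro i1.finsum) auto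
    also have "\<dots> = (\<Oplus>\<^bsub>P\<^esub>e\<in>E. t e (p\<^sub>1 z) \<odot>\<^bsub>P\<^esub> i\<^sub>1 e)"
      using tz ec by (intro i1.N.finsum_cong') auto
    also have "\<dots> = (\<Oplus>\<^bsub>P\<^esub>j\<in>Inl ` E. r j z \<odot>\<^bsub>P\<^esub> b j)"
      using 1 by (subst i1.N.finsum_reindex) (auto simp: r_def b_def)
    finally have 3: "i\<^sub>1 (p\<^sub>1 z) = (\<Oplus>\<^bsub>P\<^esub>j\<in>Inl ` E. r j z \<odot>\<^bsub>P\<^esub> b j)" .
    have "i\<^sub>2 (p\<^sub>2 z) = i\<^sub>2 (\<Oplus>\<^bsub>N\<^esub>e\<in>F. s e (p\<^sub>2 z) \<odot>\<^bsub>N\<^esub> e)"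
      using EF p2.closed[OF z] by (intro arg_cong[where f = i\<^sub>2]) blast
    also have "\<dots> = (\<Oplus>\<^bsub>P\<^esub>e\<in>F. i\<^sub>2 (s e (p\<^sub>2 z) \<odot>\<^bsub>N\<^esub> e))"
      using sz ec by (intro i2.finsum) auto
    also have "\<dots> = (\<Oplus>\<^bsub>P\<^esub>e\<in>F. s e (p\<^sub>2 z) \<odot>\<^bsub>P\<^esub> i\<^sub>2 e)"
      using sz ec by (intro i1.N.finsum_cong') auto
    also have "\<dots> = (\<Oplus>\<^bsub>P\<^esub>j\<in>Inr ` F. r j z \<odot>\<^bsub>P\<^esub> b j)"
      using 2 by (subst i1.N.finsum_reindex) (auto simp: r_def b_def)
    finally have 4: "i\<^sub>2 (p\<^sub>2 z) = (\<Oplus>\<^bsub>P\<^esub>j\<in>Inr ` F. r j z \<odot>\<^bsub>P\<^esub> b j)" .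
    have "z = (\<Oplus>\<^bsub>P\<^esub>j\<in>Inl ` E. r j z \<odot>\<^bsub>P\<^esub> b j) \<oplus>\<^bsub>P\<^esub> (\<Oplus>\<^bsub>P\<^esub>j\<in>Inr ` F. r j z \<odot>\<^bsub>P\<^esub> b j)"
      using split[OF z] 3 4 by simp
    also have "\<dots> = (\<Oplus>\<^bsub>P\<^esub>j\<in>Inl ` E \<union> Inr ` F. r j z \<odot>\<^bsub>P\<^esub> b j)"
      using 1 2 fin by (intro i1.N.finsum_Un_disjoint[symmetric]) (auto simp: r_def b_def)
    finally show ?thesis by (simp add: Plus_def)
  qed
  moreover have "lin S P (regular_module S) (r j)" if "j \<in> E <+> F" for j
    using that lin_comp[OF p1 t] lin_comp[OF p2 s] by (auto simp: r_def)
  moreover have "r i (b j) = (if i = j then \<one> else \<zero>)" if "i \<in> E <+> F" "j \<in> E <+> F" for i j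
  proof -
    have "\<And>e e'. e \<in> E \<Longrightarrow> e' \<in> E \<Longrightarrow> t e e' = (if e = e' then \<one> else \<zero>)"
      "\<And>e e'. e \<in> F \<Longrightarrow> e' \<in> F \<Longrightarrow> s e e' = (if e = e' then \<one> else \<zero>)"
      using EF by blast+
    moreover have "\<And>e. e \<in> E \<Longrightarrow> e \<in> carrier M" "\<And>e. e \<in> F \<Longrightarrow> e \<in> carrier N"
      using sub by auto
    ultimately show ?thesis
      using that assms(8-11) lin.zero[OF t] lin.zero[OF s] by (elim PlusE) (auto simp: r_def b_def)
  qed
  ultimately have "coordinates S P (E <+> F) b r"
    using fin sub unfolding coordinates_def by (auto simp: b_def)
  then show ?thesis
    by (intro fg_freeI[OF i1.N.module_axioms nz])
qed

lemma fg_free_iso: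
  assumes nz: "\<one>\<^bsub>S\<^esub> \<noteq> \<zero>\<^bsub>S\<^esub>" and free: "fg_free S M"
    and \<theta>: "lin S M N \<theta>" and bij: "bij_betw \<theta> (carrier M) (carrier N)"
  shows "fg_free S N"
proof (rule fg_free_biproduct[OF nz free])
  interpret \<theta>: lin S M N \<theta> by fact
  \<comment> \<open>The second summand of the biproduct is zero.\<close>
  let ?Z = "sub_mod N {\<zero>\<^bsub>N\<^esub>}"
  have Z: "module S ?Z" by (intro \<theta>.N.sub_mod_module \<theta>.N.singleton_zero_submodule)
  show "fg_free S ?Z" using Z by (intro fg_free_trivial) auto
  show "lin S ?Z N (\<lambda>x. x)" by (intro \<theta>.N.lin_inclusion \<theta>.N.singleton_zero_submodule)
  show "lin S N ?Z (\<lambda>x. \<zero>\<^bsub>?Z\<^esub>)" using Z by (intro lin_zero_map \<theta>.N.module_axioms)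
  show inv: "lin S N M (the_inv_into (carrier M) \<theta>)" by (rule \<theta>.inverse_lin[OF bij])
  show "the_inv_into (carrier M) \<theta> (\<theta> x) = x" if "x \<in> carrier M" for x
    using bij that by (simp add: bij_betw_def the_inv_into_f_f)
  show "the_inv_into (carrier M) \<theta> x = \<zero>\<^bsub>M\<^esub>" if "x \<in> carrier ?Z" for x
    using that lin.zero[OF inv] by simp
  show "z = \<theta> (the_inv_into (carrier M) \<theta> z) \<oplus>\<^bsub>N\<^esub> \<zero>\<^bsub>?Z\<^esub>" if "z \<in> carrier N" for z
    using that bij by (simp add: bij_betw_def f_the_inv_into_f)
qed (use \<theta> in auto)

lemma fg_free_direct_sum:
  assumes nz: "\<one>\<^bsub>S\<^esub> \<noteq> \<zero>\<^bsub>S\<^esub>" and S: "cring S" and "finite J" and "\<And>j. j \<in> J \<Longrightarrow> fg_free S (M j)"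
  shows "fg_free S (direct_sum J M)"
  using assms(3,4)
proof (induction J)
  case empty
  show ?case
    by (intro fg_free_trivial direct_sum_module S) auto
next
  case (insert i J)
  note M = fg_free_module[OF insert.prems]
  show ?case
  proof (rule fg_free_biproduct[OF nz insert.prems[of i] insert.IH[OF insert.prems]])
    show "lin S (M i) (direct_sum (insert i J) M) (single (insert i J) M i)"
      using S M by (intro lin_single) auto
    show "lin S (direct_sum (insert i J) M) (M i) (\<lambda>x. x i)"
      using S M by (intro lin_component) auto
    show "lin S (direct_sum (insert i J) M) (direct_sum J M) (\<lambda>x. restrict x J)"
      using S M by (intro lin_into_direct_sum direct_sum_module) (auto intro!: lin_component)
    show "lin S (direct_sum J M) (direct_sum (insert i J) M) (\<lambda>x. \<lambda>j\<in>insert i J. if j = i then \<zero>\<^bsub>M i\<^esub> else x j)"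
    proof (rule lin_into_direct_sum)
      show "lin S (direct_sum J M) (M j) (\<lambda>x. (\<lambda>j\<in>insert i J. if j = i then \<zero>\<^bsub>M i\<^esub> else x j) j)"
        if "j \<in> insert i J" for j
        using that S M insert.hyps
        by (cases "j = i") (auto intro!: lin_component lin_zero_map direct_sum_module)
    qed (use S M in \<open>auto intro!: direct_sum_module\<close>)
    show "z = single (insert i J) M i (z i) \<oplus>\<^bsub>direct_sum (insert i J) M\<^esub>
        (\<lambda>j\<in>insert i J. if j = i then \<zero>\<^bsub>M i\<^esub> else restrict z J j)"
      if "z \<in> carrier (direct_sum (insert i J) M)" for z
    proof (rule extensionalityI[of _ "insert i J"])
      fix j assume j: "j \<in> insert i J"
      interpret smod S "M j" using M j by (auto intro: smodI)
      have "z j \<in> carrier (M j)" using that j by auto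
      then have zj: "z j \<oplus>\<^bsub>M j\<^esub> \<zero>\<^bsub>M j\<^esub> = z j" "\<zero>\<^bsub>M j\<^esub> \<oplus>\<^bsub>M j\<^esub> z j = z j" by simp_all
      show "z j = (single (insert i J) M i (z i) \<oplus>\<^bsub>direct_sum (insert i J) M\<^esub>
        (\<lambda>j\<in>insert i J. if j = i then \<zero>\<^bsub>M i\<^esub> else restrict z J j)) j"
        using j zj by (cases "j = i") (auto simp: single_def)
    qed (use that in \<open>auto simp: PiE_iff\<close>)
  qed (use insert.hyps in \<open>auto simp: single_def PiE_iff fun_eq_iff extensional_def\<close>)
qed

text \<open>
  Free modules are projective: choose preimages of the images of the basis elements and extend
  them linearly.
\<close>

lemma fg_free_lift:
  fixes S :: "('a, 'c) ring_scheme" (structure) and F :: "('a, 'm) module"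
    and L :: "('a, 'n) module" and Z :: "('a, 'p) module"
  assumes free: "fg_free S F" and d: "lin S L Z d" and g: "lin S F Z g"
    and img: "\<And>x. x \<in> carrier F \<Longrightarrow> g x \<in> d ` carrier L"
  obtains G where "lin S F L G" "\<And>x. x \<in> carrier F \<Longrightarrow> d (G x) = g x"
proof -
  interpret d: lin S L Z d by fact
  interpret g: lin S F Z g by fact
  obtain E t where "coordinates S F E (\<lambda>e. e) t" by (rule fg_free_coordinates[OF free])
  then have E: "finite E" "E \<subseteq> carrier F" and t: "\<And>e. e \<in> E \<Longrightarrow> lin S F (regular_module S) (t e)"
    and span: "\<And>x. x \<in> carrier F \<Longrightarrow> x = (\<Oplus>\<^bsub>F\<^esub>e\<in>E. t e x \<odot>\<^bsub>F\<^esub> e)"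
    unfolding coordinates_def by auto
  have "\<forall>e\<in>E. \<exists>l. l \<in> carrier L \<and> d l = g e"
  proof
    fix e assume "e \<in> E"
    with E(2) have "g e \<in> d ` carrier L" by (intro img) auto
    then show "\<exists>l. l \<in> carrier L \<and> d l = g e" by (elim imageE) auto
  qed
  from bchoice[OF this] obtain l where "\<forall>e\<in>E. l e \<in> carrier L \<and> d (l e) = g e" by (rule exE)
  then have l: "\<And>e. e \<in> E \<Longrightarrow> l e \<in> carrier L" "\<And>e. e \<in> E \<Longrightarrow> d (l e) = g e"
    by auto
  have tc: "t e x \<in> carrier S" if "e \<in> E" "x \<in> carrier F" for e x
    using lin.closed[OF t[OF that(1)] that(2)] by simp
  have Ec: "e \<in> carrier F" if "e \<in> E" for e using E that by auto
  define G where "G x = (\<Oplus>\<^bsub>L\<^esub>e\<in>E. t e x \<odot>\<^bsub>L\<^esub> l e)" for x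
  have "lin S F L G"
  proof (rule linI)
    show "G x \<in> carrier L" if "x \<in> carrier F" for x
      using that tc l unfolding G_def by (intro d.M.finsum_closed) auto
    show "G (x \<oplus>\<^bsub>F\<^esub> y) = G x \<oplus>\<^bsub>L\<^esub> G y" if x: "x \<in> carrier F" and y: "y \<in> carrier F" for x y
    proof -
      have "G x \<oplus>\<^bsub>L\<^esub> G y = (\<Oplus>\<^bsub>L\<^esub>e\<in>E. t e x \<odot>\<^bsub>L\<^esub> l e \<oplus>\<^bsub>L\<^esub> t e y \<odot>\<^bsub>L\<^esub> l e)"
        using tc l x y unfolding G_def by (intro d.M.finsum_addf[symmetric]) auto
      also have "\<dots> = G (x \<oplus>\<^bsub>F\<^esub> y)"
        unfolding G_def using tc l x y lin.add[OF t x y]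
        by (intro d.M.finsum_cong') (auto simp: d.M.smult_l_distr)
      finally show ?thesis by simp
    qed
    show "G (a \<odot>\<^bsub>F\<^esub> x) = a \<odot>\<^bsub>L\<^esub> G x" if a: "a \<in> carrier S" and x: "x \<in> carrier F" for a x
    proof -
      have "a \<odot>\<^bsub>L\<^esub> G x = (\<Oplus>\<^bsub>L\<^esub>e\<in>E. a \<odot>\<^bsub>L\<^esub> (t e x \<odot>\<^bsub>L\<^esub> l e))"
        using tc l x a E unfolding G_def by (intro d.M.finsum_smult_ldistr) auto
      also have "\<dots> = G (a \<odot>\<^bsub>F\<^esub> x)"
        unfolding G_def using tc l x a lin.smult[OF t a x]
        by (intro d.M.finsum_cong') (auto simp: d.M.smult_assoc1)
      finally show ?thesis by simp
    qed
  qed (intro d.M.module_axioms g.M.module_axioms)+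
  moreover have "d (G x) = g x" if x: "x \<in> carrier F" for x
  proof -
    have "d (G x) = (\<Oplus>\<^bsub>Z\<^esub>e\<in>E. d (t e x \<odot>\<^bsub>L\<^esub> l e))"
      unfolding G_def using tc l x by (intro d.finsum) auto
    also have "\<dots> = (\<Oplus>\<^bsub>Z\<^esub>e\<in>E. g (t e x \<odot>\<^bsub>F\<^esub> e))"
      using tc l x Ec by (intro d.N.finsum_cong') auto
    also have "\<dots> = g (\<Oplus>\<^bsub>F\<^esub>e\<in>E. t e x \<odot>\<^bsub>F\<^esub> e)"
      using tc x Ec by (intro g.finsum[symmetric]) auto
    finally show ?thesis using span[OF x] by simp
  qed
  ultimately show thesis by (rule that)
qed

text \<open>
  Since the coordinate functions map \<open>IF\<close> into \<open>I\<close>, membership in \<open>IF\<close> can be tested on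
  coordinates, where the hypothesis on \<open>a\<close> applies.
\<close>

lemma free_regular_element:
  fixes S :: "('a, 'c) ring_scheme" (structure) and F :: "('a, 'm) module"
  assumes free: "fg_free S F" and I: "ideal I S" and a: "a \<in> carrier S"
    and reg: "\<And>b. b \<in> carrier S \<Longrightarrow> a \<otimes> b \<in> I \<Longrightarrow> b \<in> I"
    and x: "x \<in> carrier F" and ax: "a \<odot>\<^bsub>F\<^esub> x \<in> ideal_mod S I F"
  shows "x \<in> ideal_mod S I F"
proof -
  interpret F: smod S F by (rule smodI[OF fg_free_module[OF free]])
  interpret I: ideal I S by fact
  have IS: "I \<subseteq> carrier S" by (rule I.a_subset)
  obtain E t where "coordinates S F E (\<lambda>e. e) t" by (rule fg_free_coordinates[OF free])
  then have E: "finite E" "E \<subseteq> carrier F" and t: "\<And>e. e \<in> E \<Longrightarrow> lin S F (regular_module S) (t e)"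
    and span: "x = (\<Oplus>\<^bsub>F\<^esub>e\<in>E. t e x \<odot>\<^bsub>F\<^esub> e)"
    using x unfolding coordinates_def by auto
  have "t e x \<odot>\<^bsub>F\<^esub> e \<in> ideal_mod S I F" if e: "e \<in> E" for e
  proof -
    interpret te: lin S F "regular_module S" "t e" by (rule t[OF e])
    have "submodule I S (regular_module S)"
    proof (rule te.N.submoduleI)
      show "\<ominus>\<^bsub>regular_module S\<^esub> y \<in> I" if "y \<in> I" for y
      proof -
        have "\<ominus>\<^bsub>regular_module S\<^esub> y = \<ominus>\<^bsub>S\<^esub> y"
          using that IS by (intro te.N.minus_equality) (auto simp: subset_iff F.R.l_neg)
        then show ?thesis using that by simp
      qed
    qed (use IS in \<open>auto simp: I.I_l_closed\<close>)
    then have "ideal_mod S I (regular_module S) \<subseteq> I"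
      by (rule te.N.ideal_mod_least) (auto simp: I.I_r_closed)
    with te.ideal_mod_image[OF IS ax] te.smult[OF a x] have "a \<otimes> t e x \<in> I" by auto
    with reg[of "t e x"] te.closed[OF x] have "t e x \<in> I" by simp
    then show ?thesis using e E by (auto intro: F.ideal_mod_smult)
  qed
  then have "(\<Oplus>\<^bsub>F\<^esub>e\<in>E. t e x \<odot>\<^bsub>F\<^esub> e) \<in> ideal_mod S I F"
    by (intro F.ideal_mod_finsum IS) auto
  with span show ?thesis by simp
qed

section \<open>The Koszul differential\<close>

context smod
begin

lemma signed_closed [simp]: "x \<in> carrier M \<Longrightarrow> signed M k x \<in> carrier M"
  by (simp add: signed_def)

lemma signed_0 [simp]: "signed M 0 x = x"
  by (simp add: signed_def)

lemma signed_zero [simp]: "signed M k \<zero>\<^bsub>M\<^esub> = \<zero>\<^bsub>M\<^esub>"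
  by (simp add: signed_def)

lemma signed_Suc: "x \<in> carrier M \<Longrightarrow> signed M (Suc k) x = \<ominus>\<^bsub>M\<^esub> signed M k x"
  by (simp add: signed_def)

end

lemma lin_signed: "lin S M N \<phi> \<Longrightarrow> lin S M N (\<lambda>x. signed N k (\<phi> x))"
  unfolding signed_def by (cases "even k") (simp_all add: lin_neg_map)

lemma (in lin) signed [simp]: "x \<in> carrier M \<Longrightarrow> \<phi> (signed M k x) = signed N k (\<phi> x)"
  by (simp add: signed_def)

text \<open>
  The Koszul part of the differential of \<open>koszul_tensor\<close>, acting on families in one fixed module
  \<open>N\<close>. No degree is attached to such a family; the homological degree enters later, through the
  term of a complex that is substituted for \<open>N\<close>.
\<close>

definition koszul_diff ::
  "('a, 'm) module \<Rightarrow> (nat \<Rightarrow> 'a) \<Rightarrow> nat \<Rightarrow> (nat set \<Rightarrow> 'm) \<Rightarrow> nat set \<Rightarrow> 'm" where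
  "koszul_diff N f p x I =
     (\<Oplus>\<^bsub>N\<^esub>j\<in>{1..p} - I. signed N (card {k\<in>I. k < j}) (f j \<odot>\<^bsub>N\<^esub> x (insert j I)))"

locale koszul = smod +
  fixes f :: "nat \<Rightarrow> 'a" and p :: nat
  assumes f: "\<And>j. j \<in> {1..p} \<Longrightarrow> f j \<in> carrier S"
begin

abbreviation kd where "kd \<equiv> koszul_diff M f p"

lemma kd_term_closed:
  "(\<And>j. j \<in> {1..p} - I \<Longrightarrow> x (insert j I) \<in> carrier M) \<Longrightarrow>
   (\<lambda>j. signed M (card {k\<in>I. k < j}) (f j \<odot>\<^bsub>M\<^esub> x (insert j I))) \<in> {1..p} - I \<rightarrow> carrier M"
  using f by auto

lemma kd_closed:
  "(\<And>j. j \<in> {1..p} - I \<Longrightarrow> x (insert j I) \<in> carrier M) \<Longrightarrow> kd x I \<in> carrier M"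
  unfolding koszul_diff_def by (intro finsum_closed kd_term_closed)

lemma kd_cong:
  assumes "\<And>j. j \<in> {1..p} - I \<Longrightarrow> x (insert j I) = y (insert j I)"
    and "\<And>j. j \<in> {1..p} - I \<Longrightarrow> y (insert j I) \<in> carrier M"
  shows "kd x I = kd y I"
  unfolding koszul_diff_def using assms kd_term_closed[of I y]
  by (intro finsum_cong') auto

lemma kd_zero:
  assumes "\<And>j. j \<in> {1..p} - I \<Longrightarrow> x (insert j I) = \<zero>\<^bsub>M\<^esub>"
  shows "kd x I = \<zero>\<^bsub>M\<^esub>"
proof -
  have "kd x I = (\<Oplus>\<^bsub>M\<^esub>j\<in>{1..p} - I. \<zero>\<^bsub>M\<^esub>)"
    unfolding koszul_diff_def using assms f by (intro finsum_cong') auto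
  then show ?thesis by simp
qed

lemma kd_add:
  assumes "\<And>j. j \<in> {1..p} - I \<Longrightarrow> x (insert j I) \<in> carrier M"
    and "\<And>j. j \<in> {1..p} - I \<Longrightarrow> y (insert j I) \<in> carrier M"
  shows "kd (\<lambda>J. x J \<oplus>\<^bsub>M\<^esub> y J) I = kd x I \<oplus>\<^bsub>M\<^esub> kd y I"
proof -
  have "signed M k (f j \<odot>\<^bsub>M\<^esub> (x (insert j I) \<oplus>\<^bsub>M\<^esub> y (insert j I))) =
      signed M k (f j \<odot>\<^bsub>M\<^esub> x (insert j I)) \<oplus>\<^bsub>M\<^esub> signed M k (f j \<odot>\<^bsub>M\<^esub> y (insert j I))"
    if "j \<in> {1..p} - I" for j k
    using that assms f by (simp add: smult_r_distr signed_def minus_add)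
  then have "kd (\<lambda>J. x J \<oplus>\<^bsub>M\<^esub> y J) I = (\<Oplus>\<^bsub>M\<^esub>j\<in>{1..p} - I.
      signed M (card {k\<in>I. k < j}) (f j \<odot>\<^bsub>M\<^esub> x (insert j I)) \<oplus>\<^bsub>M\<^esub>
      signed M (card {k\<in>I. k < j}) (f j \<odot>\<^bsub>M\<^esub> y (insert j I)))"
    unfolding koszul_diff_def using assms f by (intro finsum_cong') auto
  also have "\<dots> = kd x I \<oplus>\<^bsub>M\<^esub> kd y I"
    unfolding koszul_diff_def using assms by (intro finsum_addf kd_term_closed)
  finally show ?thesis .
qed

lemma kd_mem_ideal_mod:
  assumes I: "I \<subseteq> carrier S" and fI: "\<And>j. j \<in> {1..p} \<Longrightarrow> f j \<in> I"
    and x: "\<And>j. j \<in> {1..p} - J \<Longrightarrow> x (insert j J) \<in> carrier M"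
  shows "kd x J \<in> ideal_mod S I M"
  unfolding koszul_diff_def
proof (intro ideal_mod_finsum I Pi_I)
  fix j assume j: "j \<in> {1..p} - J"
  then have "f j \<odot>\<^bsub>M\<^esub> x (insert j J) \<in> ideal_mod S I M" using fI x by (intro ideal_mod_smult) auto
  then show "signed M (card {k\<in>J. k < j}) (f j \<odot>\<^bsub>M\<^esub> x (insert j J)) \<in> ideal_mod S I M"
    using I by (simp add: signed_def ideal_mod_neg)
qed

end

lemma (in lin) koszul_diff:
  assumes f: "\<And>j. j \<in> {1..p} \<Longrightarrow> f j \<in> carrier S"
    and x: "\<And>j. j \<in> {1..p} - I \<Longrightarrow> x (insert j I) \<in> carrier M"
  shows "\<phi> (koszul_diff M f p x I) = koszul_diff N f p (\<lambda>J. \<phi> (x J)) I"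
proof -
  interpret koszul S M f p by unfold_locales (rule f)
  have "\<phi> (koszul_diff M f p x I) = (\<Oplus>\<^bsub>N\<^esub>j\<in>{1..p} - I. \<phi> (signed M (card {k\<in>I. k < j}) (f j \<odot>\<^bsub>M\<^esub> x (insert j I))))"
    unfolding koszul_diff_def using x by (intro finsum kd_term_closed)
  also have "\<dots> = koszul_diff N f p (\<lambda>J. \<phi> (x J)) I"
    unfolding koszul_diff_def using x f by (intro N.finsum_cong') auto
  finally show ?thesis .
qed

context smod
begin

lemma koszulI: "(\<And>j. j \<in> {1..p} \<Longrightarrow> f j \<in> carrier S) \<Longrightarrow> koszul S M f p"
  by unfold_locales

lemma koszul_diff_Suc:
  assumes f: "\<And>j. j \<in> {1..Suc p} \<Longrightarrow> f j \<in> carrier S"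
    and x: "\<And>j. j \<in> {1..Suc p} - I \<Longrightarrow> x (insert j I) \<in> carrier M"
  shows "koszul_diff M f (Suc p) x I =
    (if Suc p \<in> I then koszul_diff M f p x I
     else signed M (card {k\<in>I. k < Suc p}) (f (Suc p) \<odot>\<^bsub>M\<^esub> x (insert (Suc p) I)) \<oplus>\<^bsub>M\<^esub> koszul_diff M f p x I)"
proof (cases "Suc p \<in> I")
  case True
  then have "{1..Suc p} - I = {1..p} - I" by (auto simp: le_Suc_eq)
  then show ?thesis using True by (simp add: koszul_diff_def)
next
  case False
  then have *: "{1..Suc p} - I = insert (Suc p) ({1..p} - I)" by auto
  have "(\<lambda>j. signed M (card {k\<in>I. k < j}) (f j \<odot>\<^bsub>M\<^esub> x (insert j I))) \<in> {1..p} - I \<rightarrow> carrier M"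
    using f x by auto
  moreover have "f (Suc p) \<odot>\<^bsub>M\<^esub> x (insert (Suc p) I) \<in> carrier M"
    using f x False by auto
  moreover have "finite ({1..p} - I)" "Suc p \<notin> {1..p} - I" by auto
  ultimately show ?thesis
    using False unfolding koszul_diff_def * by (subst finsum_insert) auto
qed

lemma koszul_diff_insert_last:
  assumes f: "\<And>j. j \<in> {1..p} \<Longrightarrow> f j \<in> carrier S"
    and x: "\<And>j. j \<in> {1..p} - I \<Longrightarrow> x (insert (Suc p) (insert j I)) \<in> carrier M"
  shows "koszul_diff M f p x (insert (Suc p) I) = koszul_diff M f p (\<lambda>J. x (insert (Suc p) J)) I"
proof -
  have 1: "{1..p} - insert (Suc p) I = {1..p} - I" by auto
  have 2: "{k \<in> insert (Suc p) I. k < j} = {k\<in>I. k < j}" if "j \<le> p" for j using that by auto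
  show ?thesis
    unfolding koszul_diff_def
  proof (intro finsum_cong' 1)
    show "signed M (card {k \<in> insert (Suc p) I. k < j}) (f j \<odot>\<^bsub>M\<^esub> x (insert j (insert (Suc p) I))) =
        signed M (card {k\<in>I. k < j}) (f j \<odot>\<^bsub>M\<^esub> x (insert (Suc p) (insert j I)))" if "j \<in> {1..p} - I" for j
      using that 2[of j] by (simp only: insert_commute[of j]) auto
  qed (use f x in auto)
qed

text \<open>
  Splitting off the last index \<open>q\<close>, the terms of \<open>\<partial>\<^sup>2\<close> that contain \<open>f\<^sub>q\<close> come in pairs
  of opposite sign, as removing \<open>j < q\<close> before \<open>q\<close> shifts the position of \<open>q\<close> by one.
\<close>

lemma koszul_diff_koszul_diff:
  assumes f: "\<And>j. j \<in> {1..p} \<Longrightarrow> f j \<in> carrier S" and "finite I"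
    and x: "\<And>j k. j \<in> {1..p} - I \<Longrightarrow> k \<in> {1..p} - insert j I \<Longrightarrow> x (insert k (insert j I)) \<in> carrier M"
  shows "koszul_diff M f p (koszul_diff M f p x) I = \<zero>\<^bsub>M\<^esub>"
  using f x
proof (induction p)
  case 0
  then show ?case by (simp add: koszul_diff_def)
next
  case (Suc p)
  let ?q = "Suc p" and ?y = "koszul_diff M f (Suc p) x"
  interpret q: koszul S M f ?q by (rule koszulI) (rule Suc.prems)
  interpret p: koszul S M f p by (rule koszulI) (use Suc.prems in auto)
  have fq: "f ?q \<in> carrier S" using Suc.prems by auto
  have y: "?y (insert j I) \<in> carrier M" if "j \<in> {1..?q} - I" for j
    using Suc.prems that by (intro q.kd_closed) auto
  have IH: "p.kd (p.kd x) I = \<zero>\<^bsub>M\<^esub>"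
    using Suc.prems by (intro Suc.IH) auto
  have pc: "p.kd x (insert j I) \<in> carrier M" if "j \<in> {1..p} - I" for j
    using Suc.prems that by (intro p.kd_closed) auto
  show ?case
  proof (cases "?q \<in> I")
    case True
    have "q.kd ?y I = p.kd ?y I"
      using True y Suc.prems(1) by (subst koszul_diff_Suc) auto
    also have "\<dots> = p.kd (p.kd x) I"
    proof (rule p.kd_cong)
      show "p.kd x (insert j I) \<in> carrier M" if "j \<in> {1..p} - I" for j
        using that by (rule pc)
      show "?y (insert j I) = p.kd x (insert j I)" if "j \<in> {1..p} - I" for j
        using True that Suc.prems by (subst koszul_diff_Suc) auto
    qed
    finally show ?thesis using IH by simp
  next
    case False
    define s where "s = card {k\<in>I. k < ?q}"
    define z where "z = f ?q \<odot>\<^bsub>M\<^esub> p.kd (\<lambda>J. x (insert ?q J)) I"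
    have xq: "x (insert ?q (insert j I)) \<in> carrier M" if "j \<in> {1..p} - I" for j
      using Suc.prems(2)[of j ?q] that False by auto
    have zM: "z \<in> carrier M"
      unfolding z_def using fq xq by (intro smult_closed p.kd_closed) auto
    have yq: "?y (insert ?q I) = p.kd (\<lambda>J. x (insert ?q J)) I"
    proof -
      have "?y (insert ?q I) = p.kd x (insert ?q I)"
        using Suc.prems False by (subst koszul_diff_Suc) auto
      also have "\<dots> = p.kd (\<lambda>J. x (insert ?q J)) I"
        using Suc.prems(1) xq by (intro koszul_diff_insert_last) auto
      finally show ?thesis .
    qed
    have "p.kd ?y I = p.kd (\<lambda>J. signed M (Suc s) (f ?q \<odot>\<^bsub>M\<^esub> x (insert ?q J)) \<oplus>\<^bsub>M\<^esub> p.kd x J) I"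
    proof (rule p.kd_cong)
      fix j assume j: "j \<in> {1..p} - I"
      have "{k \<in> insert j I. k < ?q} = insert j {k\<in>I. k < ?q}" using j by auto
      then have "card {k \<in> insert j I. k < ?q} = Suc s"
        using j \<open>finite I\<close> by (simp add: s_def)
      moreover have "?q \<notin> insert j I" using j False by auto
      ultimately show "?y (insert j I) =
          signed M (Suc s) (f ?q \<odot>\<^bsub>M\<^esub> x (insert ?q (insert j I))) \<oplus>\<^bsub>M\<^esub> p.kd x (insert j I)"
        using j Suc.prems by (subst koszul_diff_Suc) auto
    qed (use fq xq pc in auto)
    also have "\<dots> = p.kd (\<lambda>J. signed M (Suc s) (f ?q \<odot>\<^bsub>M\<^esub> x (insert ?q J))) I \<oplus>\<^bsub>M\<^esub> p.kd (p.kd x) I"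
      using fq xq pc by (intro p.kd_add) auto
    also have "p.kd (\<lambda>J. signed M (Suc s) (f ?q \<odot>\<^bsub>M\<^esub> x (insert ?q J))) I = signed M (Suc s) z"
    proof -
      have "lin S M M (\<lambda>u. signed M (Suc s) (f ?q \<odot>\<^bsub>M\<^esub> u))"
        using fq by (intro lin_signed lin_smult_map module_axioms)
      from lin.koszul_diff[OF this, of p f I "\<lambda>J. x (insert ?q J)"] show ?thesis
        using xq Suc.prems(1) by (simp add: z_def)
    qed
    finally have py: "p.kd ?y I = signed M (Suc s) z"
      using IH zM by simp
    have "q.kd ?y I = signed M s z \<oplus>\<^bsub>M\<^esub> p.kd ?y I"
      using False y Suc.prems(1) by (subst koszul_diff_Suc) (auto simp: yq s_def z_def)
    then show ?thesis
      using py zM by (simp add: signed_Suc r_neg)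
  qed
qed

end

section \<open>Exactness of the Koszul complex\<close>

lemma seq_ideal_ideal:
  assumes "cring S" and "\<And>j. j \<in> {1..p} \<Longrightarrow> f j \<in> carrier S"
  shows "ideal (seq_ideal S f p) S"
proof -
  interpret cring S by fact
  show ?thesis unfolding seq_ideal_def using assms(2) by (intro genideal_ideal) auto
qed

lemma seq_ideal_subset:
  assumes "cring S" and "\<And>j. j \<in> {1..p} \<Longrightarrow> f j \<in> carrier S"
  shows "seq_ideal S f p \<subseteq> carrier S"
  using ideal.axioms(1)[OF seq_ideal_ideal[of S p f, OF assms]] additive_subgroup.a_subset by blast

lemma seq_ideal_mem:
  assumes "cring S" and "\<And>j. j \<in> {1..p} \<Longrightarrow> f j \<in> carrier S" and "j \<in> {1..p}"
  shows "f j \<in> seq_ideal S f p"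
proof -
  interpret cring S by fact
  have "f ` {1..p} \<subseteq> carrier S" using assms(2) by auto
  from genideal_self[OF this] show ?thesis using assms(3) unfolding seq_ideal_def by auto
qed

lemma seq_ideal_mono:
  assumes "cring S" and "\<And>j. j \<in> {1..q} \<Longrightarrow> f j \<in> carrier S" and "p \<le> q"
  shows "seq_ideal S f p \<subseteq> seq_ideal S f q"
proof -
  interpret cring S by fact
  show ?thesis
    unfolding seq_ideal_def[of S f p] using assms seq_ideal_mem[of S q f, OF assms(1,2)]
    by (intro genideal_minimal seq_ideal_ideal) auto
qed

context smod
begin

lemma submodule_closed_under_ideal:
  assumes f: "\<And>j. j \<in> {1..p} \<Longrightarrow> f j \<in> carrier S" and Y: "submodule Y S M"
    and "\<And>j x. j \<in> {1..p} \<Longrightarrow> x \<in> carrier M \<Longrightarrow> f j \<odot>\<^bsub>M\<^esub> x \<in> Y"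
  shows "ideal_mod S (seq_ideal S f p) M \<subseteq> Y"
proof (rule ideal_mod_least[OF Y])
  let ?I = "{a \<in> carrier S. \<forall>x\<in>carrier M. a \<odot>\<^bsub>M\<^esub> x \<in> Y}"
  have "ideal ?I S"
  proof (rule idealI)
    show "subgroup ?I (add_monoid S)"
      by (rule subgroup.intro)
        (auto simp: smult_l_distr smult_l_minus submoduleE[OF Y] submodule_zero_mem[OF Y]
          simp flip: a_inv_def)
    show "x \<otimes> a \<in> ?I" "a \<otimes> x \<in> ?I" if "a \<in> ?I" "x \<in> carrier S" for a x
      using that by (auto simp: smult_assoc1 submoduleE(4)[OF Y])
  qed (rule R.ring_axioms)
  moreover have "f ` {1..p} \<subseteq> ?I" using assms by auto
  ultimately have "seq_ideal S f p \<subseteq> ?I"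
    unfolding seq_ideal_def by (rule R.genideal_minimal)
  then show "a \<odot>\<^bsub>M\<^esub> x \<in> Y" if "a \<in> seq_ideal S f p" "x \<in> carrier M" for a x
    using that by auto
qed

lemma ideal_mod_seq_0: "ideal_mod S (seq_ideal S f 0) M = {\<zero>\<^bsub>M\<^esub>}"
proof -
  have "ideal_mod S (seq_ideal S f 0) M \<subseteq> {\<zero>\<^bsub>M\<^esub>}"
    by (rule submodule_closed_under_ideal) (auto intro: singleton_zero_submodule)
  moreover have "seq_ideal S f 0 \<subseteq> carrier S"
    by (rule seq_ideal_subset) (auto intro: R.cring_axioms)
  ultimately show ?thesis using ideal_mod_zero by blast
qed

lemma ideal_mod_mono: "I \<subseteq> J \<Longrightarrow> ideal_mod S I M \<subseteq> ideal_mod S J M"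
  by (auto simp: ideal_mod_def)

lemma ideal_mod_seq_Suc:
  assumes f: "\<And>j. j \<in> {1..Suc p} \<Longrightarrow> f j \<in> carrier S"
    and u: "u \<in> ideal_mod S (seq_ideal S f (Suc p)) M"
  obtains w v where "w \<in> ideal_mod S (seq_ideal S f p) M" "v \<in> carrier M"
    "u = w \<oplus>\<^bsub>M\<^esub> f (Suc p) \<odot>\<^bsub>M\<^esub> v"
proof -
  let ?I = "ideal_mod S (seq_ideal S f p) M"
  let ?Y = "{u. \<exists>w v. w \<in> ?I \<and> v \<in> carrier M \<and> u = w \<oplus>\<^bsub>M\<^esub> f (Suc p) \<odot>\<^bsub>M\<^esub> v}"
  have fp: "f (Suc p) \<in> carrier S" and f': "\<And>j. j \<in> {1..p} \<Longrightarrow> f j \<in> carrier S" using f by auto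
  have I: "seq_ideal S f p \<subseteq> carrier S" by (rule seq_ideal_subset[of S p f, OF R.cring_axioms f'])
  note Ic = ideal_mod_closed[OF I]
  have "submodule ?Y S M"
  proof (rule submoduleI)
    show "?Y \<subseteq> carrier M" using fp Ic by auto
    show "\<zero>\<^bsub>M\<^esub> \<in> ?Y" using fp ideal_mod_zero[OF I] by (force intro: exI[of _ "\<zero>\<^bsub>M\<^esub>"])
    show "\<ominus>\<^bsub>M\<^esub> a \<in> ?Y" if "a \<in> ?Y" for a
    proof -
      from that obtain w v where "w \<in> ?I" "v \<in> carrier M" "a = w \<oplus>\<^bsub>M\<^esub> f (Suc p) \<odot>\<^bsub>M\<^esub> v" by auto
      then have "\<ominus>\<^bsub>M\<^esub> a = \<ominus>\<^bsub>M\<^esub> w \<oplus>\<^bsub>M\<^esub> f (Suc p) \<odot>\<^bsub>M\<^esub> \<ominus>\<^bsub>M\<^esub> v" "\<ominus>\<^bsub>M\<^esub> w \<in> ?I" "\<ominus>\<^bsub>M\<^esub> v \<in> carrier M"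
        using fp Ic ideal_mod_neg[OF I] by (auto simp: minus_add smult_r_minus)
      then show ?thesis by blast
    qed
    show "a \<oplus>\<^bsub>M\<^esub> b \<in> ?Y" if "a \<in> ?Y" "b \<in> ?Y" for a b
    proof -
      from that obtain w v w' v' where "w \<in> ?I" "v \<in> carrier M" "a = w \<oplus>\<^bsub>M\<^esub> f (Suc p) \<odot>\<^bsub>M\<^esub> v"
        "w' \<in> ?I" "v' \<in> carrier M" "b = w' \<oplus>\<^bsub>M\<^esub> f (Suc p) \<odot>\<^bsub>M\<^esub> v'" by auto
      then have "a \<oplus>\<^bsub>M\<^esub> b = (w \<oplus>\<^bsub>M\<^esub> w') \<oplus>\<^bsub>M\<^esub> f (Suc p) \<odot>\<^bsub>M\<^esub> (v \<oplus>\<^bsub>M\<^esub> v')" "w \<oplus>\<^bsub>M\<^esub> w' \<in> ?I" "v \<oplus>\<^bsub>M\<^esub> v' \<in> carrier M"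
        using fp Ic ideal_mod_add[OF I] by (auto simp: smult_r_distr a_ac)
      then show ?thesis by blast
    qed
    show "a \<odot>\<^bsub>M\<^esub> b \<in> ?Y" if "a \<in> carrier S" "b \<in> ?Y" for a b
    proof -
      from that obtain w v where "w \<in> ?I" "v \<in> carrier M" "b = w \<oplus>\<^bsub>M\<^esub> f (Suc p) \<odot>\<^bsub>M\<^esub> v" by auto
      then have "a \<odot>\<^bsub>M\<^esub> b = a \<odot>\<^bsub>M\<^esub> w \<oplus>\<^bsub>M\<^esub> f (Suc p) \<odot>\<^bsub>M\<^esub> (a \<odot>\<^bsub>M\<^esub> v)" "a \<odot>\<^bsub>M\<^esub> w \<in> ?I" "a \<odot>\<^bsub>M\<^esub> v \<in> carrier M"
        using that(1) fp Ic ideal_mod_scale[OF I] by (auto simp: smult_r_distr R.m_comm simp flip: smult_assoc1)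
      then show ?thesis by blast
    qed
  qed
  moreover have "f j \<odot>\<^bsub>M\<^esub> x \<in> ?Y" if j: "j \<in> {1..Suc p}" and x: "x \<in> carrier M" for j x
  proof (cases "j = Suc p")
    case True
    have "f j \<odot>\<^bsub>M\<^esub> x = \<zero>\<^bsub>M\<^esub> \<oplus>\<^bsub>M\<^esub> f (Suc p) \<odot>\<^bsub>M\<^esub> x" using True fp x by simp
    then show ?thesis using ideal_mod_zero[OF I] x by blast
  next
    case False
    then have "j \<in> {1..p}" using j by auto
    then have *: "f j \<odot>\<^bsub>M\<^esub> x \<in> ?I" using x by (intro ideal_mod_smult seq_ideal_mem[of S p f, OF R.cring_axioms f'])
    moreover have "f j \<odot>\<^bsub>M\<^esub> x = f j \<odot>\<^bsub>M\<^esub> x \<oplus>\<^bsub>M\<^esub> f (Suc p) \<odot>\<^bsub>M\<^esub> \<zero>\<^bsub>M\<^esub>" using fp Ic[OF *] by simp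
    ultimately show ?thesis by blast
  qed
  ultimately have "ideal_mod S (seq_ideal S f (Suc p)) M \<subseteq> ?Y"
    using f by (intro submodule_closed_under_ideal) auto
  with u show thesis using that by blast
qed

end

context smod
begin

text \<open>
  The Koszul complex of \<open>f\<^sub>1, \<dots>, f\<^sub>q\<close> is the mapping cone of multiplication by \<open>f\<^sub>q\<close> on the Koszul
  complex of \<open>f\<^sub>1, \<dots>, f\<^bsub>q-1\<^esub>\<close>, which allows an induction on the length. Let \<open>xq\<close> be the coefficient of
  \<open>e\<^sub>q\<close> in a cycle \<open>x\<close>. It is a cycle, and regularity puts its degree zero component into
  \<open>(f\<^sub>1, \<dots>, f\<^bsub>q-1\<^esub>)M\<close>; hence it is the boundary of some \<open>y1\<close>, and what remains of \<open>x\<close> after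
  subtracting the boundary of \<open>e\<^sub>q \<otimes> y1\<close> is a shorter cycle \<open>t\<close>. Families of mixed degree are
  treated at once, so exactness in positive degrees takes the form that a cycle is a boundary
  if its component of degree zero is zero in the zeroth homology.
\<close>

lemma koszul_exact:
  assumes f: "\<And>j. j \<in> {1..p} \<Longrightarrow> f j \<in> carrier S"
    and reg: "\<And>q x. q < p \<Longrightarrow> x \<in> carrier M \<Longrightarrow>
      f (Suc q) \<odot>\<^bsub>M\<^esub> x \<in> ideal_mod S (seq_ideal S f q) M \<Longrightarrow> x \<in> ideal_mod S (seq_ideal S f q) M"
    and x: "\<And>I. I \<subseteq> {1..p} \<Longrightarrow> x I \<in> carrier M"
    and cyc: "\<And>I. I \<subseteq> {1..p} \<Longrightarrow> koszul_diff M f p x I = \<zero>\<^bsub>M\<^esub>"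
    and x0: "x {} \<in> ideal_mod S (seq_ideal S f p) M"
  shows "\<exists>y. (\<forall>I. I \<subseteq> {1..p} \<longrightarrow> y I \<in> carrier M \<and> koszul_diff M f p y I = x I)"
  using assms
proof (induction p arbitrary: x)
  case 0
  then have "x {} = \<zero>\<^bsub>M\<^esub>" by (simp add: ideal_mod_seq_0)
  then show ?case
    by (intro exI[of _ "\<lambda>_. \<zero>\<^bsub>M\<^esub>"]) (auto simp: koszul_diff_def)
next
  case (Suc p)
  let ?q = "Suc p" and ?I = "ideal_mod S (seq_ideal S f p) M"
  interpret p: koszul S M f p by (rule koszulI) (use Suc.prems in auto)
  have f': "\<And>j. j \<in> {1..p} \<Longrightarrow> f j \<in> carrier S" and fq: "f ?q \<in> carrier S" using Suc.prems(1) by auto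
  have sub: "seq_ideal S f p \<subseteq> carrier S" by (rule seq_ideal_subset[of S p f, OF R.cring_axioms f'])
  have reg': "\<And>q x. q < p \<Longrightarrow> x \<in> carrier M \<Longrightarrow>
      f (Suc q) \<odot>\<^bsub>M\<^esub> x \<in> ideal_mod S (seq_ideal S f q) M \<Longrightarrow> x \<in> ideal_mod S (seq_ideal S f q) M"
    by (rule Suc.prems(2)) auto
  define s where "s I = card {k\<in>I. k < ?q}" for I
  have s_insert: "s (insert j I) = Suc (s I)" if "I \<subseteq> {1..p}" "j \<in> {1..p} - I" for I j
  proof -
    have "{k \<in> insert j I. k < ?q} = insert j {k\<in>I. k < ?q}" using that by auto
    moreover have "finite I" using that by (auto intro: finite_subset)
    ultimately show ?thesis using that by (simp add: s_def)
  qed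
  have xM: "x I \<in> carrier M" if "I \<subseteq> {1..?q}" for I using that by (rule Suc.prems(3))
  have ins: "insert j I \<subseteq> {1..p}" if "j \<in> {1..p} - I" "I \<subseteq> {1..p}" for I j using that by auto
  have up: "I \<subseteq> {1..?q}" if "I \<subseteq> {1..p}" for I using that by fastforce
  have upq: "insert ?q I \<subseteq> {1..?q}" if "I \<subseteq> {1..p}" for I using that by fastforce
  have nq: "?q \<notin> I" if "I \<subseteq> {1..p}" for I using that by fastforce
  define xq where "xq I = x (insert ?q I)" for I
  have xqM: "xq I \<in> carrier M" if "I \<subseteq> {1..p}" for I
    unfolding xq_def by (rule xM[OF upq[OF that]])
  have last: "koszul_diff M f ?q x (insert ?q I) = p.kd xq I" if "I \<subseteq> {1..p}" for I
  proof -
    have "koszul_diff M f ?q x (insert ?q I) = p.kd x (insert ?q I)"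
      using that by (subst koszul_diff_Suc) (auto intro!: Suc.prems(1) xM)
    also have "\<dots> = p.kd xq I"
      unfolding xq_def using that f' upq[OF ins] by (intro koszul_diff_insert_last xM) auto
    finally show ?thesis .
  qed
  have first: "koszul_diff M f ?q x I = signed M (s I) (f ?q \<odot>\<^bsub>M\<^esub> xq I) \<oplus>\<^bsub>M\<^esub> p.kd x I" if "I \<subseteq> {1..p}" for I
    using that nq[OF that] by (subst koszul_diff_Suc) (auto simp: xq_def s_def intro!: Suc.prems(1) xM)
  have kx: "p.kd x I \<in> carrier M" if "I \<subseteq> {1..p}" for I
    using that by (intro p.kd_closed xM up ins)
  have "f ?q \<odot>\<^bsub>M\<^esub> xq {} = \<ominus>\<^bsub>M\<^esub> p.kd x {}"
  proof -
    have "f ?q \<odot>\<^bsub>M\<^esub> xq {} \<oplus>\<^bsub>M\<^esub> p.kd x {} = \<zero>\<^bsub>M\<^esub>"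
      using first[of "{}"] Suc.prems(4)[of "{}"] by (simp add: s_def)
    then show ?thesis using fq xqM kx by (intro minus_equality[symmetric]) auto
  qed
  moreover have "p.kd x {} \<in> ?I"
    using xM by (intro p.kd_mem_ideal_mod sub seq_ideal_mem[of S p f, OF R.cring_axioms f']) auto
  ultimately have "f ?q \<odot>\<^bsub>M\<^esub> xq {} \<in> ?I"
    by (simp only: ideal_mod_neg[OF sub])
  then have "xq {} \<in> ?I"
    by (rule Suc.prems(2)[OF lessI xqM[OF empty_subsetI]])
  then have "\<exists>y. \<forall>I. I \<subseteq> {1..p} \<longrightarrow> y I \<in> carrier M \<and> p.kd y I = xq I"
  proof (rule Suc.IH[rotated -1])
    show "p.kd xq I = \<zero>\<^bsub>M\<^esub>" if "I \<subseteq> {1..p}" for I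
      using last[OF that] Suc.prems(4)[OF upq[OF that]] by simp
  qed (fact f' reg' xqM)+
  then obtain y0 where "\<forall>I. I \<subseteq> {1..p} \<longrightarrow> y0 I \<in> carrier M \<and> p.kd y0 I = xq I" by (rule exE)
  then have y0: "\<And>I. I \<subseteq> {1..p} \<Longrightarrow> y0 I \<in> carrier M"
    and dy0: "\<And>I. I \<subseteq> {1..p} \<Longrightarrow> p.kd y0 I = xq I"
    by simp_all
  obtain w v where w: "w \<in> ?I" and v: "v \<in> carrier M" and xwv: "x {} = w \<oplus>\<^bsub>M\<^esub> f ?q \<odot>\<^bsub>M\<^esub> v"
    by (rule ideal_mod_seq_Suc[of p f "x {}", OF Suc.prems(1,5)])
  \<comment> \<open>The component of \<open>y1\<close> at the empty set does not enter its boundary, hence it is free to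
     be chosen so that \<open>t\<close> below is a boundary.\<close>
  define y1 where "y1 I = (if I = {} then v else y0 I)" for I
  have y1: "y1 I \<in> carrier M" if "I \<subseteq> {1..p}" for I using y0 v that by (simp add: y1_def)
  have dy1: "p.kd y1 I = xq I" if "I \<subseteq> {1..p}" for I
  proof -
    have "p.kd y1 I = p.kd y0 I" using that y0 by (intro p.kd_cong) (auto simp: y1_def)
    then show ?thesis using dy0 that by simp
  qed
  define t where "t I = x I \<oplus>\<^bsub>M\<^esub> signed M (Suc (s I)) (f ?q \<odot>\<^bsub>M\<^esub> y1 I)" for I
  have t: "t I \<in> carrier M" if "I \<subseteq> {1..p}" for I
    using xM[OF up[OF that]] y1[OF that] fq by (simp add: t_def)
  have dt: "p.kd t I = \<zero>\<^bsub>M\<^esub>" if I: "I \<subseteq> {1..p}" for I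
  proof -
    let ?z = "f ?q \<odot>\<^bsub>M\<^esub> xq I"
    have z: "?z \<in> carrier M" using fq xqM[OF I] by simp
    have "p.kd t I = p.kd (\<lambda>J. x J \<oplus>\<^bsub>M\<^esub> signed M (s I) (f ?q \<odot>\<^bsub>M\<^esub> y1 J)) I"
      using I fq y1[OF ins] xM[OF up[OF ins]]
      by (intro p.kd_cong) (auto simp: t_def s_insert signed_Suc simp del: insert_subset)
    also have "\<dots> = p.kd x I \<oplus>\<^bsub>M\<^esub> p.kd (\<lambda>J. signed M (s I) (f ?q \<odot>\<^bsub>M\<^esub> y1 J)) I"
      using I fq y1[OF ins] xM[OF up[OF ins]] by (intro p.kd_add) auto
    also have "p.kd (\<lambda>J. signed M (s I) (f ?q \<odot>\<^bsub>M\<^esub> y1 J)) I = signed M (s I) ?z"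
    proof -
      have "lin S M M (\<lambda>u. signed M (s I) (f ?q \<odot>\<^bsub>M\<^esub> u))"
        using fq by (intro lin_signed lin_smult_map module_axioms)
      from lin.koszul_diff[OF this, of p f I y1] show ?thesis
        using y1[OF ins] I f' by (simp add: dy1)
    qed
    also have "p.kd x I \<oplus>\<^bsub>M\<^esub> signed M (s I) ?z = \<zero>\<^bsub>M\<^esub>"
      using first[OF I] Suc.prems(4)[OF up[OF I]] z kx[OF I] by (simp add: a_comm)
    finally show ?thesis .
  qed
  have "t {} = w"
    using w v fq ideal_mod_closed[OF sub w]
    by (simp add: t_def xwv y1_def s_def signed_Suc a_assoc r_neg)
  then have "t {} \<in> ?I" using w by simp
  then have "\<exists>y. \<forall>I. I \<subseteq> {1..p} \<longrightarrow> y I \<in> carrier M \<and> p.kd y I = t I"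
    by (rule Suc.IH[rotated -1]) (fact f' reg' t dt)+
  then obtain y2 where "\<forall>I. I \<subseteq> {1..p} \<longrightarrow> y2 I \<in> carrier M \<and> p.kd y2 I = t I" by (rule exE)
  then have y2: "\<And>I. I \<subseteq> {1..p} \<Longrightarrow> y2 I \<in> carrier M"
    and dy2: "\<And>I. I \<subseteq> {1..p} \<Longrightarrow> p.kd y2 I = t I"
    by simp_all
  define y where "y J = (if ?q \<in> J then y1 (J - {?q}) else y2 J)" for J
  have split: "?q \<in> I \<and> I - {?q} \<subseteq> {1..p} \<or> I \<subseteq> {1..p}" if "I \<subseteq> {1..?q}" for I
    using that by (auto simp: atLeastAtMostSuc_conv)
  have y: "y I \<in> carrier M" if "I \<subseteq> {1..?q}" for I
    using split[OF that] y1 y2 nq by (auto simp: y_def)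
  have "koszul_diff M f ?q y I = x I" if "I \<subseteq> {1..?q}" for I
    using split[OF that]
  proof
    assume "?q \<in> I \<and> I - {?q} \<subseteq> {1..p}"
    then obtain I' where I': "I = insert ?q I'" "I' \<subseteq> {1..p}" by (metis insert_Diff)
    have "koszul_diff M f ?q y I = p.kd y (insert ?q I')"
      unfolding I'(1) using I'(2) by (subst koszul_diff_Suc) (auto intro!: Suc.prems(1) y)
    also have "\<dots> = p.kd (\<lambda>J. y (insert ?q J)) I'"
      using f' upq[OF ins] I'(2) by (intro koszul_diff_insert_last y) auto
    also have "\<dots> = p.kd y1 I'"
    proof (rule p.kd_cong)
      fix j assume "j \<in> {1..p} - I'"
      from nq[OF ins[OF this I'(2)]] show "y (insert ?q (insert j I')) = y1 (insert j I')"
        by (simp add: y_def del: insert_iff) (simp add: insert_Diff_if)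
    qed (use y1 ins I'(2) in auto)
    also have "\<dots> = x I" using dy1[OF I'(2)] I'(1) by (simp add: xq_def)
    finally show ?thesis .
  next
    assume I: "I \<subseteq> {1..p}"
    let ?z = "f ?q \<odot>\<^bsub>M\<^esub> y1 I"
    have z: "?z \<in> carrier M" using fq y1[OF I] by simp
    have "koszul_diff M f ?q y I = signed M (s I) (f ?q \<odot>\<^bsub>M\<^esub> y (insert ?q I)) \<oplus>\<^bsub>M\<^esub> p.kd y I"
      using I nq[OF I] by (subst koszul_diff_Suc) (auto simp: s_def intro!: Suc.prems(1) y)
    also have "y (insert ?q I) = y1 I" using nq[OF I] by (simp add: y_def)
    also have "p.kd y I = p.kd y2 I"
      using nq[OF ins[OF _ I]] y2[OF ins[OF _ I]] by (intro p.kd_cong) (auto simp: y_def simp del: insert_iff)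
    also have "\<dots> = t I" by (rule dy2[OF I])
    also have "signed M (s I) ?z \<oplus>\<^bsub>M\<^esub> t I = x I"
      using z xM[OF up[OF I]] by (simp add: t_def signed_Suc a_lcomm[of "signed M (s I) ?z"] r_neg)
    finally show ?thesis .
  qed
  with y show ?case by (intro exI[of _ y]) simp
qed

end

text \<open>
  Conversely to \<open>kd_mem_ideal_mod\<close>, the elements of \<open>(f\<^sub>1, \<dots>, f\<^sub>p)M\<close> are boundaries in degree zero.
\<close>

lemma ideal_mod_seq_koszul:
  fixes M :: "('a, 'm) module"
  assumes M: "smod S M" and f: "\<And>j. j \<in> {1..p} \<Longrightarrow> f j \<in> carrier S"
    and u: "u \<in> ideal_mod S (seq_ideal S f p) M"
  shows "\<exists>z. (\<forall>I. z I \<in> carrier M) \<and> koszul_diff M f p z {} = u"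
  using f u
proof (induction p arbitrary: u)
  case 0
  interpret M: smod S M by fact
  from 0 have "u = \<zero>\<^bsub>M\<^esub>" by (simp add: M.ideal_mod_seq_0)
  then show ?case by (intro exI[of _ "\<lambda>_. \<zero>\<^bsub>M\<^esub>"]) (simp add: koszul_diff_def)
next
  case (Suc p)
  interpret M: smod S M by fact
  interpret p: koszul S M f p by (rule M.koszulI) (use Suc.prems in auto)
  have fq: "f (Suc p) \<in> carrier S" using Suc.prems by auto
  obtain w v where w: "w \<in> ideal_mod S (seq_ideal S f p) M" and v: "v \<in> carrier M"
    and uwv: "u = w \<oplus>\<^bsub>M\<^esub> f (Suc p) \<odot>\<^bsub>M\<^esub> v"
    by (rule M.ideal_mod_seq_Suc[of p f u, OF Suc.prems])
  have "\<exists>z. (\<forall>I. z I \<in> carrier M) \<and> p.kd z {} = w"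
    by (rule Suc.IH[OF _ w]) (use Suc.prems in auto)
  then obtain z where z: "\<And>I. z I \<in> carrier M" and dz: "p.kd z {} = w" by blast
  define z' where "z' I = (if I = {Suc p} then v else z I)" for I
  have z': "z' I \<in> carrier M" for I using z v by (simp add: z'_def)
  have "p.kd z' {} = p.kd z {}" using z by (intro p.kd_cong) (auto simp: z'_def)
  moreover have "z' {Suc p} = v" by (simp add: z'_def)
  then have "koszul_diff M f (Suc p) z' {} = f (Suc p) \<odot>\<^bsub>M\<^esub> v \<oplus>\<^bsub>M\<^esub> p.kd z' {}"
    using z' Suc.prems by (subst M.koszul_diff_Suc) auto
  moreover have "w \<in> carrier M" using dz p.kd_closed[of "{}" z] z by simp
  ultimately have "koszul_diff M f (Suc p) z' {} = u"
    using fq v dz by (simp add: uwv M.a_comm)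
  with z' show ?case by blast
qed

section \<open>Complexes and Koszul tensor products\<close>

lemma complex_lin: "is_complex S C \<Longrightarrow> lin S (cmod C i) (cmod C (i - 1)) (bdry C i)"
  unfolding is_complex_def by (auto intro!: mod_hom_lin)

lemma complex_lin_eq: "is_complex S C \<Longrightarrow> i - 1 = j \<Longrightarrow> lin S (cmod C i) (cmod C j) (bdry C i)"
  using complex_lin by metis

lemma complex_module: "is_complex S C \<Longrightarrow> module S (cmod C i)"
  unfolding is_complex_def by auto

lemma complex_bdry_bdry:
  "is_complex S C \<Longrightarrow> x \<in> carrier (cmod C i) \<Longrightarrow> bdry C (i - 1) (bdry C i x) = \<zero>\<^bsub>cmod C (i - 2)\<^esub>"
  unfolding is_complex_def by auto

lemma complexI:
  assumes "\<And>i. lin S (cmod C i) (cmod C (i - 1)) (bdry C i)"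
    and "\<And>i x. x \<in> carrier (cmod C i) \<Longrightarrow> bdry C (i - 1) (bdry C i x) = \<zero>\<^bsub>cmod C (i - 2)\<^esub>"
  shows "is_complex S C"
  using assms(2) lin.hom[OF assms(1)] assms(1)
  unfolding is_complex_def by (auto simp: lin_def smod_def)

lemma chain_map_lin:
  "chain_map S C D \<phi> \<Longrightarrow> is_complex S C \<Longrightarrow> is_complex S D \<Longrightarrow> lin S (cmod C i) (cmod D i) (\<phi> i)"
  unfolding chain_map_def by (auto intro!: mod_hom_lin complex_module)

lemma chain_mapI:
  assumes "\<And>i. lin S (cmod C i) (cmod D i) (\<phi> i)"
    and "\<And>i x. x \<in> carrier (cmod C i) \<Longrightarrow> bdry D i (\<phi> i x) = \<phi> (i - 1) (bdry C i x)"
  shows "chain_map S C D \<phi>"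
  using assms unfolding chain_map_def by (auto dest: lin.hom)

lemma koszul_tensor_cmod [simp]:
  "cmod (koszul_tensor f p B) n = direct_sum (Pow {1..p}) (\<lambda>I. cmod B (n - int (card I)))"
  by (simp add: koszul_tensor_def)

lemma koszul_tensor_bdry:
  "bdry (koszul_tensor f p B) n x = (\<lambda>I\<in>Pow {1..p}.
     koszul_diff (cmod B (n - 1 - int (card I))) f p x I \<oplus>\<^bsub>cmod B (n - 1 - int (card I))\<^esub>
     signed (cmod B (n - 1 - int (card I))) (card I) (bdry B (n - int (card I)) (x I)))"
  by (simp add: koszul_tensor_def koszul_diff_def Let_def)

lemma card_insert_index:
  assumes "I \<subseteq> {1..p::nat}" "j \<in> {1..p} - I"
  shows "card (insert j I) = Suc (card I)" and "n - int (card (insert j I)) = n - 1 - int (card I)"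
proof -
  have "finite I" using assms by (auto intro: finite_subset)
  then show "card (insert j I) = Suc (card I)" using assms by simp
  then show "n - int (card (insert j I)) = n - 1 - int (card I)" by simp
qed

locale koszul_tensor_complex =
  fixes S :: "('a, 'c) ring_scheme" and f :: "nat \<Rightarrow> 'a" and p :: nat and B :: "('a, 'x) cplx"
  assumes cring: "cring S" and f: "\<And>j. j \<in> {1..p} \<Longrightarrow> f j \<in> carrier S" and B: "is_complex S B"
begin

abbreviation K where "K \<equiv> koszul_tensor f p B"

lemma B_koszul: "koszul S (cmod B i) f p"
  using f complex_module[OF B] by (intro koszul.intro koszul_axioms.intro smodI)

lemma K_module: "module S (cmod K n)"
  unfolding koszul_tensor_cmod by (intro direct_sum_module cring complex_module[OF B])

lemma K_component: "x \<in> carrier (cmod K n) \<Longrightarrow> I \<subseteq> {1..p} \<Longrightarrow> n - int (card I) = i \<Longrightarrow> x I \<in> carrier (cmod B i)"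
  by auto

lemma K_component_insert:
  "x \<in> carrier (cmod K n) \<Longrightarrow> I \<subseteq> {1..p} \<Longrightarrow> j \<in> {1..p} - I \<Longrightarrow> x (insert j I) \<in> carrier (cmod B (n - 1 - int (card I)))"
  by (rule K_component) (auto simp: card_insert_index(2) simp del: card_insert_if)

lemma lin_K_component:
  "I \<subseteq> {1..p} \<Longrightarrow> n - int (card I) = i \<Longrightarrow> lin S (cmod K n) (cmod B i) (\<lambda>x. x I)"
  unfolding koszul_tensor_cmod
  using lin_component[of S "Pow {1..p}" "\<lambda>I. cmod B (n - int (card I))" I, OF cring complex_module[OF B]] by auto

lemma bdry_lin: "lin S (cmod K n) (cmod K (n - 1)) (bdry K n)"
  unfolding koszul_tensor_cmod[of f p B "n - 1"]
proof (rule lin_into_direct_sum[OF cring K_module])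
  fix I assume "I \<in> Pow {1..p}"
  then have I: "I \<subseteq> {1..p}" by auto
  let ?N = "cmod B (n - 1 - int (card I))"
  interpret N: koszul S ?N f p by (rule B_koszul)
  have "lin S (cmod K n) ?N (\<lambda>x. koszul_diff ?N f p x I)"
    unfolding koszul_diff_def
  proof (intro lin_finsum_map K_module N.module_axioms)
    fix j assume j: "j \<in> {1..p} - I"
    have "lin S (cmod K n) ?N (\<lambda>x. x (insert j I))"
      using I j by (intro lin_K_component card_insert_index(2)) auto
    moreover have "lin S ?N ?N (\<lambda>u. signed ?N (card {k\<in>I. k < j}) (f j \<odot>\<^bsub>?N\<^esub> u))"
      using j f by (intro lin_signed lin_smult_map N.module_axioms) auto
    ultimately show "lin S (cmod K n) ?N (\<lambda>x. signed ?N (card {k\<in>I. k < j}) (f j \<odot>\<^bsub>?N\<^esub> x (insert j I)))"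
      by (rule lin_comp)
  qed auto
  moreover have "lin S (cmod K n) ?N (\<lambda>x. signed ?N (card I) (bdry B (n - int (card I)) (x I)))"
  proof -
    have "lin S (cmod B (n - int (card I))) ?N (bdry B (n - int (card I)))"
      by (rule complex_lin_eq[OF B]) simp
    then show ?thesis
      using I by (intro lin_signed lin_comp[OF lin_K_component]) auto
  qed
  ultimately have "lin S (cmod K n) ?N (\<lambda>x. koszul_diff ?N f p x I \<oplus>\<^bsub>?N\<^esub> signed ?N (card I) (bdry B (n - int (card I)) (x I)))"
    by (rule lin_add_map)
  then show "lin S (cmod K n) ?N (\<lambda>x. bdry K n x I)"
    using I by (simp add: koszul_tensor_bdry)
qed (simp add: koszul_tensor_bdry)

lemma K_complex: "is_complex S K"
proof (rule complexI[OF bdry_lin])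
  fix n x assume x: "x \<in> carrier (cmod K n)"
  have "bdry K (n - 1) (bdry K n x) I = \<zero>\<^bsub>cmod K (n - 2)\<^esub> I" if I: "I \<subseteq> {1..p}" for I
  proof -
    let ?c = "int (card I)"
    let ?N1 = "cmod B (n - 1 - ?c)" and ?N = "cmod B (n - 2 - ?c)"
    interpret N: koszul S ?N f p by (rule B_koszul)
    interpret N1: koszul S ?N1 f p by (rule B_koszul)
    have fin: "finite I" using I by (rule finite_subset) simp
    interpret d1: lin S ?N1 ?N "bdry B (n - 1 - ?c)"
      by (rule complex_lin_eq[OF B]) simp
    let ?z = "N.kd (\<lambda>J. bdry B (n - 1 - ?c) (x J)) I"
    have z: "?z \<in> carrier ?N"
      using x I by (intro N.kd_closed d1.closed K_component_insert)
    have kk: "N.kd x (insert j I) \<in> carrier ?N" if "j \<in> {1..p} - I" for j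
    proof (rule N.kd_closed)
      fix k assume "k \<in> {1..p} - insert j I"
      then show "x (insert k (insert j I)) \<in> carrier ?N"
        using K_component_insert[OF x, of "insert j I" k] that I by (simp add: card_insert_index(1)[OF I that] algebra_simps)
    qed
    have "N.kd (bdry K n x) I = N.kd (\<lambda>J. N.kd x J \<oplus>\<^bsub>?N\<^esub> signed ?N (Suc (card I)) (bdry B (n - 1 - ?c) (x J))) I"
    proof (rule N.kd_cong)
      fix j assume j: "j \<in> {1..p} - I"
      note c = card_insert_index[OF I j]
      have e: "n - 1 - int (Suc (card I)) = n - 2 - ?c" "n - int (Suc (card I)) = n - 1 - ?c" by simp_all
      show "bdry K n x (insert j I) =
          N.kd x (insert j I) \<oplus>\<^bsub>?N\<^esub> signed ?N (Suc (card I)) (bdry B (n - 1 - ?c) (x (insert j I)))"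
        using I j by (simp add: koszul_tensor_bdry c(1) e del: of_nat_Suc)
      show "N.kd x (insert j I) \<oplus>\<^bsub>?N\<^esub> signed ?N (Suc (card I)) (bdry B (n - 1 - ?c) (x (insert j I))) \<in> carrier ?N"
        using kk j K_component_insert[OF x I j] by simp
    qed
    also have "\<dots> = N.kd (N.kd x) I \<oplus>\<^bsub>?N\<^esub> N.kd (\<lambda>J. signed ?N (Suc (card I)) (bdry B (n - 1 - ?c) (x J))) I"
      using kk K_component_insert[OF x I] by (intro N.kd_add) auto
    also have "N.kd (N.kd x) I = \<zero>\<^bsub>?N\<^esub>"
    proof (rule N.koszul_diff_koszul_diff[OF f fin])
      fix j k assume "j \<in> {1..p} - I" "k \<in> {1..p} - insert j I"
      then show "x (insert k (insert j I)) \<in> carrier ?N"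
        using K_component_insert[OF x, of "insert j I" k] I by (simp add: card_insert_index(1)[OF I] algebra_simps)
    qed
    also have "N.kd (\<lambda>J. signed ?N (Suc (card I)) (bdry B (n - 1 - ?c) (x J))) I = signed ?N (Suc (card I)) ?z"
      using lin.koszul_diff[OF lin_signed[OF lin_id[OF N.module_axioms]], of p f I "\<lambda>J. bdry B (n - 1 - ?c) (x J)" "Suc (card I)"]
        f K_component_insert[OF x I] by simp
    finally have 1: "N.kd (bdry K n x) I = signed ?N (Suc (card I)) ?z"
      using z by simp
    have e: "n - ?c - 1 = n - 1 - ?c" "n - ?c - 2 = n - 2 - ?c" by simp_all
    have xI: "x I \<in> carrier (cmod B (n - ?c))" using x I by (intro K_component) auto
    have dxI: "bdry B (n - ?c) (x I) \<in> carrier ?N1"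
      using lin.closed[OF complex_lin[OF B] xI] by (simp add: e)
    have "bdry B (n - 1 - ?c) (bdry K n x I) = bdry B (n - 1 - ?c) (N1.kd x I) \<oplus>\<^bsub>?N\<^esub>
        signed ?N (card I) (bdry B (n - 1 - ?c) (bdry B (n - ?c) (x I)))"
      using I x dxI N1.kd_closed[of I x, OF K_component_insert[OF x I]] by (simp add: koszul_tensor_bdry)
    also have "bdry B (n - 1 - ?c) (bdry B (n - ?c) (x I)) = \<zero>\<^bsub>?N\<^esub>"
      using complex_bdry_bdry[OF B xI] by (simp add: e)
    also have "bdry B (n - 1 - ?c) (N1.kd x I) = ?z"
      using K_component_insert[OF x I] f by (intro d1.koszul_diff) auto
    finally have 2: "bdry B (n - 1 - ?c) (bdry K n x I) = ?z"
      using z by simp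
    have "n - 1 - 1 - ?c = n - 2 - ?c" by simp
    then have "bdry K (n - 1) (bdry K n x) I = signed ?N (Suc (card I)) ?z \<oplus>\<^bsub>?N\<^esub> signed ?N (card I) ?z"
      using I 1 2 by (simp add: koszul_tensor_bdry[of _ _ _ "n - 1"])
    also have "\<dots> = \<zero>\<^bsub>?N\<^esub>" using z by (simp add: N.signed_Suc N.l_neg)
    finally show ?thesis using I by simp
  qed
  then show "bdry K (n - 1) (bdry K n x) = \<zero>\<^bsub>cmod K (n - 2)\<^esub>"
    by (intro extensionalityI[of _ "Pow {1..p}"]) (auto simp: koszul_tensor_bdry)
qed

end

section \<open>Koszul complexes with coefficients in a two-term complex\<close>

text \<open>
  Each of the first \<open>p\<close> elements is a nonzerodivisor modulo its predecessors. Indexing by the number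
  \<open>q\<close> of predecessors suits inductions on the length of the sequence.
\<close>

definition regular_upto :: "('a, 'c) ring_scheme \<Rightarrow> (nat \<Rightarrow> 'a) \<Rightarrow> nat \<Rightarrow> bool" where
  "regular_upto S f p \<longleftrightarrow> (\<forall>j\<in>{1..p}. f j \<in> carrier S) \<and>
     (\<forall>q<p. \<forall>a\<in>carrier S. f (Suc q) \<otimes>\<^bsub>S\<^esub> a \<in> seq_ideal S f q \<longrightarrow> a \<in> seq_ideal S f q)"

lemma regular_on_free:
  assumes reg: "regular_upto S f p" and free: "fg_free S F" and q: "q < p"
    and x: "x \<in> carrier F" "f (Suc q) \<odot>\<^bsub>F\<^esub> x \<in> ideal_mod S (seq_ideal S f q) F"
  shows "x \<in> ideal_mod S (seq_ideal S f q) F"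
proof -
  have cr: "cring S" using fg_free_module[OF free] by (simp add: module_def)
  have "ideal (seq_ideal S f q) S"
    using reg q by (intro seq_ideal_ideal cr) (auto simp: regular_upto_def)
  then show ?thesis
    using reg q by (intro free_regular_element[OF free _ _ _ x]) (auto simp: regular_upto_def)
qed

locale two_term = koszul_tensor_complex +
  assumes B_trivial: "\<And>i. i \<noteq> 0 \<Longrightarrow> i \<noteq> 1 \<Longrightarrow> carrier (cmod B i) = {\<zero>\<^bsub>cmod B i\<^esub>}"
    and B_free: "\<And>i. fg_free S (cmod B i)"
begin

lemma bdry_at:
  assumes "I \<subseteq> {1..p}" "n - 1 - int (card I) = i"
  shows "bdry K n x I = koszul_diff (cmod B i) f p x I \<oplus>\<^bsub>cmod B i\<^esub>
           signed (cmod B i) (card I) (bdry B (i + 1) (x I))"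
proof -
  have e: "n - int (card I) = i + 1" using assms(2) by simp
  have "bdry K n x I = koszul_diff (cmod B (n - 1 - int (card I))) f p x I \<oplus>\<^bsub>cmod B (n - 1 - int (card I))\<^esub>
      signed (cmod B (n - 1 - int (card I))) (card I) (bdry B (n - int (card I)) (x I))"
    using assms(1) by (simp add: koszul_tensor_bdry)
  then show ?thesis unfolding assms(2) e .
qed

lemma bdry_at_zero:
  assumes x: "x \<in> carrier (cmod K n)" and I: "I \<subseteq> {1..p}" "n - 1 - int (card I) = i"
    and xI: "x I = \<zero>\<^bsub>cmod B (i + 1)\<^esub>"
  shows "bdry K n x I = koszul_diff (cmod B i) f p x I"
proof -
  interpret N: koszul S "cmod B i" f p by (rule B_koszul)
  interpret d: lin S "cmod B (i + 1)" "cmod B i" "bdry B (i + 1)"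
    by (rule complex_lin_eq[OF B]) simp
  have "koszul_diff (cmod B i) f p x I \<in> carrier (cmod B i)"
    using K_component_insert[OF x I(1)] I(2) by (intro N.kd_closed) auto
  then show ?thesis
    unfolding bdry_at[OF I] xI by simp
qed

lemma K_free: "\<one>\<^bsub>S\<^esub> \<noteq> \<zero>\<^bsub>S\<^esub> \<Longrightarrow> fg_free S (cmod K n)"
  unfolding koszul_tensor_cmod by (intro fg_free_direct_sum cring B_free) auto

text \<open>
  With coefficients in a two-term complex \<open>B\<^sub>1 \<rightarrow> B\<^sub>0\<close>, the \<open>B\<^sub>1\<close>-part of a cycle is a Koszul
  cycle, because the Koszul differential is the only part of the differential that ends in
  \<open>B\<^sub>1\<close>. Once it has been removed by subtracting a boundary, the remaining \<open>B\<^sub>0\<close>-part is a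
  Koszul cycle of positive degree.
\<close>

lemma two_term_exact:
  assumes reg: "regular_upto S f p" and w: "w \<in> carrier (cmod K n)" and n: "n \<ge> 1"
    and cyc: "bdry K n w = \<zero>\<^bsub>cmod K (n - 1)\<^esub>"
    and w0: "n = 1 \<Longrightarrow> w {} \<in> ideal_mod S (seq_ideal S f p) (cmod B 1)"
  shows "\<exists>v\<in>carrier (cmod K (n + 1)). bdry K (n + 1) v = w"
proof -
  interpret B0: koszul S "cmod B 0" f p by (rule B_koszul)
  interpret B1: koszul S "cmod B 1" f p by (rule B_koszul)
  interpret Kn: smod S "cmod K n" by (rule smodI[OF K_module])
  interpret Kn1: smod S "cmod K (n + 1)" by (rule smodI[OF K_module])
  interpret dn: lin S "cmod K n" "cmod K (n - 1)" "bdry K n" by (rule bdry_lin)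
  interpret dn1: lin S "cmod K (n + 1)" "cmod K n" "bdry K (n + 1)"
    by (rule complex_lin_eq[OF K_complex]) simp
  have sub: "seq_ideal S f p \<subseteq> carrier S" by (rule seq_ideal_subset[of S p f, OF cring f])
  have triv: "x = \<zero>\<^bsub>cmod B i\<^esub>" if "x \<in> carrier (cmod B i)" "i \<noteq> 0" "i \<noteq> 1" for x i
    using B_trivial[OF that(2,3)] that(1) by auto
  note ex = smod.koszul_exact[of S _ p f, OF smodI f regular_on_free[OF reg B_free]]
  have zB: "\<zero>\<^bsub>cmod B i\<^esub> \<in> carrier (cmod B i)" for i
    using complex_module[OF B, of i] by (simp add: module_def abelian_groupE(2))
  define x1 where "x1 I = (if int (card I) = n - 1 then w I else \<zero>\<^bsub>cmod B 1\<^esub>)" for I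
  have x1: "x1 I \<in> carrier (cmod B 1)" if "I \<subseteq> {1..p}" for I
    using w that by (auto simp: x1_def intro!: K_component[OF w])
  have "B1.kd x1 I = \<zero>\<^bsub>cmod B 1\<^esub>" if I: "I \<subseteq> {1..p}" for I
  proof (cases "int (card I) = n - 2")
    case True
    have wI: "w I = \<zero>\<^bsub>cmod B 2\<^esub>"
      using True I by (intro triv K_component[OF w]) auto
    have "B1.kd x1 I = B1.kd w I"
      using True I by (intro B1.kd_cong K_component[OF w]) (auto simp: x1_def card_insert_index(1) simp del: card_insert_if)
    also have "\<dots> = bdry K n w I"
      using True I wI by (intro bdry_at_zero[OF w, symmetric]) auto
    also have "\<dots> = \<zero>\<^bsub>cmod B 1\<^esub>" using True I cyc by simp
    finally show ?thesis .
  next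
    case False
    then show ?thesis
      using I by (intro B1.kd_zero) (auto simp: x1_def card_insert_index(1) simp del: card_insert_if)
  qed
  moreover have "x1 {} \<in> ideal_mod S (seq_ideal S f p) (cmod B 1)"
    using w0 B1.ideal_mod_zero[OF sub] by (auto simp: x1_def)
  ultimately have "\<exists>y. \<forall>I. I \<subseteq> {1..p} \<longrightarrow> y I \<in> carrier (cmod B 1) \<and> B1.kd y I = x1 I"
    using x1 by (intro ex complex_module[OF B]) auto
  then obtain y1 where "\<forall>I. I \<subseteq> {1..p} \<longrightarrow> y1 I \<in> carrier (cmod B 1) \<and> B1.kd y1 I = x1 I" by (rule exE)
  then have y1: "\<And>I. I \<subseteq> {1..p} \<Longrightarrow> y1 I \<in> carrier (cmod B 1)"
    and dy1: "\<And>I. I \<subseteq> {1..p} \<Longrightarrow> B1.kd y1 I = x1 I" by simp_all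
  define v1 where "v1 = (\<lambda>I\<in>Pow {1..p}. if int (card I) = n then y1 I else \<zero>\<^bsub>cmod B (n + 1 - int (card I))\<^esub>)"
  have v1: "v1 \<in> carrier (cmod K (n + 1))"
    using y1 zB by (auto simp: v1_def)
  define w' where "w' = w \<ominus>\<^bsub>cmod K n\<^esub> bdry K (n + 1) v1"
  have w': "w' \<in> carrier (cmod K n)"
    unfolding w'_def by (rule Kn.minus_closed[OF w dn1.closed[OF v1]])
  have cyc': "bdry K n w' = \<zero>\<^bsub>cmod K (n - 1)\<^esub>"
  proof -
    have "bdry K n (bdry K (n + 1) v1) = \<zero>\<^bsub>cmod K (n - 1)\<^esub>"
      using complex_bdry_bdry[OF K_complex v1] by simp
    then have "bdry K n w' = \<zero>\<^bsub>cmod K (n - 1)\<^esub> \<ominus>\<^bsub>cmod K (n - 1)\<^esub> \<zero>\<^bsub>cmod K (n - 1)\<^esub>"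
      unfolding w'_def dn.diff[OF w dn1.closed[OF v1]] cyc by (simp only:)
    then show ?thesis by (simp only: dn.N.diff_self[OF dn.N.zero_closed])
  qed
  have w'I: "w' I = \<zero>\<^bsub>cmod B (n - int (card I))\<^esub>" if I: "I \<subseteq> {1..p}" and c: "int (card I) \<noteq> n" for I
  proof (cases "int (card I) = n - 1")
    case True
    have v1I: "v1 I = \<zero>\<^bsub>cmod B 2\<^esub>"
      using True I by (simp add: v1_def)
    have "bdry K (n + 1) v1 I = B1.kd v1 I"
      using True I v1I by (intro bdry_at_zero[OF v1]) auto
    also have "\<dots> = B1.kd y1 I"
      using True I y1 by (intro B1.kd_cong) (auto simp: v1_def card_insert_index(1) simp del: card_insert_if)
    also have "\<dots> = w I" using dy1[OF I] True by (simp add: x1_def)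
    finally have eq: "bdry K (n + 1) v1 I = w I" .
    have "w' I = w I \<ominus>\<^bsub>cmod B 1\<^esub> bdry K (n + 1) v1 I"
      unfolding w'_def
      by (rule lin.diff[OF lin_K_component w dn1.closed[OF v1]]) (use True I in auto)
    moreover have "w I \<in> carrier (cmod B 1)" using True I by (intro K_component[OF w]) auto
    ultimately show ?thesis using eq True by simp
  next
    case False
    then show ?thesis using c I by (intro triv K_component[OF w']) auto
  qed
  define x0 where "x0 I = (if int (card I) = n then w' I else \<zero>\<^bsub>cmod B 0\<^esub>)" for I
  have x0: "x0 I \<in> carrier (cmod B 0)" if "I \<subseteq> {1..p}" for I
    using that by (auto simp: x0_def intro!: K_component[OF w'])
  have "B0.kd x0 I = \<zero>\<^bsub>cmod B 0\<^esub>" if I: "I \<subseteq> {1..p}" for I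
  proof (cases "int (card I) = n - 1")
    case True
    have "B0.kd x0 I = B0.kd w' I"
      using True I by (intro B0.kd_cong K_component[OF w']) (auto simp: x0_def card_insert_index(1) simp del: card_insert_if)
    also have "\<dots> = bdry K n w' I"
      using True I w'I[OF I] by (intro bdry_at_zero[OF w', symmetric]) auto
    also have "\<dots> = \<zero>\<^bsub>cmod B 0\<^esub>" using True I cyc' by simp
    finally show ?thesis .
  next
    case False
    then show ?thesis
      using I by (intro B0.kd_zero) (auto simp: x0_def card_insert_index(1) simp del: card_insert_if)
  qed
  moreover have "x0 {} \<in> ideal_mod S (seq_ideal S f p) (cmod B 0)"
    using n B0.ideal_mod_zero[OF sub] by (auto simp: x0_def)
  ultimately have "\<exists>y. \<forall>I. I \<subseteq> {1..p} \<longrightarrow> y I \<in> carrier (cmod B 0) \<and> B0.kd y I = x0 I"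
    using x0 by (intro ex complex_module[OF B]) auto
  then obtain y0 where "\<forall>I. I \<subseteq> {1..p} \<longrightarrow> y0 I \<in> carrier (cmod B 0) \<and> B0.kd y0 I = x0 I" by (rule exE)
  then have y0: "\<And>I. I \<subseteq> {1..p} \<Longrightarrow> y0 I \<in> carrier (cmod B 0)"
    and dy0: "\<And>I. I \<subseteq> {1..p} \<Longrightarrow> B0.kd y0 I = x0 I" by simp_all
  define v0 where "v0 = (\<lambda>I\<in>Pow {1..p}. if int (card I) = n + 1 then y0 I else \<zero>\<^bsub>cmod B (n + 1 - int (card I))\<^esub>)"
  have v0: "v0 \<in> carrier (cmod K (n + 1))"
    using y0 zB by (auto simp: v0_def)
  have "bdry K (n + 1) v0 I = w' I" if I: "I \<subseteq> {1..p}" for I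
  proof -
    consider "int (card I) = n" | "int (card I) = n - 1" | "n - int (card I) \<noteq> 0" "n - int (card I) \<noteq> 1" by linarith
    then show ?thesis
    proof cases
      case 1
      have "bdry K (n + 1) v0 I = B0.kd v0 I"
        using 1 I by (intro bdry_at_zero[OF v0]) (auto simp: v0_def)
      also have "\<dots> = B0.kd y0 I"
        using 1 I y0 by (intro B0.kd_cong) (auto simp: v0_def card_insert_index(1) simp del: card_insert_if)
      also have "\<dots> = w' I" using dy0[OF I] 1 by (simp add: x0_def)
      finally show ?thesis .
    next
      case 2
      have "bdry K (n + 1) v0 I = B1.kd v0 I"
        using 2 I by (intro bdry_at_zero[OF v0]) (auto simp: v0_def)
      also have "\<dots> = \<zero>\<^bsub>cmod B 1\<^esub>"
        using 2 I by (intro B1.kd_zero) (auto simp: v0_def card_insert_index(1) simp del: card_insert_if)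
      also have "\<dots> = w' I" using w'I[OF I] 2 by simp
      finally show ?thesis .
    next
      case 3
      have "bdry K (n + 1) v0 I = \<zero>\<^bsub>cmod B (n - int (card I))\<^esub>"
        using 3 I by (intro triv K_component[OF dn1.closed[OF v0]]) auto
      then show ?thesis using w'I[OF I] 3 by simp
    qed
  qed
  then have dv0: "bdry K (n + 1) v0 = w'"
    using dn1.closed[OF v0] w' by (intro extensionalityI[of _ "Pow {1..p}"]) (auto simp: PiE_iff)
  have "bdry K (n + 1) (v0 \<oplus>\<^bsub>cmod K (n + 1)\<^esub> v1) = w' \<oplus>\<^bsub>cmod K n\<^esub> bdry K (n + 1) v1"
    by (simp only: dn1.add[OF v0 v1] dv0)
  also have "\<dots> = w"
    unfolding w'_def a_minus_def
    using Kn.a_assoc[OF w Kn.a_inv_closed[OF dn1.closed[OF v1]] dn1.closed[OF v1]] Kn.l_neg[OF dn1.closed[OF v1]] Kn.r_zero[OF w]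
    by (simp only:)
  finally show ?thesis
    using Kn1.a_closed[OF v0 v1] by (intro bexI[of _ "v0 \<oplus>\<^bsub>cmod K (n + 1)\<^esub> v1"])
qed

end

section \<open>Comparison of complexes\<close>

definition free_acyclic :: "('a, 'c) ring_scheme \<Rightarrow> ('a, 'x) cplx \<Rightarrow> bool" where
  "free_acyclic S L \<longleftrightarrow> left_complex S L \<and> (\<forall>i. fg_free S (cmod L i)) \<and>
     (\<forall>i>0. {x \<in> carrier (cmod L i). bdry L i x = \<zero>\<^bsub>cmod L (i - 1)\<^esub>}
             = bdry L (i + 1) ` carrier (cmod L (i + 1)))"

lemma free_acyclicD:
  assumes "free_acyclic S L"
  shows "is_complex S L" and "\<And>i. fg_free S (cmod L i)"
    and "\<And>i x. i < 0 \<Longrightarrow> x \<in> carrier (cmod L i) \<Longrightarrow> x = \<zero>\<^bsub>cmod L i\<^esub>"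
    and "\<And>i j k x. i > 0 \<Longrightarrow> x \<in> carrier (cmod L i) \<Longrightarrow> j = i - 1 \<Longrightarrow> k = i + 1 \<Longrightarrow>
           bdry L i x = \<zero>\<^bsub>cmod L j\<^esub> \<Longrightarrow> x \<in> bdry L k ` carrier (cmod L k)"
proof -
  show "is_complex S L" "\<And>i. fg_free S (cmod L i)"
    "\<And>i x. i < 0 \<Longrightarrow> x \<in> carrier (cmod L i) \<Longrightarrow> x = \<zero>\<^bsub>cmod L i\<^esub>"
    using assms unfolding free_acyclic_def left_complex_def by auto
  fix i j k x
  assume *: "i > 0" "x \<in> carrier (cmod L i)" "j = i - 1" "k = i + 1" "bdry L i x = \<zero>\<^bsub>cmod L j\<^esub>"
  then have "{x \<in> carrier (cmod L i). bdry L i x = \<zero>\<^bsub>cmod L j\<^esub>} = bdry L k ` carrier (cmod L k)"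
    using assms unfolding free_acyclic_def by simp
  with * show "x \<in> bdry L k ` carrier (cmod L k)" by blast
qed

lemma bdry_bdry_eq:
  "is_complex S C \<Longrightarrow> x \<in> carrier (cmod C i) \<Longrightarrow> i - 1 = j \<Longrightarrow> j - 1 = k \<Longrightarrow> bdry C j (bdry C i x) = \<zero>\<^bsub>cmod C k\<^esub>"
  using complex_bdry_bdry[of S C x i] by auto

text \<open>
  The terms of \<open>\<Phi>\<close> are constructed one after the other by lifting along the differential of \<open>L\<close>.
  The condition in \<open>P\<close> that makes the next lift possible holds in degree \<open>0\<close> by assumption, and
  above it because \<open>\<psi>\<partial>\<close> has values in the cycles of \<open>L\<close>.
\<close>

lemma comparison_theorem:
  assumes V: "is_complex S V" and Vfree: "\<And>i. fg_free S (cmod V i)"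
    and Vneg: "\<And>i x. i < 0 \<Longrightarrow> x \<in> carrier (cmod V i) \<Longrightarrow> x = \<zero>\<^bsub>cmod V i\<^esub>"
    and L: "free_acyclic S L" and g: "lin S (cmod V 0) (cmod L 0) g"
    and img: "\<And>x. x \<in> carrier (cmod V 1) \<Longrightarrow> g (bdry V 1 x) \<in> bdry L 1 ` carrier (cmod L 1)"
  obtains \<Phi> where "chain_map S V L \<Phi>" "\<Phi> 0 = g"
proof -
  note Lc = free_acyclicD(1)[OF L]
  note dL = complex_lin_eq[OF Lc] and dV = complex_lin_eq[OF V]
  define P where "P n \<phi> \<longleftrightarrow> (n = 0 \<longrightarrow> \<phi> = g) \<and> lin S (cmod V (int n)) (cmod L (int n)) \<phi> \<and>
    (\<forall>x\<in>carrier (cmod V (int (Suc n))). \<phi> (bdry V (int (Suc n)) x)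
       \<in> bdry L (int (Suc n)) ` carrier (cmod L (int (Suc n))))" for n \<phi>
  define Q where "Q n \<phi> \<psi> \<longleftrightarrow> (\<forall>x\<in>carrier (cmod V (int (Suc n))).
    bdry L (int (Suc n)) (\<psi> x) = \<phi> (bdry V (int (Suc n)) x))" for n \<phi> \<psi>
  have "\<exists>F. \<forall>n. P n (F n) \<and> Q n (F n) (F (Suc n))"
  proof (rule dependent_nat_choice)
    show "\<exists>\<phi>. P 0 \<phi>"
      using g img by (intro exI[of _ g]) (auto simp: P_def)
    fix \<phi> n assume P: "P n \<phi>"
    then have \<phi>: "lin S (cmod V (int n)) (cmod L (int n)) \<phi>"
      and im: "\<And>x. x \<in> carrier (cmod V (int (Suc n))) \<Longrightarrow> \<phi> (bdry V (int (Suc n)) x)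
        \<in> bdry L (int (Suc n)) ` carrier (cmod L (int (Suc n)))" unfolding P_def by blast+
    have dn: "lin S (cmod L (int (Suc n))) (cmod L (int n)) (bdry L (int (Suc n)))" by (rule dL) simp
    have dv: "lin S (cmod V (int (Suc n))) (cmod V (int n)) (bdry V (int (Suc n)))" by (rule dV) simp
    obtain \<psi> where \<psi>: "lin S (cmod V (int (Suc n))) (cmod L (int (Suc n))) \<psi>"
      and d\<psi>: "\<And>x. x \<in> carrier (cmod V (int (Suc n))) \<Longrightarrow> bdry L (int (Suc n)) (\<psi> x) = \<phi> (bdry V (int (Suc n)) x)"
      by (rule fg_free_lift[OF Vfree dn lin_comp[OF dv \<phi>] im]) (assumption, rule that)
    have "\<psi> (bdry V (int (Suc (Suc n))) x) \<in> bdry L (int (Suc (Suc n))) ` carrier (cmod L (int (Suc (Suc n))))"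
      if x: "x \<in> carrier (cmod V (int (Suc (Suc n))))" for x
    proof (rule free_acyclicD(4)[OF L])
      have c: "bdry V (int (Suc (Suc n))) x \<in> carrier (cmod V (int (Suc n)))"
        by (rule lin.closed[OF dV x]) simp
      then show "\<psi> (bdry V (int (Suc (Suc n))) x) \<in> carrier (cmod L (int (Suc n)))" by (rule lin.closed[OF \<psi>])
      have "bdry V (int (Suc n)) (bdry V (int (Suc (Suc n))) x) = \<zero>\<^bsub>cmod V (int n)\<^esub>"
        by (rule bdry_bdry_eq[OF V x]) simp_all
      then show "bdry L (int (Suc n)) (\<psi> (bdry V (int (Suc (Suc n))) x)) = \<zero>\<^bsub>cmod L (int n)\<^esub>"
        using d\<psi>[OF c] lin.zero[OF \<phi>] by simp
    qed simp_all
    with \<psi> d\<psi> have "P (Suc n) \<psi> \<and> Q n \<phi> \<psi>" unfolding P_def Q_def by blast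
    then show "\<exists>\<psi>. P (Suc n) \<psi> \<and> Q n \<phi> \<psi>" by (rule exI[of _ \<psi>])
  qed
  then obtain F where F: "\<forall>n. P n (F n) \<and> Q n (F n) (F (Suc n))" ..
  have Flin: "lin S (cmod V (int n)) (cmod L (int n)) (F n)" for n using F unfolding P_def by blast
  have Fd: "bdry L (int (Suc n)) (F (Suc n) x) = F n (bdry V (int (Suc n)) x)"
    if "x \<in> carrier (cmod V (int (Suc n)))" for n x using F that unfolding Q_def by blast
  have F0: "F 0 = g" using F unfolding P_def by blast
  define \<Phi> where "\<Phi> i = (if i < 0 then (\<lambda>x. \<zero>\<^bsub>cmod L i\<^esub>) else F (nat i))" for i
  have lin\<Phi>: "lin S (cmod V i) (cmod L i) (\<Phi> i)" for i
    using Flin[of "nat i"] lin_zero_map[OF complex_module[OF V] complex_module[OF Lc], of i i]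
    by (cases "i < 0") (simp_all add: \<Phi>_def)
  have "chain_map S V L \<Phi>"
  proof (rule chain_mapI[OF lin\<Phi>])
    fix i x assume x: "x \<in> carrier (cmod V i)"
    show "bdry L i (\<Phi> i x) = \<Phi> (i - 1) (bdry V i x)"
    proof (cases "i \<le> 0")
      case True
      have "bdry L i (\<Phi> i x) \<in> carrier (cmod L (i - 1))"
        by (rule lin.closed[OF complex_lin[OF Lc] lin.closed[OF lin\<Phi> x]])
      then show ?thesis
        using True free_acyclicD(3)[OF L, of "i - 1"] by (simp add: \<Phi>_def)
    next
      case False
      then obtain n where "i = int (Suc n)" by (metis not_le zero_less_imp_eq_int Suc_pred')
      then show ?thesis using Fd[of x n] x by (simp add: \<Phi>_def nat_add_distrib)
    qed
  qed
  then show thesis by (rule that) (simp add: \<Phi>_def F0)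
qed

text \<open>
  As \<open>V\<close> is free and \<open>L\<close> acyclic, a chain map that is zero in degree \<open>0\<close> is null-homotopic, \<open>\<Delta> = \<partial>\<sigma> + \<sigma>\<partial>\<close>, and both summands
  have values in \<open>IL\<close> when the differentials do.
\<close>

lemma nullhomotopic_image:
  assumes V: "is_complex S V" and Vfree: "\<And>i. fg_free S (cmod V i)" and L: "free_acyclic S L"
    and \<Delta>: "chain_map S V L \<Delta>" and \<Delta>0: "\<And>x. x \<in> carrier (cmod V 0) \<Longrightarrow> \<Delta> 0 x = \<zero>\<^bsub>cmod L 0\<^esub>"
    and I: "I \<subseteq> carrier S" and Vmin: "minimal_complex S I V" and Lmin: "minimal_complex S I L"
    and x: "x \<in> carrier (cmod V i)"
  shows "\<Delta> i x \<in> ideal_mod S I (cmod L i)"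
proof -
  note Lc = free_acyclicD(1)[OF L]
  note dL = complex_lin_eq[OF Lc] and dV = complex_lin_eq[OF V]
  note \<Delta>lin = chain_map_lin[OF \<Delta> V Lc]
  have \<Delta>d: "bdry L i (\<Delta> i x) = \<Delta> j (bdry V i x)" if "x \<in> carrier (cmod V i)" "i - 1 = j" for i j x
    using \<Delta> that unfolding chain_map_def by auto
  \<comment> \<open>The second condition in \<open>P\<close> makes \<open>\<Delta> - \<sigma>\<partial>\<close> in degree \<open>n + 1\<close> a cycle, which can then be lifted
     to the next term of the homotopy.\<close>
  define P where "P n \<sigma> \<longleftrightarrow> lin S (cmod V (int n)) (cmod L (int (Suc n))) \<sigma> \<and>
    (\<forall>x\<in>carrier (cmod V (int (Suc n))). bdry L (int (Suc n)) (\<sigma> (bdry V (int (Suc n)) x))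
       = \<Delta> (int n) (bdry V (int (Suc n)) x))" for n \<sigma>
  define Q where "Q n \<sigma> \<tau> \<longleftrightarrow> (\<forall>x\<in>carrier (cmod V (int (Suc n))).
    bdry L (int (Suc (Suc n))) (\<tau> x) = \<Delta> (int (Suc n)) x \<ominus>\<^bsub>cmod L (int (Suc n))\<^esub> \<sigma> (bdry V (int (Suc n)) x))" for n \<sigma> \<tau>
  have "\<exists>F. \<forall>n. P n (F n) \<and> Q n (F n) (F (Suc n))"
  proof (rule dependent_nat_choice)
    have "lin S (cmod V (int 0)) (cmod L (int (Suc 0))) (\<lambda>x. \<zero>\<^bsub>cmod L (int (Suc 0))\<^esub>)"
      by (rule lin_zero_map[OF complex_module[OF V] complex_module[OF Lc]])
    moreover have "bdry L (int (Suc 0)) \<zero>\<^bsub>cmod L (int (Suc 0))\<^esub> = \<Delta> (int 0) (bdry V (int (Suc 0)) x)"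
      if "x \<in> carrier (cmod V (int (Suc 0)))" for x
      using lin.zero[OF dL[of 1 0]] \<Delta>0 lin.closed[OF dV[of 1 0]] that by simp
    ultimately show "\<exists>\<sigma>. P 0 \<sigma>" unfolding P_def by blast
    fix \<sigma> n assume P: "P n \<sigma>"
    then have \<sigma>: "lin S (cmod V (int n)) (cmod L (int (Suc n))) \<sigma>"
      and d\<sigma>: "\<And>x. x \<in> carrier (cmod V (int (Suc n))) \<Longrightarrow> bdry L (int (Suc n)) (\<sigma> (bdry V (int (Suc n)) x))
        = \<Delta> (int n) (bdry V (int (Suc n)) x)" unfolding P_def by blast+
    have dn: "lin S (cmod L (int (Suc n))) (cmod L (int n)) (bdry L (int (Suc n)))" by (rule dL) simp
    have dn': "lin S (cmod L (int (Suc (Suc n)))) (cmod L (int (Suc n))) (bdry L (int (Suc (Suc n))))" by (rule dL) simp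
    have dv: "lin S (cmod V (int (Suc n))) (cmod V (int n)) (bdry V (int (Suc n)))" by (rule dV) simp
    let ?g = "\<lambda>x. \<Delta> (int (Suc n)) x \<ominus>\<^bsub>cmod L (int (Suc n))\<^esub> \<sigma> (bdry V (int (Suc n)) x)"
    have g: "lin S (cmod V (int (Suc n))) (cmod L (int (Suc n))) ?g"
      by (intro lin_diff_map \<Delta>lin lin_comp[OF dv \<sigma>])
    have im: "?g x \<in> bdry L (int (Suc (Suc n))) ` carrier (cmod L (int (Suc (Suc n))))"
      if x: "x \<in> carrier (cmod V (int (Suc n)))" for x
    proof (rule free_acyclicD(4)[OF L])
      show "?g x \<in> carrier (cmod L (int (Suc n)))" by (rule lin.closed[OF g x])
      interpret dn: lin S "cmod L (int (Suc n))" "cmod L (int n)" "bdry L (int (Suc n))" by (rule dn)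
      have c: "\<Delta> (int n) (bdry V (int (Suc n)) x) \<in> carrier (cmod L (int n))"
        by (rule lin.closed[OF \<Delta>lin lin.closed[OF dv x]])
      have "bdry L (int (Suc n)) (?g x) = bdry L (int (Suc n)) (\<Delta> (int (Suc n)) x) \<ominus>\<^bsub>cmod L (int n)\<^esub>
          bdry L (int (Suc n)) (\<sigma> (bdry V (int (Suc n)) x))"
        by (rule dn.diff[OF lin.closed[OF \<Delta>lin x] lin.closed[OF lin_comp[OF dv \<sigma>] x]])
      also have "\<dots> = \<zero>\<^bsub>cmod L (int n)\<^esub>"
        using \<Delta>d[OF x, of "int n"] d\<sigma>[OF x] dn.N.diff_self[OF c] by simp
      finally show "bdry L (int (Suc n)) (?g x) = \<zero>\<^bsub>cmod L (int n)\<^esub>" .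
    qed simp_all
    obtain \<tau> where \<tau>: "lin S (cmod V (int (Suc n))) (cmod L (int (Suc (Suc n)))) \<tau>"
      and d\<tau>: "\<And>x. x \<in> carrier (cmod V (int (Suc n))) \<Longrightarrow> bdry L (int (Suc (Suc n))) (\<tau> x) = ?g x"
      by (rule fg_free_lift[OF Vfree dn' g im]) (assumption, rule that)
    have "bdry L (int (Suc (Suc n))) (\<tau> (bdry V (int (Suc (Suc n))) x)) = \<Delta> (int (Suc n)) (bdry V (int (Suc (Suc n))) x)"
      if x: "x \<in> carrier (cmod V (int (Suc (Suc n))))" for x
    proof -
      interpret LL: smod S "cmod L (int (Suc n))" by (rule smodI[OF complex_module[OF Lc]])
      have c: "bdry V (int (Suc (Suc n))) x \<in> carrier (cmod V (int (Suc n)))"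
        by (rule lin.closed[OF dV x]) simp
      have "bdry V (int (Suc n)) (bdry V (int (Suc (Suc n))) x) = \<zero>\<^bsub>cmod V (int n)\<^esub>"
        by (rule bdry_bdry_eq[OF V x]) simp_all
      then show ?thesis
        using d\<tau>[OF c] lin.zero[OF \<sigma>] LL.diff_zero[OF lin.closed[OF \<Delta>lin c]] by simp
    qed
    with \<tau> d\<tau> have "P (Suc n) \<tau> \<and> Q n \<sigma> \<tau>" unfolding P_def Q_def by blast
    then show "\<exists>\<tau>. P (Suc n) \<tau> \<and> Q n \<sigma> \<tau>" by (rule exI[of _ \<tau>])
  qed
  then obtain F where F: "\<forall>n. P n (F n) \<and> Q n (F n) (F (Suc n))" ..
  have Flin: "lin S (cmod V (int n)) (cmod L (int (Suc n))) (F n)" for n using F unfolding P_def by blast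
  have Fd: "bdry L (int (Suc (Suc n))) (F (Suc n) x) = \<Delta> (int (Suc n)) x \<ominus>\<^bsub>cmod L (int (Suc n))\<^esub> F n (bdry V (int (Suc n)) x)"
    if "x \<in> carrier (cmod V (int (Suc n)))" for n x using F that unfolding Q_def by blast
  interpret Li: smod S "cmod L i" by (rule smodI[OF complex_module[OF Lc]])
  show ?thesis
  proof (cases "i \<le> 0")
    case True
    then have "\<Delta> i x = \<zero>\<^bsub>cmod L i\<^esub>"
      using \<Delta>0[of x] free_acyclicD(3)[OF L _ lin.closed[OF \<Delta>lin x]] x by (cases "i = 0") auto
    then show ?thesis using Li.ideal_mod_zero[OF I] by simp
  next
    case False
    then obtain n where i: "i = int (Suc n)" by (metis not_le zero_less_imp_eq_int Suc_pred')
    let ?a = "bdry L (int (Suc (Suc n))) (F (Suc n) x)" and ?b = "F n (bdry V (int (Suc n)) x)"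
    have x': "x \<in> carrier (cmod V (int (Suc n)))" using x i by simp
    have "?a \<in> ideal_mod S I (cmod L i)"
      using Lmin lin.closed[OF Flin x'] unfolding minimal_complex_def i
      by (metis (no_types, lifting) add_diff_cancel_left' image_subset_iff of_nat_Suc)
    moreover have "?b \<in> ideal_mod S I (cmod L i)"
    proof -
      have "bdry V (int (Suc n)) x \<in> ideal_mod S I (cmod V (int n))"
        using Vmin x' unfolding minimal_complex_def
        by (metis (no_types, lifting) add_diff_cancel_left' image_subset_iff of_nat_Suc)
      from lin.ideal_mod_image[OF Flin I this] show ?thesis by (simp only: i)
    qed
    moreover have "\<Delta> i x = ?a \<oplus>\<^bsub>cmod L i\<^esub> ?b"
    proof -
      have c: "\<Delta> i x \<in> carrier (cmod L i)" by (rule lin.closed[OF \<Delta>lin x])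
      have b: "?b \<in> carrier (cmod L i)" by (rule Li.ideal_mod_closed[OF I]) fact
      have "?a = \<Delta> i x \<ominus>\<^bsub>cmod L i\<^esub> ?b" using Fd[OF x'] by (simp only: i)
      then show ?thesis
        using Li.a_assoc[OF c Li.a_inv_closed[OF b] b] Li.l_neg[OF b] Li.r_zero[OF c]
        by (simp only: a_minus_def)
    qed
    ultimately show ?thesis using Li.ideal_mod_add[OF I] by simp
  qed
qed

section \<open>Koszul extensions\<close>

lemma shift_simps [simp]:
  "cmod (shift W) i = cmod W (i + 1)"
  "bdry (shift W) i x = \<ominus>\<^bsub>cmod W i\<^esub> bdry W (i + 1) x"
  by (simp_all add: shift_def)

lemma shift_complex:
  assumes W: "is_complex S W"
  shows "is_complex S (shift W)"
proof (rule complexI)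
  fix i
  have l: "lin S (cmod W (i + 1)) (cmod W i) (bdry W (i + 1))" for i
    by (rule complex_lin_eq[OF W]) simp
  show "lin S (cmod (shift W) i) (cmod (shift W) (i - 1)) (bdry (shift W) i)"
    using lin_neg_map[OF l[of i]] by (simp add: shift_def)
  fix x assume "x \<in> carrier (cmod (shift W) i)"
  then have x: "x \<in> carrier (cmod W (i + 1))" by simp
  interpret d: lin S "cmod W i" "cmod W (i - 1)" "bdry W i" by (rule complex_lin[OF W])
  have c: "bdry W (i + 1) x \<in> carrier (cmod W i)" by (rule lin.closed[OF l x])
  have "bdry W i (bdry W (i + 1) x) = \<zero>\<^bsub>cmod W (i - 1)\<^esub>"
    by (rule bdry_bdry_eq[OF W x]) simp_all
  then have "\<ominus>\<^bsub>cmod W (i - 1)\<^esub> bdry W i (\<ominus>\<^bsub>cmod W i\<^esub> bdry W (i + 1) x) = \<zero>\<^bsub>cmod W (i - 1)\<^esub>"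
    using d.neg[OF c] by simp
  moreover have "i - 2 + 1 = i - 1" by simp
  ultimately show "bdry (shift W) (i - 1) (bdry (shift W) i x) = \<zero>\<^bsub>cmod (shift W) (i - 2)\<^esub>"
    by (simp only: shift_simps diff_add_cancel)
qed

lemma shift_chain_map:
  assumes C: "is_complex S C" and D: "is_complex S D" and \<phi>: "chain_map S C D \<phi>"
  shows "chain_map S (shift C) (shift D) (\<lambda>i. \<phi> (i + 1))"
proof (rule chain_mapI)
  note l = chain_map_lin[OF \<phi> C D]
  show "lin S (cmod (shift C) i) (cmod (shift D) i) (\<phi> (i + 1))" for i
    using l by simp
  fix i x assume x: "x \<in> carrier (cmod (shift C) i)"
  have c: "bdry C (i + 1) x \<in> carrier (cmod C i)"
    by (rule lin.closed[OF complex_lin_eq[OF C]]) (use x in simp_all)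
  have "bdry D (i + 1) (\<phi> (i + 1) x) = \<phi> (i + 1 - 1) (bdry C (i + 1) x)"
    using \<phi> x unfolding chain_map_def by simp
  then show "bdry (shift D) i (\<phi> (i + 1) x) = \<phi> (i - 1 + 1) (bdry (shift C) i x)"
    using lin.neg[OF l c] by simp
qed

lemma chain_map_comp:
  assumes "is_complex S C" "is_complex S D" "is_complex S E" "chain_map S C D \<phi>" "chain_map S D E \<psi>"
  shows "chain_map S C E (\<lambda>i x. \<psi> i (\<phi> i x))"
proof (rule chain_mapI)
  note l = chain_map_lin[OF assms(4,1,2)] chain_map_lin[OF assms(5,2,3)]
  show "lin S (cmod C i) (cmod E i) (\<lambda>x. \<psi> i (\<phi> i x))" for i
    by (rule lin_comp[OF l])
  show "bdry E i (\<psi> i (\<phi> i x)) = \<psi> (i - 1) (\<phi> (i - 1) (bdry C i x))" if "x \<in> carrier (cmod C i)" for i x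
    using assms(4,5) that lin.closed[OF l(1) that] unfolding chain_map_def by simp
qed

text \<open>
  The degree is that of \<open>B\<^sub>1\<close> in the two-term complexes, so that \<open>K \<otimes> C\<close>, shifted, starts with \<open>C\<close>
  in degree \<open>0\<close>.
\<close>

definition in_degree_one :: "('a, 'y) module \<Rightarrow> ('a, 'y) cplx" where
  "in_degree_one C = \<lparr>cmod = (\<lambda>i. if i = 1 then C else sub_mod C {\<zero>\<^bsub>C\<^esub>}), bdry = (\<lambda>i x. \<zero>\<^bsub>C\<^esub>)\<rparr>"

lemma in_degree_one_simps [simp]:
  "cmod (in_degree_one C) i = (if i = 1 then C else sub_mod C {\<zero>\<^bsub>C\<^esub>})"
  "bdry (in_degree_one C) i x = \<zero>\<^bsub>C\<^esub>"
  by (simp_all add: in_degree_one_def)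

lemma in_degree_one_module: "module S C \<Longrightarrow> module S (cmod (in_degree_one C) i)"
  by (simp add: smod.sub_mod_module smod.singleton_zero_submodule smodI)

lemma in_degree_one_complex:
  assumes "module S C"
  shows "is_complex S (in_degree_one C)"
proof (rule complexI)
  have eq: "bdry (in_degree_one C) i = (\<lambda>x. \<zero>\<^bsub>cmod (in_degree_one C) (i - 1)\<^esub>)" for i
    by (rule ext) simp
  show "lin S (cmod (in_degree_one C) i) (cmod (in_degree_one C) (i - 1)) (bdry (in_degree_one C) i)" for i
    unfolding eq by (intro lin_zero_map in_degree_one_module assms)
qed simp

definition koszul_induced :: "nat \<Rightarrow> ('a, 'y) module \<Rightarrow> ('x \<Rightarrow> 'y) \<Rightarrow> int \<Rightarrow> (nat set \<Rightarrow> 'x) \<Rightarrow> nat set \<Rightarrow> 'y" where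
  "koszul_induced p C \<tau> n x = (\<lambda>I\<in>Pow {1..p}. if n - int (card I) = 1 then \<tau> (x I) else \<zero>\<^bsub>C\<^esub>)"

context two_term
begin

lemma B_two: "x \<in> carrier (cmod B 2) \<Longrightarrow> x = \<zero>\<^bsub>cmod B 2\<^esub>"
  using B_trivial[of 2] by auto

text \<open>
  As \<open>B\<^sub>1\<close> is the top term of \<open>B\<close>, a map out of \<open>B\<^sub>1\<close> extends to a map of complexes
  by zero.
\<close>

lemma koszul_induced_chain_map:
  assumes \<tau>: "lin S (cmod B 1) C \<tau>"
  shows "chain_map S K (koszul_tensor f p (in_degree_one C)) (koszul_induced p C \<tau>)"
proof -
  interpret \<tau>: lin S "cmod B 1" C \<tau> by fact
  interpret D: koszul_tensor_complex S f p "in_degree_one C"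
    by (intro koszul_tensor_complex.intro cring f in_degree_one_complex \<tau>.N.module_axioms)
  have l: "lin S (cmod K n) (cmod D.K n) (koszul_induced p C \<tau> n)" for n
    unfolding koszul_tensor_cmod[of f p "in_degree_one C"]
  proof (rule lin_into_direct_sum[OF cring K_module])
    fix I assume I: "I \<in> Pow {1..p}"
    show "lin S (cmod K n) (cmod (in_degree_one C) (n - int (card I))) (\<lambda>x. koszul_induced p C \<tau> n x I)"
    proof (cases "n - int (card I) = 1")
      case True
      then have "lin S (cmod K n) C (\<lambda>x. \<tau> (x I))"
        using I by (intro lin_comp[OF lin_K_component \<tau>]) auto
      then show ?thesis using True I by (simp add: koszul_induced_def)
    next
      case False
      have "lin S (cmod K n) (sub_mod C {\<zero>\<^bsub>C\<^esub>}) (\<lambda>x. \<zero>\<^bsub>sub_mod C {\<zero>\<^bsub>C\<^esub>}\<^esub>)"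
        by (intro lin_zero_map K_module \<tau>.N.sub_mod_module \<tau>.N.singleton_zero_submodule)
      then show ?thesis using False I by (simp add: koszul_induced_def)
    qed
  qed (simp add: koszul_induced_def)
  show ?thesis
  proof (rule chain_mapI[OF l])
    fix n x assume x: "x \<in> carrier (cmod K n)"
    have c: "koszul_induced p C \<tau> n x \<in> carrier (cmod D.K n)" by (rule lin.closed[OF l x])
    have c1: "bdry D.K n (koszul_induced p C \<tau> n x) \<in> carrier (cmod D.K (n - 1))"
      by (rule lin.closed[OF D.bdry_lin c])
    have c2: "koszul_induced p C \<tau> (n - 1) (bdry K n x) \<in> carrier (cmod D.K (n - 1))"
      by (rule lin.closed[OF l lin.closed[OF bdry_lin x]])
    have "bdry D.K n (koszul_induced p C \<tau> n x) I = koszul_induced p C \<tau> (n - 1) (bdry K n x) I" if I: "I \<subseteq> {1..p}" for I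
    proof (cases "n - 1 - int (card I) = 1")
      case False
      then show ?thesis
        using D.K_component[OF c1 I refl] D.K_component[OF c2 I refl] by simp
    next
      case True
      interpret C: koszul S C f p by (rule \<tau>.N.koszulI) (rule f)
      have xj: "x (insert j I) \<in> carrier (cmod B 1)" if "j \<in> {1..p} - I" for j
        using K_component_insert[OF x I that] True by simp
      have n: "n - int (card I) = 2" using True by simp
      have "bdry D.K n (koszul_induced p C \<tau> n x) I = C.kd (koszul_induced p C \<tau> n x) I \<oplus>\<^bsub>C\<^esub> signed C (card I) \<zero>\<^bsub>C\<^esub>"
        using I True by (simp add: koszul_tensor_bdry)
      also have "C.kd (koszul_induced p C \<tau> n x) I = C.kd (\<lambda>J. \<tau> (x J)) I"
        using I xj True
        by (intro C.kd_cong) (auto simp: koszul_induced_def card_insert_index(1)[OF I] simp del: card_insert_if)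
      also have "\<dots> \<oplus>\<^bsub>C\<^esub> signed C (card I) \<zero>\<^bsub>C\<^esub> = C.kd (\<lambda>J. \<tau> (x J)) I"
        using xj C.kd_closed[of I "\<lambda>J. \<tau> (x J)"] by simp
      also have "\<dots> = \<tau> (koszul_diff (cmod B 1) f p x I)"
        using xj f by (intro \<tau>.koszul_diff[symmetric]) auto
      also have "koszul_diff (cmod B 1) f p x I = bdry K n x I"
      proof (rule bdry_at_zero[OF x I True, symmetric])
        have "x I \<in> carrier (cmod B 2)" by (rule K_component[OF x I n])
        then show "x I = \<zero>\<^bsub>cmod B (1 + 1)\<^esub>" using B_two by simp
      qed
      also have "\<tau> (bdry K n x I) = koszul_induced p C \<tau> (n - 1) (bdry K n x) I"
        using True I by (simp add: koszul_induced_def)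
      finally show ?thesis .
    qed
    then show "bdry D.K n (koszul_induced p C \<tau> n x) = koszul_induced p C \<tau> (n - 1) (bdry K n x)"
      using c1 c2 by (intro extensionalityI[of _ "Pow {1..p}"]) (auto simp: PiE_iff simp del: in_degree_one_simps)
  qed
qed

end

text \<open>
  The zeroth homology of \<open>L\<close> is annihilated by the \<open>f\<^sub>j\<close>, so that the identity of \<open>L\<^sub>0\<close> induces a map
  from the zeroth homology of \<open>K \<otimes> L\<^sub>0\<close>, a complex of free modules, to that of \<open>L\<close>.
\<close>

lemma koszul_map_extending_identity:
  assumes cr: "cring S" and nz: "\<one>\<^bsub>S\<^esub> \<noteq> \<zero>\<^bsub>S\<^esub>" and f: "\<And>j. j \<in> {1..p} \<Longrightarrow> f j \<in> carrier S"
    and L: "free_acyclic S L"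
    and kill: "\<And>j y. j \<in> {1..p} \<Longrightarrow> y \<in> carrier (cmod L 0) \<Longrightarrow>
      f j \<odot>\<^bsub>cmod L 0\<^esub> y \<in> bdry L 1 ` carrier (cmod L 1)"
  obtains \<Phi> where "chain_map S (shift (koszul_tensor f p (in_degree_one (cmod L 0)))) L \<Phi>"
    and "\<Phi> 0 = (\<lambda>x. x {})"
proof -
  note Lc = free_acyclicD(1)[OF L] and Lfree = free_acyclicD(2)[OF L]
  let ?C = "cmod L 0"
  interpret d: lin S "cmod L 1" ?C "bdry L 1" by (rule complex_lin_eq[OF Lc]) simp
  interpret C: koszul S ?C f p by (rule d.N.koszulI) (rule f)
  interpret D: two_term S f p "in_degree_one ?C"
  proof (intro two_term.intro koszul_tensor_complex.intro two_term_axioms.intro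
      cr f in_degree_one_complex d.N.module_axioms)
    show "fg_free S (cmod (in_degree_one ?C) i)" for i
      using Lfree fg_free_trivial[OF in_degree_one_module[OF d.N.module_axioms], of i]
      by (cases "i = 1") simp_all
  qed simp_all
  have sh: "cmod (shift D.K) i = cmod D.K (i + 1)" for i by simp
  show thesis
  proof (rule comparison_theorem[OF shift_complex[OF D.K_complex] _ _ L])
    show "fg_free S (cmod (shift D.K) i)" for i
      unfolding sh by (rule D.K_free[OF nz])
    show "x = \<zero>\<^bsub>cmod (shift D.K) i\<^esub>" if "i < 0" "x \<in> carrier (cmod (shift D.K) i)" for i x
    proof -
      have "x \<in> carrier (cmod D.K (i + 1))" using that(2) by simp
      then have "x I = \<zero>\<^bsub>cmod D.K (i + 1)\<^esub> I" if "I \<subseteq> {1..p}" for I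
        using D.K_component[of x "i + 1" I, OF _ that refl] \<open>i < 0\<close> that by simp
      then have "x = \<zero>\<^bsub>cmod D.K (i + 1)\<^esub>"
        using that(2) by (intro extensionalityI[of _ "Pow {1..p}"]) (auto simp: PiE_iff)
      then show ?thesis by simp
    qed
    show "lin S (cmod (shift D.K) 0) ?C (\<lambda>x. x {})"
      using D.lin_K_component[of "{}" 1 1] by simp
    show "bdry (shift D.K) 1 x {} \<in> bdry L 1 ` carrier (cmod L 1)" if "x \<in> carrier (cmod (shift D.K) 1)" for x
    proof -
      have x: "x \<in> carrier (cmod D.K 2)" using that by simp
      have Y: "submodule (bdry L 1 ` carrier (cmod L 1)) S ?C"
        by (rule d.image_submodule[OF d.M.carrier_is_submodule])
      have xj: "x {j} \<in> carrier ?C" if "j \<in> {1..p}" for j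
        using D.K_component[OF x, of "{j}" 1] that by simp
      interpret K1: smod S "cmod D.K 1" by (rule smodI[OF D.K_module])
      have "bdry D.K 2 x \<in> carrier (cmod D.K 1)"
        using lin.closed[OF D.bdry_lin x] by simp
      then have "bdry (shift D.K) 1 x {} = \<ominus>\<^bsub>?C\<^esub> bdry D.K 2 x {}"
        using lin.neg[OF D.lin_K_component[of "{}" 1 1]] by simp
      also have "bdry D.K 2 x {} = C.kd x {}"
        using xj C.kd_closed[of "{}" x] by (simp add: koszul_tensor_bdry)
      also have "\<ominus>\<^bsub>?C\<^esub> C.kd x {} \<in> bdry L 1 ` carrier (cmod L 1)"
        unfolding koszul_diff_def using kill xj
        by (intro d.N.submoduleE(3)[OF Y] d.N.submodule_finsum[OF Y]) auto
      finally show ?thesis .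
    qed
  qed (rule that)
qed

context two_term
begin

text \<open>
  Because a Koszul extension vanishes on \<open>K \<otimes> B\<^sub>0\<close>, it amounts to a map out of \<open>K \<otimes> B\<^sub>1\<close>, and the
  composite of \<open>K \<otimes> \<psi>\<close> with an extension of the identity of \<open>L\<^sub>0\<close> is one. This gives
  extensions for all \<open>\<psi>\<close> from a single map.
\<close>

lemma koszul_extension_from_identity:
  assumes L: "is_complex S L"
    and \<Phi>: "chain_map S (shift (koszul_tensor f p (in_degree_one (cmod L 0)))) L \<Phi>"
    and \<Phi>0: "\<Phi> 0 = (\<lambda>x. x {})"
    and \<psi>: "lin S (cmod B 1) (cmod L 0) (\<psi> 0)"
    and \<psi>': "\<And>i b. i \<noteq> 0 \<Longrightarrow> b \<in> carrier (cmod B (i + 1)) \<Longrightarrow> \<psi> i b = \<zero>\<^bsub>cmod L i\<^esub>"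
  shows "koszul_extension S f p B L \<psi> (\<lambda>i x. \<Phi> i (koszul_induced p (cmod L 0) (\<psi> 0) (i + 1) x))"
proof -
  let ?C = "cmod L 0" and ?\<kappa> = "koszul_induced p (cmod L 0) (\<psi> 0)"
  have C: "module S ?C" by (rule complex_module[OF L])
  interpret D: koszul_tensor_complex S f p "in_degree_one ?C"
    by (intro koszul_tensor_complex.intro cring f in_degree_one_complex C)
  note sc = shift_complex[OF K_complex] shift_complex[OF D.K_complex]
  have ch: "chain_map S (shift K) (shift D.K) (\<lambda>i. ?\<kappa> (i + 1))"
    by (rule shift_chain_map[OF K_complex D.K_complex koszul_induced_chain_map[OF \<psi>]])
  have \<Phi>z: "\<Phi> i (\<lambda>I\<in>Pow {1..p}. \<zero>\<^bsub>?C\<^esub>) = \<zero>\<^bsub>cmod L i\<^esub>" for i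
  proof -
    have "\<zero>\<^bsub>cmod (shift D.K) i\<^esub> = (\<lambda>I\<in>Pow {1..p}. \<zero>\<^bsub>?C\<^esub>)" by (auto intro!: restrict_ext)
    then show ?thesis using lin.zero[OF chain_map_lin[OF \<Phi> sc(2) L]] by metis
  qed
  have "chain_map S (shift K) L (\<lambda>i x. \<Phi> i (?\<kappa> (i + 1) x))"
    by (rule chain_map_comp[OF sc L ch \<Phi>])
  moreover have "\<Phi> i (?\<kappa> (i + 1) (koszul_unit p B (i + 1) b)) = \<psi> i b" if b: "b \<in> carrier (cmod B (i + 1))" for i b
  proof (cases "i = 0")
    case True
    then show ?thesis by (simp add: \<Phi>0 koszul_induced_def koszul_unit_def)
  next
    case False
    have "?\<kappa> (i + 1) (koszul_unit p B (i + 1) b) = (\<lambda>I\<in>Pow {1..p}. \<zero>\<^bsub>?C\<^esub>)"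
      unfolding koszul_induced_def
    proof (rule restrict_ext)
      fix I :: "nat set" assume I: "I \<in> Pow {1..p}"
      show "(if i + 1 - int (card I) = 1 then \<psi> 0 (koszul_unit p B (i + 1) b I) else \<zero>\<^bsub>?C\<^esub>) = \<zero>\<^bsub>?C\<^esub>"
        using I False lin.zero[OF \<psi>] by (cases "I = {}") (simp_all add: koszul_unit_def)
    qed
    then show ?thesis using \<Phi>z \<psi>'[OF False b] by simp
  qed
  moreover have "\<Phi> i (?\<kappa> (i + 1) x) = \<zero>\<^bsub>cmod L i\<^esub>"
    if "\<forall>I\<in>Pow {1..p}. i + 1 - int (card I) \<noteq> 0 \<longrightarrow> x I = \<zero>\<^bsub>cmod B (i + 1 - int (card I))\<^esub>" for i x
  proof -
    have "?\<kappa> (i + 1) x = (\<lambda>I\<in>Pow {1..p}. \<zero>\<^bsub>?C\<^esub>)"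
      unfolding koszul_induced_def
    proof (rule restrict_ext)
      fix I :: "nat set" assume I: "I \<in> Pow {1..p}"
      show "(if i + 1 - int (card I) = 1 then \<psi> 0 (x I) else \<zero>\<^bsub>?C\<^esub>) = \<zero>\<^bsub>?C\<^esub>"
        using bspec[OF that I] lin.zero[OF \<psi>] by simp
    qed
    then show ?thesis using \<Phi>z by simp
  qed
  ultimately show ?thesis unfolding koszul_extension_def by blast
qed

text \<open>
  An element of degree \<open>1\<close> of \<open>K \<otimes> B\<close> lies in \<open>B\<^sub>1 \<oplus> K\<^sub>1 \<otimes> B\<^sub>0\<close>; the two conditions on a Koszul
  extension prescribe its values on these summands.
\<close>

lemma koszul_extension_degree_zero:
  assumes L: "is_complex S L" and \<Psi>: "koszul_extension S f p B L \<psi> \<Psi>"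
    and x: "x \<in> carrier (cmod K 1)"
  shows "\<Psi> 0 x = \<psi> 0 (x {})"
proof -
  have ch: "chain_map S (shift K) L \<Psi>"
    and un: "\<And>b. b \<in> carrier (cmod B 1) \<Longrightarrow> \<Psi> 0 (koszul_unit p B 1 b) = \<psi> 0 b"
    and van: "\<And>x. x \<in> carrier (cmod K 1) \<Longrightarrow>
        \<forall>I\<in>Pow {1..p}. 1 - int (card I) \<noteq> 0 \<longrightarrow> x I = \<zero>\<^bsub>cmod B (1 - int (card I))\<^esub> \<Longrightarrow> \<Psi> 0 x = \<zero>\<^bsub>cmod L 0\<^esub>"
    using \<Psi> unfolding koszul_extension_def by (metis add_0)+
  interpret \<Psi>0: lin S "cmod K 1" "cmod L 0" "\<Psi> 0"
    using chain_map_lin[OF ch shift_complex[OF K_complex] L, of 0] by simp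
  have x0: "x {} \<in> carrier (cmod B 1)" using K_component[OF x, of "{}" 1] by simp
  have zB: "\<zero>\<^bsub>cmod B i\<^esub> \<in> carrier (cmod B i)" for i
    using complex_module[OF B, of i] by (simp add: module_def abelian_groupE(2))
  define u where "u = koszul_unit p B 1 (x {})"
  define r where "r = (\<lambda>I\<in>Pow {1..p}. if I = {} then \<zero>\<^bsub>cmod B 1\<^esub> else x I)"
  have u: "u \<in> carrier (cmod K 1)" using x0 zB by (auto simp: u_def koszul_unit_def)
  have r: "r \<in> carrier (cmod K 1)" using x zB by (auto simp: r_def)
  have "x = u \<oplus>\<^bsub>cmod K 1\<^esub> r"
  proof (rule extensionalityI[of _ "Pow {1..p}"])
    fix I assume I: "I \<in> Pow {1..p}"
    interpret N: smod S "cmod B (1 - int (card I))" by (rule smodI[OF complex_module[OF B]])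
    have "x I \<in> carrier (cmod B (1 - int (card I)))" using x I by auto
    then have "x I = x I \<oplus>\<^bsub>cmod B (1 - int (card I))\<^esub> \<zero>\<^bsub>cmod B (1 - int (card I))\<^esub>"
      "x I = \<zero>\<^bsub>cmod B (1 - int (card I))\<^esub> \<oplus>\<^bsub>cmod B (1 - int (card I))\<^esub> x I" by simp_all
    then show "x I = (u \<oplus>\<^bsub>cmod K 1\<^esub> r) I"
      using I by (cases "I = {}") (simp_all add: u_def r_def koszul_unit_def)
  qed (use x in \<open>auto simp: PiE_iff\<close>)
  then have "\<Psi> 0 x = \<Psi> 0 u \<oplus>\<^bsub>cmod L 0\<^esub> \<Psi> 0 r"
    using \<Psi>0.add[OF u r] by simp
  also have "\<Psi> 0 r = \<zero>\<^bsub>cmod L 0\<^esub>"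
  proof (rule van[OF r], intro ballI impI)
    fix I assume I: "I \<in> Pow {1..p}" and c: "1 - int (card I) \<noteq> 0"
    show "r I = \<zero>\<^bsub>cmod B (1 - int (card I))\<^esub>"
    proof (cases "I = {}")
      case False
      have "finite I" using I by (auto intro: finite_subset)
      then have "card I \<noteq> 0" using False by simp
      then have "carrier (cmod B (1 - int (card I))) = {\<zero>\<^bsub>cmod B (1 - int (card I))\<^esub>}"
        using c by (intro B_trivial) auto
      then show ?thesis using False I K_component[OF x, of I] by (auto simp: r_def)
    qed (simp add: r_def)
  qed
  also have "\<Psi> 0 u = \<psi> 0 (x {})" unfolding u_def by (rule un[OF x0])
  finally have "\<Psi> 0 x = \<psi> 0 (x {}) \<oplus>\<^bsub>cmod L 0\<^esub> \<zero>\<^bsub>cmod L 0\<^esub>" .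
  then show ?thesis
    using \<Psi>0.closed[OF u] \<open>\<Psi> 0 u = \<psi> 0 (x {})\<close> by simp
qed

lemma K_minimal:
  assumes I: "I \<subseteq> carrier S" and fI: "\<And>j. j \<in> {1..p} \<Longrightarrow> f j \<in> I" and "minimal_complex S I B"
  shows "minimal_complex S I K"
  unfolding minimal_complex_def
proof (intro allI subsetI)
  fix n y assume "y \<in> bdry K n ` carrier (cmod K n)"
  then obtain x where x: "x \<in> carrier (cmod K n)" and y: "y = bdry K n x" by blast
  have "bdry K n x J \<in> ideal_mod S I (cmod B (n - 1 - int (card J)))" if J: "J \<subseteq> {1..p}" for J
  proof -
    let ?N = "cmod B (n - 1 - int (card J))"
    interpret N: koszul S ?N f p by (rule B_koszul)
    have e: "n - int (card J) - 1 = n - 1 - int (card J)" by simp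
    have "bdry B (n - int (card J)) (x J) \<in> ideal_mod S I (cmod B (n - int (card J) - 1))"
      using assms(3) K_component[OF x J refl] unfolding minimal_complex_def by blast
    then have "signed ?N (card J) (bdry B (n - int (card J)) (x J)) \<in> ideal_mod S I ?N"
      unfolding e by (simp add: signed_def N.ideal_mod_neg[OF I])
    moreover have "N.kd x J \<in> ideal_mod S I ?N"
      by (rule N.kd_mem_ideal_mod[of I J x, OF I fI K_component_insert[OF x J]])
    ultimately show ?thesis
      using J N.ideal_mod_add[OF I] by (simp add: koszul_tensor_bdry)
  qed
  then show "y \<in> ideal_mod S I (cmod K (n - 1))"
    using lin.closed[OF bdry_lin x] I unfolding y koszul_tensor_cmod
    by (intro ideal_mod_direct_sum cring complex_module[OF B]) auto
qed

text \<open>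
  A Koszul extension \<open>\<Psi>\<close> and the composite of \<open>\<psi>\<close> with a Koszul extension of the identity
  agree in degree \<open>0\<close>, so that they are homotopic. Between complexes that are minimal with
  respect to \<open>I\<close> homotopic maps agree modulo \<open>I\<close>, and the composite is zero modulo \<open>I\<close> because
  \<open>\<psi>\<close> is.
\<close>

lemma koszul_extension_minimal:
  assumes nz: "\<one>\<^bsub>S\<^esub> \<noteq> \<zero>\<^bsub>S\<^esub>" and L: "free_acyclic S L"
    and kill: "\<And>j y. j \<in> {1..p} \<Longrightarrow> y \<in> carrier (cmod L 0) \<Longrightarrow>
      f j \<odot>\<^bsub>cmod L 0\<^esub> y \<in> bdry L 1 ` carrier (cmod L 1)"
    and \<psi>: "lin S (cmod B 1) (cmod L 0) (\<psi> 0)"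
    and \<psi>': "\<And>i b. i \<noteq> 0 \<Longrightarrow> b \<in> carrier (cmod B (i + 1)) \<Longrightarrow> \<psi> i b = \<zero>\<^bsub>cmod L i\<^esub>"
    and \<Psi>: "koszul_extension S f p B L \<psi> \<Psi>"
    and I: "I \<subseteq> carrier S" and fI: "\<And>j. j \<in> {1..p} \<Longrightarrow> f j \<in> I"
    and Bmin: "minimal_complex S I B" and Lmin: "minimal_complex S I L"
    and \<psi>I: "\<And>b. b \<in> carrier (cmod B 1) \<Longrightarrow> \<psi> 0 b \<in> ideal_mod S I (cmod L 0)"
    and x: "x \<in> carrier (cmod K (i + 1))"
  shows "\<Psi> i x \<in> ideal_mod S I (cmod L i)"
proof -
  note Lc = free_acyclicD(1)[OF L]
  let ?C = "cmod L 0" and ?\<kappa> = "koszul_induced p (cmod L 0) (\<psi> 0)"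
  obtain \<Phi> where \<Phi>: "chain_map S (shift (koszul_tensor f p (in_degree_one ?C))) L \<Phi>"
    and \<Phi>0: "\<Phi> 0 = (\<lambda>x. x {})"
    by (rule koszul_map_extending_identity[OF cring nz f L kill])
  have \<Psi>': "koszul_extension S f p B L \<psi> (\<lambda>i x. \<Phi> i (?\<kappa> (i + 1) x))"
    by (rule koszul_extension_from_identity[OF Lc \<Phi> \<Phi>0 \<psi> \<psi>'])
  have C: "module S ?C" by (rule complex_module[OF Lc])
  interpret C: smod S ?C by (rule smodI[OF C])
  interpret Li: smod S "cmod L i" by (rule smodI[OF complex_module[OF Lc]])
  interpret D: koszul_tensor_complex S f p "in_degree_one ?C"
    by (intro koszul_tensor_complex.intro cring f in_degree_one_complex C)
  note sK = shift_complex[OF K_complex]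
  have ch: "chain_map S (shift K) L \<Psi>" and ch': "chain_map S (shift K) L (\<lambda>i x. \<Phi> i (?\<kappa> (i + 1) x))"
    using \<Psi> \<Psi>' unfolding koszul_extension_def by blast+
  note l = chain_map_lin[OF ch sK Lc] and l' = chain_map_lin[OF ch' sK Lc]
  define \<Delta> where "\<Delta> i x = \<Psi> i x \<ominus>\<^bsub>cmod L i\<^esub> \<Phi> i (?\<kappa> (i + 1) x)" for i x
  have x': "x \<in> carrier (cmod (shift K) i)" using x by simp
  have "\<Delta> i x \<in> ideal_mod S I (cmod L i)"
  proof (rule nullhomotopic_image[OF sK _ L _ _ I _ Lmin x'])
    show "fg_free S (cmod (shift K) i)" for i unfolding shift_simps by (rule K_free[OF nz])
    show "chain_map S (shift K) L \<Delta>"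
    proof (rule chain_mapI)
      show "lin S (cmod (shift K) i) (cmod L i) (\<Delta> i)" for i
        unfolding \<Delta>_def by (rule lin_diff_map[OF l l'])
      fix i x assume x: "x \<in> carrier (cmod (shift K) i)"
      interpret d: lin S "cmod L i" "cmod L (i - 1)" "bdry L i" by (rule complex_lin[OF Lc])
      show "bdry L i (\<Delta> i x) = \<Delta> (i - 1) (bdry (shift K) i x)"
        using ch ch' x lin.closed[OF l x] lin.closed[OF l' x] unfolding chain_map_def \<Delta>_def
        by (simp del: shift_simps)
    qed
    show "\<Delta> 0 x = \<zero>\<^bsub>?C\<^esub>" if "x \<in> carrier (cmod (shift K) 0)" for x
    proof -
      have x: "x \<in> carrier (cmod K 1)" using that by simp
      have "\<Psi> 0 x = \<Phi> 0 (?\<kappa> (0 + 1) x)"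
        using koszul_extension_degree_zero[OF Lc \<Psi> x] koszul_extension_degree_zero[OF Lc \<Psi>' x] by simp
      then show ?thesis
        using lin.closed[OF l that] by (simp add: \<Delta>_def del: add_0)
    qed
    show "minimal_complex S I (shift K)"
      unfolding minimal_complex_def
    proof (intro allI subsetI)
      fix i y assume "y \<in> bdry (shift K) i ` carrier (cmod (shift K) i)"
      then obtain x where x: "x \<in> carrier (cmod K (i + 1))" and y: "y = \<ominus>\<^bsub>cmod K i\<^esub> bdry K (i + 1) x"
        unfolding shift_simps by blast
      interpret Ki: smod S "cmod K i" by (rule smodI[OF K_module])
      have "bdry K (i + 1) x \<in> ideal_mod S I (cmod K (i + 1 - 1))"
        using K_minimal[OF I fI Bmin] x unfolding minimal_complex_def by blast
      then have "y \<in> ideal_mod S I (cmod K i)"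
        unfolding y by (intro Ki.ideal_mod_neg[OF I]) simp
      then show "y \<in> ideal_mod S I (cmod (shift K) (i - 1))" by simp
    qed
  qed
  moreover have "\<Phi> i (?\<kappa> (i + 1) x) \<in> ideal_mod S I (cmod L i)"
  proof -
    have k: "?\<kappa> (i + 1) x \<in> carrier (cmod D.K (i + 1))"
      using lin.closed[OF chain_map_lin[OF koszul_induced_chain_map[OF \<psi>] K_complex D.K_complex] x] .
    have "?\<kappa> (i + 1) x J \<in> ideal_mod S I (cmod (in_degree_one ?C) (i + 1 - int (card J)))" if J: "J \<in> Pow {1..p}" for J
    proof (cases "i + 1 - int (card J) = 1")
      case True
      have "x J \<in> carrier (cmod B 1)" using K_component[OF x _ True] J by auto
      then show ?thesis using \<psi>I True J by (simp add: koszul_induced_def)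
    next
      case False
      interpret Z: smod S "sub_mod ?C {\<zero>\<^bsub>?C\<^esub>}"
        by (intro smodI C.sub_mod_module C.singleton_zero_submodule)
      show ?thesis using False J Z.ideal_mod_zero[OF I] by (simp add: koszul_induced_def)
    qed
    then have "?\<kappa> (i + 1) x \<in> ideal_mod S I (cmod D.K (i + 1))"
      using k unfolding koszul_tensor_cmod
      by (intro ideal_mod_direct_sum cring in_degree_one_module C I) auto
    then have "?\<kappa> (i + 1) x \<in> ideal_mod S I (cmod (shift D.K) i)" by simp
    then show ?thesis
      by (rule lin.ideal_mod_image[OF chain_map_lin[OF \<Phi> shift_complex[OF D.K_complex] Lc] I])
  qed
  moreover have "\<Psi> i x = \<Delta> i x \<oplus>\<^bsub>cmod L i\<^esub> \<Phi> i (?\<kappa> (i + 1) x)"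
    using Li.a_assoc[OF lin.closed[OF l x'] Li.a_inv_closed[OF lin.closed[OF l' x']] lin.closed[OF l' x']]
      Li.l_neg[OF lin.closed[OF l' x']] Li.r_zero[OF lin.closed[OF l x']]
    by (simp only: \<Delta>_def a_minus_def)
  ultimately show ?thesis using Li.ideal_mod_add[OF I] by simp
qed

end

section \<open>Mapping cones\<close>

lemma cone_simps [simp]:
  "carrier (cmod (cone Y W \<phi>) i) = {w # y | w y. w \<in> carrier (cmod W i) \<and> y \<in> carrier (cmod Y i)}"
  "\<zero>\<^bsub>cmod (cone Y W \<phi>) i\<^esub> = \<zero>\<^bsub>cmod W i\<^esub> # \<zero>\<^bsub>cmod Y i\<^esub>"
  "u \<oplus>\<^bsub>cmod (cone Y W \<phi>) i\<^esub> v = (hd u \<oplus>\<^bsub>cmod W i\<^esub> hd v) # (tl u \<oplus>\<^bsub>cmod Y i\<^esub> tl v)"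
  "a \<odot>\<^bsub>cmod (cone Y W \<phi>) i\<^esub> u = (a \<odot>\<^bsub>cmod W i\<^esub> hd u) # (a \<odot>\<^bsub>cmod Y i\<^esub> tl u)"
  "bdry (cone Y W \<phi>) i u = bdry W i (hd u) # (bdry Y i (tl u) \<oplus>\<^bsub>cmod Y (i - 1)\<^esub> \<phi> (i - 1) (hd u))"
  by (simp_all add: cone_def)

locale mapping_cone =
  fixes S :: "('a, 'c) ring_scheme" and Y :: "('a, 'w list) cplx" and W :: "('a, 'w) cplx"
    and \<phi> :: "int \<Rightarrow> 'w \<Rightarrow> 'w list"
  assumes Y: "is_complex S Y" and W: "is_complex S W" and \<phi>: "chain_map S (shift W) Y \<phi>"
begin

abbreviation C where "C \<equiv> cone Y W \<phi>"

lemma \<phi>_lin: "lin S (cmod W (i + 1)) (cmod Y i) (\<phi> i)"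
  using chain_map_lin[OF \<phi> shift_complex[OF W] Y, of i] by simp

lemma \<phi>_lin': "lin S (cmod W i) (cmod Y (i - 1)) (\<phi> (i - 1))"
  using \<phi>_lin[of "i - 1"] by simp

lemma \<phi>_bdry:
  assumes w: "w \<in> carrier (cmod W (i + 1))"
  shows "bdry Y i (\<phi> i w) = \<ominus>\<^bsub>cmod Y (i - 1)\<^esub> \<phi> (i - 1) (bdry W (i + 1) w)"
proof -
  have c: "bdry W (i + 1) w \<in> carrier (cmod W i)" by (rule lin.closed[OF complex_lin_eq[OF W] w]) simp
  have "bdry Y i (\<phi> i w) = \<phi> (i - 1) (bdry (shift W) i w)"
    using \<phi> w unfolding chain_map_def by simp
  then show ?thesis using lin.neg[OF \<phi>_lin' c] by simp
qed

lemma cone_module: "module S (cmod C i)"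
proof -
  interpret Wi: smod S "cmod W i" by (rule smodI[OF complex_module[OF W]])
  interpret Yi: smod S "cmod Y i" by (rule smodI[OF complex_module[OF Y]])
  show ?thesis
  proof (rule moduleI)
    show "abelian_group (cmod C i)"
    proof (rule abelian_groupI)
      show "\<exists>y\<in>carrier (cmod C i). y \<oplus>\<^bsub>cmod C i\<^esub> x = \<zero>\<^bsub>cmod C i\<^esub>" if "x \<in> carrier (cmod C i)" for x
      proof (rule bexI)
        show "((\<ominus>\<^bsub>cmod W i\<^esub> hd x) # (\<ominus>\<^bsub>cmod Y i\<^esub> tl x)) \<oplus>\<^bsub>cmod C i\<^esub> x = \<zero>\<^bsub>cmod C i\<^esub>"
          using that by (auto simp: Wi.l_neg Yi.l_neg)
      qed (use that in auto)
    qed (auto simp: Wi.a_ac Yi.a_ac)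
  qed (auto simp: Wi.R.cring_axioms Wi.smult_l_distr Yi.smult_l_distr Wi.smult_r_distr Yi.smult_r_distr
      Wi.smult_assoc1 Yi.smult_assoc1)
qed

lemma lin_hd: "lin S (cmod C i) (cmod W i) hd"
  by (rule linI[OF cone_module complex_module[OF W]]) auto

lemma lin_tl: "lin S (cmod C i) (cmod Y i) tl"
  by (rule linI[OF cone_module complex_module[OF Y]]) auto

lemma lin_in_W: "lin S (cmod W i) (cmod C i) (\<lambda>w. w # \<zero>\<^bsub>cmod Y i\<^esub>)"
proof -
  interpret Yi: smod S "cmod Y i" by (rule smodI[OF complex_module[OF Y]])
  show ?thesis by (rule linI[OF complex_module[OF W] cone_module]) auto
qed

lemma lin_in_Y: "lin S (cmod Y i) (cmod C i) (\<lambda>y. \<zero>\<^bsub>cmod W i\<^esub> # y)"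
proof -
  interpret Wi: smod S "cmod W i" by (rule smodI[OF complex_module[OF W]])
  show ?thesis by (rule linI[OF complex_module[OF Y] cone_module]) auto
qed

lemma cone_split:
  assumes "u \<in> carrier (cmod C i)"
  shows "u = (hd u # \<zero>\<^bsub>cmod Y i\<^esub>) \<oplus>\<^bsub>cmod C i\<^esub> (\<zero>\<^bsub>cmod W i\<^esub> # tl u)"
proof -
  interpret Wi: smod S "cmod W i" by (rule smodI[OF complex_module[OF W]])
  interpret Yi: smod S "cmod Y i" by (rule smodI[OF complex_module[OF Y]])
  show ?thesis using assms by auto
qed

lemma cone_free:
  assumes "\<one>\<^bsub>S\<^esub> \<noteq> \<zero>\<^bsub>S\<^esub>" "fg_free S (cmod W i)" "fg_free S (cmod Y i)"
  shows "fg_free S (cmod C i)"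
proof (rule fg_free_biproduct[OF assms lin_in_W lin_in_Y lin_hd lin_tl])
  show "u = (hd u # \<zero>\<^bsub>cmod Y i\<^esub>) \<oplus>\<^bsub>cmod C i\<^esub> (\<zero>\<^bsub>cmod W i\<^esub> # tl u)" if "u \<in> carrier (cmod C i)" for u
    using that by (rule cone_split)
qed simp_all

lemma cone_bdry_lin: "lin S (cmod C i) (cmod C (i - 1)) (bdry C i)"
proof -
  have 1: "lin S (cmod C i) (cmod C (i - 1)) (\<lambda>u. bdry W i (hd u) # \<zero>\<^bsub>cmod Y (i - 1)\<^esub>)"
    by (rule lin_comp[OF lin_comp[OF lin_hd complex_lin[OF W]] lin_in_W])
  have 2: "lin S (cmod C i) (cmod C (i - 1))
      (\<lambda>u. \<zero>\<^bsub>cmod W (i - 1)\<^esub> # (bdry Y i (tl u) \<oplus>\<^bsub>cmod Y (i - 1)\<^esub> \<phi> (i - 1) (hd u)))"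
    by (rule lin_comp[OF lin_add_map[OF lin_comp[OF lin_tl complex_lin[OF Y]] lin_comp[OF lin_hd \<phi>_lin']] lin_in_Y])
  interpret Wi: smod S "cmod W (i - 1)" by (rule smodI[OF complex_module[OF W]])
  interpret Yi: smod S "cmod Y (i - 1)" by (rule smodI[OF complex_module[OF Y]])
  show ?thesis
  proof (rule lin_cong[OF lin_add_map[OF 1 2]])
    fix u assume u: "u \<in> carrier (cmod C i)"
    have "bdry W i (hd u) \<in> carrier (cmod W (i - 1))"
      by (rule lin.closed[OF lin_comp[OF lin_hd complex_lin[OF W]] u])
    moreover have "bdry Y i (tl u) \<oplus>\<^bsub>cmod Y (i - 1)\<^esub> \<phi> (i - 1) (hd u) \<in> carrier (cmod Y (i - 1))"
      by (rule lin.closed[OF lin_add_map[OF lin_comp[OF lin_tl complex_lin[OF Y]] lin_comp[OF lin_hd \<phi>_lin']] u])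
    ultimately show "bdry C i u = (bdry W i (hd u) # \<zero>\<^bsub>cmod Y (i - 1)\<^esub>) \<oplus>\<^bsub>cmod C (i - 1)\<^esub>
        (\<zero>\<^bsub>cmod W (i - 1)\<^esub> # (bdry Y i (tl u) \<oplus>\<^bsub>cmod Y (i - 1)\<^esub> \<phi> (i - 1) (hd u)))"
      by simp
  qed
qed

lemma cone_complex: "is_complex S C"
proof (rule complexI[OF cone_bdry_lin])
  fix i u assume "u \<in> carrier (cmod C i)"
  then obtain w y where u: "u = w # y" and w: "w \<in> carrier (cmod W i)" and y: "y \<in> carrier (cmod Y i)" by auto
  have i: "i - 1 - 1 = i - 2" by simp
  interpret dY: lin S "cmod Y (i - 1)" "cmod Y (i - 2)" "bdry Y (i - 1)"
    by (rule complex_lin_eq[OF Y]) simp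
  have dy: "bdry Y i y \<in> carrier (cmod Y (i - 1))" by (rule lin.closed[OF complex_lin[OF Y] y])
  have dw: "bdry W i w \<in> carrier (cmod W (i - 1))" by (rule lin.closed[OF complex_lin[OF W] w])
  have fw: "\<phi> (i - 1) w \<in> carrier (cmod Y (i - 1))" by (rule lin.closed[OF \<phi>_lin' w])
  have fdw: "\<phi> (i - 2) (bdry W i w) \<in> carrier (cmod Y (i - 2))"
    using lin.closed[OF \<phi>_lin' dw] by (simp only: i)
  have "bdry Y (i - 1) (\<phi> (i - 1) w) = \<ominus>\<^bsub>cmod Y (i - 2)\<^esub> \<phi> (i - 2) (bdry W i w)"
    using \<phi>_bdry[of w "i - 1"] w by (simp add: i)
  then have "bdry Y (i - 1) (bdry Y i y \<oplus>\<^bsub>cmod Y (i - 1)\<^esub> \<phi> (i - 1) w) \<oplus>\<^bsub>cmod Y (i - 2)\<^esub> \<phi> (i - 2) (bdry W i w) = \<zero>\<^bsub>cmod Y (i - 2)\<^esub>"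
    using dy fw fdw complex_bdry_bdry[OF Y y] by (simp add: dY.N.l_neg)
  then show "bdry C (i - 1) (bdry C i u) = \<zero>\<^bsub>cmod C (i - 2)\<^esub>"
    using complex_bdry_bdry[OF W w] by (simp add: u i)
qed

text \<open>
  This is the long exact sequence of \<open>0 \<rightarrow> Y \<rightarrow> C \<rightarrow> W \<rightarrow> 0\<close> in terms of elements. As \<open>Y\<close> is acyclic
  in positive degrees, it suffices that \<open>W\<close> has no homology in degrees above \<open>1\<close> and that the
  connecting map from its first homology to the zeroth homology of \<open>Y\<close> is injective.
\<close>

lemma cone_acyclic:
  assumes nz: "\<one>\<^bsub>S\<^esub> \<noteq> \<zero>\<^bsub>S\<^esub>" and Yac: "free_acyclic S Y" and Wfree: "\<And>i. fg_free S (cmod W i)"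
    and Wneg: "\<And>i. i < 0 \<Longrightarrow> carrier (cmod W i) = {\<zero>\<^bsub>cmod W i\<^esub>}"
    and Wex: "\<And>i w. i > 0 \<Longrightarrow> w \<in> carrier (cmod W i) \<Longrightarrow> bdry W i w = \<zero>\<^bsub>cmod W (i - 1)\<^esub> \<Longrightarrow>
      (i = 1 \<Longrightarrow> \<phi> 0 w \<in> bdry Y 1 ` carrier (cmod Y 1)) \<Longrightarrow> \<exists>v\<in>carrier (cmod W (i + 1)). bdry W (i + 1) v = w"
  shows "free_acyclic S C"
  unfolding free_acyclic_def left_complex_def
proof (intro conjI allI impI cone_complex cone_free nz Wfree free_acyclicD(2)[OF Yac])
  show "carrier (cmod C i) = {\<zero>\<^bsub>cmod C i\<^esub>}" if "i < 0" for i
  proof -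
    interpret Yi: smod S "cmod Y i" by (rule smodI[OF complex_module[OF Y]])
    have "carrier (cmod Y i) = {\<zero>\<^bsub>cmod Y i\<^esub>}"
      using free_acyclicD(3)[OF Yac that] by auto
    then show ?thesis using Wneg[OF that] by simp
  qed
  fix i :: int assume i: "0 < i"
  show "{u \<in> carrier (cmod C i). bdry C i u = \<zero>\<^bsub>cmod C (i - 1)\<^esub>} = bdry C (i + 1) ` carrier (cmod C (i + 1))"
  proof (intro equalityI subsetI)
    fix u assume "u \<in> bdry C (i + 1) ` carrier (cmod C (i + 1))"
    then obtain v where v: "v \<in> carrier (cmod C (i + 1))" and u: "u = bdry C (i + 1) v" by blast
    have "u \<in> carrier (cmod C i)" unfolding u
      by (rule lin.closed[OF complex_lin_eq[OF cone_complex] v]) simp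
    moreover have "bdry C i u = \<zero>\<^bsub>cmod C (i - 1)\<^esub>" unfolding u
      by (rule bdry_bdry_eq[OF cone_complex v]) simp_all
    ultimately show "u \<in> {u \<in> carrier (cmod C i). bdry C i u = \<zero>\<^bsub>cmod C (i - 1)\<^esub>}" by blast
  next
    fix u assume "u \<in> {u \<in> carrier (cmod C i). bdry C i u = \<zero>\<^bsub>cmod C (i - 1)\<^esub>}"
    then obtain w y where u: "u = w # y" and w: "w \<in> carrier (cmod W i)" and y: "y \<in> carrier (cmod Y i)"
      and dw: "bdry W i w = \<zero>\<^bsub>cmod W (i - 1)\<^esub>"
      and dy: "bdry Y i y \<oplus>\<^bsub>cmod Y (i - 1)\<^esub> \<phi> (i - 1) w = \<zero>\<^bsub>cmod Y (i - 1)\<^esub>" by auto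
    interpret dY: lin S "cmod Y i" "cmod Y (i - 1)" "bdry Y i" by (rule complex_lin[OF Y])
    have fw: "\<phi> (i - 1) w \<in> carrier (cmod Y (i - 1))" by (rule lin.closed[OF \<phi>_lin' w])
    have fw': "\<phi> (i - 1) w = bdry Y i (\<ominus>\<^bsub>cmod Y i\<^esub> y)"
      using y fw dy dY.N.minus_equality[of "\<phi> (i - 1) w" "bdry Y i y"] by (simp add: dY.N.a_comm)
    have "\<exists>v\<in>carrier (cmod W (i + 1)). bdry W (i + 1) v = w"
    proof (rule Wex[OF i w dw])
      assume "i = 1"
      then show "\<phi> 0 w \<in> bdry Y 1 ` carrier (cmod Y 1)"
        using fw' dY.M.a_inv_closed[OF y] by simp
    qed
    then obtain v where v: "v \<in> carrier (cmod W (i + 1))" and dv: "bdry W (i + 1) v = w" by blast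
    have fv: "\<phi> i v \<in> carrier (cmod Y i)" by (rule lin.closed[OF \<phi>_lin v])
    define y' where "y' = y \<ominus>\<^bsub>cmod Y i\<^esub> \<phi> i v"
    have y': "y' \<in> carrier (cmod Y i)" using y fv by (simp add: y'_def)
    have "bdry Y i y' = bdry Y i y \<oplus>\<^bsub>cmod Y (i - 1)\<^esub> \<phi> (i - 1) w"
      using y fv fw \<phi>_bdry[OF v] dv by (simp add: y'_def a_minus_def)
    then have "bdry Y i y' = \<zero>\<^bsub>cmod Y (i - 1)\<^esub>" using dy by simp
    then have "y' \<in> bdry Y (i + 1) ` carrier (cmod Y (i + 1))"
      by (intro free_acyclicD(4)[OF Yac i y']) auto
    then obtain t where t: "t \<in> carrier (cmod Y (i + 1))" and y't: "y' = bdry Y (i + 1) t" by blast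
    have "bdry Y (i + 1) t \<oplus>\<^bsub>cmod Y i\<^esub> \<phi> i v = y"
      using y fv unfolding y't[symmetric] y'_def a_minus_def by (simp add: dY.M.a_assoc dY.M.l_neg)
    then have "bdry C (i + 1) (v # t) = u" by (simp add: u dv)
    moreover have "v # t \<in> carrier (cmod C (i + 1))" using v t by simp
    ultimately show "u \<in> bdry C (i + 1) ` carrier (cmod C (i + 1))" by (metis imageI)
  qed
qed

lemma cone_minimal:
  assumes I: "I \<subseteq> carrier S" and Ymin: "minimal_complex S I Y" and Wmin: "minimal_complex S I W"
    and \<phi>I: "\<And>i w. w \<in> carrier (cmod W (i + 1)) \<Longrightarrow> \<phi> i w \<in> ideal_mod S I (cmod Y i)"
  shows "minimal_complex S I C"
  unfolding minimal_complex_def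
proof (intro allI subsetI)
  fix i v assume "v \<in> bdry C i ` carrier (cmod C i)"
  then obtain u where uC: "u \<in> carrier (cmod C i)" and v: "v = bdry C i u" by blast
  then obtain w y where u: "u = w # y" and w: "w \<in> carrier (cmod W i)" and y: "y \<in> carrier (cmod Y i)" by auto
  interpret Y1: smod S "cmod Y (i - 1)" by (rule smodI[OF complex_module[OF Y]])
  interpret C1: smod S "cmod C (i - 1)" by (rule smodI[OF cone_module])
  have "bdry W i w \<in> ideal_mod S I (cmod W (i - 1))"
    using Wmin w unfolding minimal_complex_def by blast
  from lin.ideal_mod_image[OF lin_in_W I this]
  have 1: "hd v # \<zero>\<^bsub>cmod Y (i - 1)\<^esub> \<in> ideal_mod S I (cmod C (i - 1))" by (simp add: v u)
  have "bdry Y i y \<in> ideal_mod S I (cmod Y (i - 1))"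
    using Ymin y unfolding minimal_complex_def by blast
  moreover have "\<phi> (i - 1) w \<in> ideal_mod S I (cmod Y (i - 1))" using w by (intro \<phi>I) simp
  ultimately have "bdry Y i y \<oplus>\<^bsub>cmod Y (i - 1)\<^esub> \<phi> (i - 1) w \<in> ideal_mod S I (cmod Y (i - 1))"
    by (rule Y1.ideal_mod_add[OF I])
  from lin.ideal_mod_image[OF lin_in_Y I this]
  have 2: "\<zero>\<^bsub>cmod W (i - 1)\<^esub> # tl v \<in> ideal_mod S I (cmod C (i - 1))" by (simp add: v u)
  have "v \<in> carrier (cmod C (i - 1))" unfolding v by (rule lin.closed[OF cone_bdry_lin uC])
  from cone_split[OF this] C1.ideal_mod_add[OF I 1 2] show "v \<in> ideal_mod S I (cmod C (i - 1))" by simp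
qed

end

section \<open>The data of a higher matrix factorization\<close>

(* The indices s = 1 and p = 1 are kept as written, so that facts about the terms indexed by
   them rewrite goals without passing through Suc 0. *)
declare One_nat_def [simp del]

locale hmf_construction =
  fixes S :: "('a, 'b) ring_scheme" and f :: "nat \<Rightarrow> 'a" and c :: nat
    and X :: "('a, 'm) hmf_data" and B :: "nat \<Rightarrow> nat \<Rightarrow> 'm set"
  assumes S: "cring S" and regular: "regular_sequence S f c"
    and hmf: "hmf S f c X" and splitting: "splitting S c X B"
begin

lemma f_closed: "j \<in> {1..p} \<Longrightarrow> p \<le> c \<Longrightarrow> f j \<in> carrier S"
  using regular by (auto simp: regular_sequence_def)

lemma regular_upto: "p \<le> c \<Longrightarrow> regular_upto S f p"
  unfolding regular_upto_def
proof (intro conjI ballI allI impI)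
  fix q a assume "p \<le> c" "q < p" "a \<in> carrier S" "f (Suc q) \<otimes>\<^bsub>S\<^esub> a \<in> seq_ideal S f q"
  moreover from this have "Suc q \<in> {1..c}" by auto
  ultimately show "a \<in> seq_ideal S f q"
    using regular unfolding regular_sequence_def by fastforce
qed (rule f_closed)

lemma one_not_zero: "\<one>\<^bsub>S\<^esub> \<noteq> \<zero>\<^bsub>S\<^esub>"
proof
  assume "\<one>\<^bsub>S\<^esub> = \<zero>\<^bsub>S\<^esub>"
  interpret cring S by (rule S)
  interpret I: ideal "seq_ideal S f c" S by (rule seq_ideal_ideal[of S c f, OF S f_closed[OF _ order_refl]])
  have "carrier S = {\<zero>\<^bsub>S\<^esub>}"
    using \<open>\<one>\<^bsub>S\<^esub> = \<zero>\<^bsub>S\<^esub>\<close> by (rule one_zeroD)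
  then have "seq_ideal S f c = carrier S" using I.zero_closed I.a_subset by auto
  then show False using regular by (simp add: regular_sequence_def)
qed

abbreviation I where "I p \<equiv> seq_ideal S f p"

lemma I_subset: "p \<le> c \<Longrightarrow> I p \<subseteq> carrier S"
  by (rule seq_ideal_subset[of S p f, OF S f_closed])

lemma f_mem_I: "j \<in> {1..p} \<Longrightarrow> p \<le> c \<Longrightarrow> f j \<in> I p"
  by (rule seq_ideal_mem[of S p f, OF S f_closed])

lemma filtration: "s \<in> {0, 1} \<Longrightarrow> free_filtration S c (amb X s) (fil X s)"
  using hmf unfolding hmf_def by blast

lemma amb_module: "s \<in> {0, 1} \<Longrightarrow> smod S (amb X s)"
  by (rule smodI[OF fg_free_module], drule filtration, unfold free_filtration_def, elim conjE)

lemma fil_0: "s \<in> {0, 1} \<Longrightarrow> fil X s 0 = {\<zero>\<^bsub>amb X s\<^esub>}"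
  by (drule filtration, unfold free_filtration_def, elim conjE)

lemma fil_submodule:
  assumes "s \<in> {0, 1}" "p \<le> c"
  shows "submodule (fil X s p) S (amb X s)"
proof (cases "p = 0")
  case True
  then show ?thesis using smod.singleton_zero_submodule[OF amb_module] fil_0 assms by simp
next
  case False
  then have "p \<in> {1..c}" using assms by auto
  with filtration[OF assms(1)] show ?thesis
    unfolding free_filtration_def by (elim conjE) (drule bspec, assumption, elim conjE)
qed

lemma fil_subset: "s \<in> {0, 1} \<Longrightarrow> p \<in> {1..c} \<Longrightarrow> fil X s (p - 1) \<subseteq> fil X s p"
  by (drule filtration, unfold free_filtration_def, elim conjE, drule bspec, assumption, elim conjE)

lemma fil_carrier: "s \<in> {0, 1} \<Longrightarrow> p \<le> c \<Longrightarrow> x \<in> fil X s p \<Longrightarrow> x \<in> carrier (amb X s)"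
  by (rule subsetD[OF module.submoduleE(1)[OF smod.axioms[OF amb_module] fil_submodule]])

abbreviation A where "A s p \<equiv> Afil X s p"
abbreviation Bm where "Bm s p \<equiv> sub_mod (amb X s) (B s p)"

lemma A_simps [simp]:
  "carrier (A s p) = fil X s p" "zero (A s p) = zero (amb X s)" "add (A s p) = add (amb X s)"
  "smult (A s p) = smult (amb X s)"
  by (simp_all add: Afil_def)

lemma A_module: "s \<in> {0, 1} \<Longrightarrow> p \<le> c \<Longrightarrow> smod S (A s p)"
  unfolding Afil_def by (intro smodI smod.sub_mod_module amb_module fil_submodule)

lemma internal: "s \<in> {0, 1} \<Longrightarrow> p \<in> {1..c} \<Longrightarrow> internal_sum S (amb X s) (fil X s p) (fil X s (p - 1)) (B s p)"
  using splitting unfolding splitting_def by blast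

lemma B_submodule: "s \<in> {0, 1} \<Longrightarrow> p \<in> {1..c} \<Longrightarrow> submodule (B s p) S (amb X s)"
  using internal unfolding internal_sum_def by blast

lemma Bm_module: "s \<in> {0, 1} \<Longrightarrow> p \<in> {1..c} \<Longrightarrow> smod S (Bm s p)"
  by (intro smodI smod.sub_mod_module amb_module B_submodule)

lemma B_subset_fil:
  assumes s: "s \<in> {0, 1}" and p: "p \<in> {1..c}" and b: "b \<in> B s p"
  shows "b \<in> fil X s p"
proof -
  interpret M: smod S "amb X s" by (rule amb_module[OF s])
  have "\<zero>\<^bsub>amb X s\<^esub> \<in> fil X s (p - 1)"
    using p by (intro M.submodule_zero_mem fil_submodule[OF s]) auto
  moreover have "b \<in> carrier (amb X s)" using b M.submoduleE(1)[OF B_submodule[OF s p]] by auto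
  then have "b = \<zero>\<^bsub>amb X s\<^esub> \<oplus>\<^bsub>amb X s\<^esub> b" by simp
  ultimately show ?thesis
    using internal[OF s p] b unfolding internal_sum_def set_add_def' by blast
qed

lemma components:
  assumes s: "s \<in> {0, 1}" and p: "p \<in> {1..c}"
  shows "\<And>x. x \<in> fil X s p \<Longrightarrow> compA X B s p x \<in> fil X s (p - 1) \<and> compB X B s p x \<in> B s p \<and>
      x = compA X B s p x \<oplus>\<^bsub>amb X s\<^esub> compB X B s p x"
    and "\<And>y b. y \<in> fil X s (p - 1) \<Longrightarrow> b \<in> B s p \<Longrightarrow>
      compA X B s p (y \<oplus>\<^bsub>amb X s\<^esub> b) = y \<and> compB X B s p (y \<oplus>\<^bsub>amb X s\<^esub> b) = b"
proof -
  interpret M: smod S "amb X s" by (rule amb_module[OF s])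
  have F: "submodule (fil X s (p - 1)) S (amb X s)" using p by (intro fil_submodule[OF s]) auto
  have Bs: "submodule (B s p) S (amb X s)" by (rule B_submodule[OF s p])
  have cl: "y \<in> carrier (amb X s)" if "y \<in> fil X s (p - 1) \<or> y \<in> B s p" for y
    using that M.submoduleE(1)[OF F] M.submoduleE(1)[OF Bs] by auto
  have uniq: "y = y' \<and> b = b'"
    if "y \<in> fil X s (p - 1)" "b \<in> B s p" "y' \<in> fil X s (p - 1)" "b' \<in> B s p"
      and eq: "y \<oplus>\<^bsub>amb X s\<^esub> b = y' \<oplus>\<^bsub>amb X s\<^esub> b'" for y b y' b'
  proof -
    note cl' = cl[OF disjI1[OF that(1)]] cl[OF disjI2[OF that(2)]] cl[OF disjI1[OF that(3)]] cl[OF disjI2[OF that(4)]]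
    have e: "y \<ominus>\<^bsub>amb X s\<^esub> y' = b' \<ominus>\<^bsub>amb X s\<^esub> b" by (rule M.add_eq_add_imp[OF cl' eq])
    have "y \<ominus>\<^bsub>amb X s\<^esub> y' \<in> fil X s (p - 1)" by (rule M.submodule_diff[OF F that(1,3)])
    moreover have "y \<ominus>\<^bsub>amb X s\<^esub> y' \<in> B s p" unfolding e by (rule M.submodule_diff[OF Bs that(4,2)])
    ultimately have "y \<ominus>\<^bsub>amb X s\<^esub> y' = \<zero>\<^bsub>amb X s\<^esub>"
      using internal[OF s p] unfolding internal_sum_def by blast
    then show ?thesis using e cl' by (simp add: M.diff_eq_zero_iff)
  qed
  show *: "compA X B s p (y \<oplus>\<^bsub>amb X s\<^esub> b) = y \<and> compB X B s p (y \<oplus>\<^bsub>amb X s\<^esub> b) = b"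
    if "y \<in> fil X s (p - 1)" "b \<in> B s p" for y b
  proof
    show "compA X B s p (y \<oplus>\<^bsub>amb X s\<^esub> b) = y"
      unfolding compA_def using that uniq by (intro the_equality) blast+
    show "compB X B s p (y \<oplus>\<^bsub>amb X s\<^esub> b) = b"
      unfolding compB_def using that uniq by (intro the_equality) blast+
  qed
  fix x assume "x \<in> fil X s p"
  then obtain y b where "y \<in> fil X s (p - 1)" "b \<in> B s p" "x = y \<oplus>\<^bsub>amb X s\<^esub> b"
    using internal[OF s p] unfolding internal_sum_def set_add_def' by blast
  with * show "compA X B s p x \<in> fil X s (p - 1) \<and> compB X B s p x \<in> B s p \<and>
      x = compA X B s p x \<oplus>\<^bsub>amb X s\<^esub> compB X B s p x" by simp
qed

lemma comp_lin:
  assumes s: "s \<in> {0, 1}" and p: "p \<in> {1..c}"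
  shows "lin S (A s p) (A s (p - 1)) (compA X B s p)" and "lin S (A s p) (Bm s p) (compB X B s p)"
proof -
  have p': "p \<le> c" "p - 1 \<le> c" using p by auto
  interpret M: smod S "amb X s" by (rule amb_module[OF s])
  interpret Ap: smod S "A s p" by (rule A_module[OF s p'(1)])
  interpret A': smod S "A s (p - 1)" by (rule A_module[OF s p'(2)])
  interpret Bp: smod S "Bm s p" by (rule Bm_module[OF s p])
  note F = M.submoduleE[OF fil_submodule[OF s p'(2)]] and Bs = M.submoduleE[OF B_submodule[OF s p]]
  have add: "compA X B s p (x \<oplus>\<^bsub>amb X s\<^esub> y) = compA X B s p x \<oplus>\<^bsub>amb X s\<^esub> compA X B s p y \<and>
      compB X B s p (x \<oplus>\<^bsub>amb X s\<^esub> y) = compB X B s p x \<oplus>\<^bsub>amb X s\<^esub> compB X B s p y"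
    if "x \<in> fil X s p" "y \<in> fil X s p" for x y
  proof -
    note x = components(1)[OF s p that(1)] and y = components(1)[OF s p that(2)]
    define a b a' b' where "a = compA X B s p x" and "b = compB X B s p x"
      and "a' = compA X B s p y" and "b' = compB X B s p y"
    have m: "a \<in> fil X s (p - 1)" "b \<in> B s p" "a' \<in> fil X s (p - 1)" "b' \<in> B s p"
      and e: "x = a \<oplus>\<^bsub>amb X s\<^esub> b" "y = a' \<oplus>\<^bsub>amb X s\<^esub> b'"
      using x y unfolding a_def b_def a'_def b'_def by blast+
    have cl: "a \<in> carrier (amb X s)" "b \<in> carrier (amb X s)" "a' \<in> carrier (amb X s)" "b' \<in> carrier (amb X s)"
      using m F(1) Bs(1) by auto
    have "x \<oplus>\<^bsub>amb X s\<^esub> y = (a \<oplus>\<^bsub>amb X s\<^esub> a') \<oplus>\<^bsub>amb X s\<^esub> (b \<oplus>\<^bsub>amb X s\<^esub> b')"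
      unfolding e using cl by (simp add: M.a_ac)
    then show ?thesis
      using components(2)[OF s p F(5)[OF m(1,3)] Bs(5)[OF m(2,4)]] by (simp add: a_def b_def a'_def b'_def)
  qed
  have smult: "compA X B s p (r \<odot>\<^bsub>amb X s\<^esub> x) = r \<odot>\<^bsub>amb X s\<^esub> compA X B s p x \<and>
      compB X B s p (r \<odot>\<^bsub>amb X s\<^esub> x) = r \<odot>\<^bsub>amb X s\<^esub> compB X B s p x"
    if "r \<in> carrier S" "x \<in> fil X s p" for r x
  proof -
    define a b where "a = compA X B s p x" and "b = compB X B s p x"
    have m: "a \<in> fil X s (p - 1)" "b \<in> B s p" and e: "x = a \<oplus>\<^bsub>amb X s\<^esub> b"
      using components(1)[OF s p that(2)] unfolding a_def b_def by blast+
    have cl: "a \<in> carrier (amb X s)" "b \<in> carrier (amb X s)" using m F(1) Bs(1) by auto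
    have "r \<odot>\<^bsub>amb X s\<^esub> x = (r \<odot>\<^bsub>amb X s\<^esub> a) \<oplus>\<^bsub>amb X s\<^esub> (r \<odot>\<^bsub>amb X s\<^esub> b)"
      unfolding e using cl that(1) by (simp add: M.smult_r_distr)
    then show ?thesis
      using components(2)[OF s p F(4)[OF that(1) m(1)] Bs(4)[OF that(1) m(2)]] by (simp add: a_def b_def)
  qed
  show "lin S (A s p) (A s (p - 1)) (compA X B s p)"
    by (rule linI[OF Ap.module_axioms A'.module_axioms]) (use components(1)[OF s p] add smult in auto)
  show "lin S (A s p) (Bm s p) (compB X B s p)"
    by (rule linI[OF Ap.module_axioms Bp.module_axioms]) (use components(1)[OF s p] add smult in auto)
qed

lemma comp_fil:
  assumes s: "s \<in> {0, 1}" and p: "p \<in> {1..c}" and x: "x \<in> fil X s (p - 1)"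
  shows "compA X B s p x = x" "compB X B s p x = \<zero>\<^bsub>amb X s\<^esub>"
proof -
  interpret M: smod S "amb X s" by (rule amb_module[OF s])
  have "x \<in> carrier (amb X s)" using p by (intro fil_carrier[OF s _ x]) auto
  then show "compA X B s p x = x" "compB X B s p x = \<zero>\<^bsub>amb X s\<^esub>"
    using components(2)[OF s p x M.submodule_zero_mem[OF B_submodule[OF s p]]] by simp_all
qed

lemma comp_B:
  assumes s: "s \<in> {0, 1}" and p: "p \<in> {1..c}" and b: "b \<in> B s p"
  shows "compB X B s p b = b"
proof -
  interpret M: smod S "amb X s" by (rule amb_module[OF s])
  have "b \<in> carrier (amb X s)" using M.submoduleE(1)[OF B_submodule[OF s p]] b by auto
  moreover have "\<zero>\<^bsub>amb X s\<^esub> \<in> fil X s (p - 1)"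
    using p by (intro M.submodule_zero_mem fil_submodule[OF s]) auto
  ultimately show ?thesis using components(2)[OF s p _ b, of "\<zero>\<^bsub>amb X s\<^esub>"] by simp
qed

lemma B_lin_inclusion: "s \<in> {0, 1} \<Longrightarrow> p \<in> {1..c} \<Longrightarrow> lin S (Bm s p) (A s p) (\<lambda>x. x)"
  by (rule linI) (auto intro!: smod.axioms Bm_module A_module intro: B_subset_fil)

lemma A_lin_inclusion: "s \<in> {0, 1} \<Longrightarrow> p \<in> {1..c} \<Longrightarrow> lin S (A s (p - 1)) (A s p) (\<lambda>x. x)"
  using fil_subset[of s p] by (intro linI) (auto intro!: smod.axioms A_module)

text \<open>
  Freeness of the \<open>B\<^sub>s(p)\<close> and condition (b) are stated for the quotients \<open>A\<^sub>s(p)/A\<^sub>s(p-1)\<close>, whereas the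
  resolutions are built from the complements in the splitting. The isomorphism \<open>\<beta>\<close> between the
  two carries these statements over.
\<close>

lemma quotient_of_splitting:
  assumes s: "s \<in> {0, 1}" and p: "p \<in> {1..c}"
  obtains \<beta> where "lin S (Bquot X s p) (Bm s p) \<beta>"
    "\<And>x. x \<in> fil X s p \<Longrightarrow> \<beta> (proj_quot X s p x) = compB X B s p x"
    "bij_betw \<beta> (carrier (Bquot X s p)) (carrier (Bm s p))"
    "lin S (A s p) (Bquot X s p) (proj_quot X s p)"
proof -
  have p': "p \<le> c" "p - 1 \<le> c" using p by auto
  interpret M: smod S "amb X s" by (rule amb_module[OF s])
  interpret Ap: smod S "A s p" by (rule A_module[OF s p'(1)])
  interpret cB: lin S "A s p" "Bm s p" "compB X B s p" by (rule comp_lin(2)[OF s p])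
  have H: "submodule (fil X s (p - 1)) S (A s p)"
    using lin.image_submodule[OF A_lin_inclusion[OF s p] module.carrier_is_submodule[OF smod.axioms[OF A_module[OF s p'(2)]]]]
    by simp
  have coset: "fil X s (p - 1) +>\<^bsub>A s p\<^esub> x = proj_quot X s p x" for x
    by (simp add: proj_quot_def a_r_coset_def r_coset_def)
  have kill: "compB X B s p x = \<zero>\<^bsub>Bm s p\<^esub>" if "x \<in> fil X s (p - 1)" for x
    using comp_fil(2)[OF s p that] by simp
  have Q: "Bquot X s p = quot_mod (A s p) (fil X s (p - 1))" by (simp add: Bquot_def)
  obtain \<beta> where \<beta>: "lin S (Bquot X s p) (Bm s p) \<beta>"
    and \<beta>x: "\<And>x. x \<in> fil X s p \<Longrightarrow> \<beta> (proj_quot X s p x) = compB X B s p x"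
    by (rule cB.factor_through_quotient[OF H kill]) (auto simp: coset Q)
  have carr: "carrier (Bquot X s p) = proj_quot X s p ` fil X s p"
    using Ap.quot_mod_simps(1)[OF H] by (simp add: Q coset)
  have "inj_on \<beta> (carrier (Bquot X s p))"
  proof (rule inj_onI)
    fix C D assume "C \<in> carrier (Bquot X s p)" "D \<in> carrier (Bquot X s p)" and eq: "\<beta> C = \<beta> D"
    then obtain x y where x: "x \<in> fil X s p" and y: "y \<in> fil X s p"
      and C: "C = proj_quot X s p x" and D: "D = proj_quot X s p y"
      unfolding carr by blast
    have xy: "x \<ominus>\<^bsub>A s p\<^esub> y \<in> fil X s p" using Ap.minus_closed[of x y] x y by simp
    have "compB X B s p (x \<ominus>\<^bsub>A s p\<^esub> y) = \<zero>\<^bsub>Bm s p\<^esub>"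
      using eq cB.diff[of x y] x y cB.closed[of x] cB.closed[of y]
      by (simp add: C D \<beta>x cB.N.diff_eq_zero_iff)
    then have "x \<ominus>\<^bsub>A s p\<^esub> y \<in> fil X s (p - 1)"
      using components(1)[OF s p xy] fil_carrier[OF s p'(2)] by (metis M.r_zero sub_mod_simps(2))
    then show "C = D"
      using Ap.coset_eq_iff[OF H, of x y] x y by (simp add: C D coset)
  qed
  moreover have "\<beta> ` carrier (Bquot X s p) = B s p"
  proof -
    have "\<beta> ` carrier (Bquot X s p) = compB X B s p ` fil X s p"
      unfolding carr image_image using \<beta>x by (intro image_cong) auto
    also have "\<dots> = B s p"
      using components(1)[OF s p] comp_B[OF s p] B_subset_fil[OF s p] by (force simp: image_iff)
    finally show ?thesis .
  qed
  ultimately have "bij_betw \<beta> (carrier (Bquot X s p)) (carrier (Bm s p))"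
    by (simp add: bij_betw_def)
  moreover have "lin S (A s p) (Bquot X s p) (proj_quot X s p)"
    using Ap.lin_proj[OF H] by (simp add: coset Q)
  ultimately show thesis by (intro that[OF \<beta> \<beta>x])
qed

lemma B_free:
  assumes s: "s \<in> {0, 1}" and p: "p \<in> {1..c}"
  shows "fg_free S (Bm s p)"
proof -
  obtain \<beta> where \<beta>: "lin S (Bquot X s p) (Bm s p) \<beta>"
    and bij: "bij_betw \<beta> (carrier (Bquot X s p)) (carrier (Bm s p))"
    by (rule quotient_of_splitting[OF s p])
  have "fg_free S (Bquot X s p)"
    using filtration[OF s] p unfolding free_filtration_def Bquot_def Afil_def
    by (elim conjE) (drule bspec, assumption, elim conjE)
  then show ?thesis by (rule fg_free_iso[OF one_not_zero _ \<beta> bij])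
qed

lemma d_lin:
  assumes p: "p \<le> c"
  shows "lin S (A 1 p) (A 0 p) (dmap X)"
proof -
  interpret d: lin S "amb X 1" "amb X 0" "dmap X"
  proof (intro lin.intro lin_axioms.intro amb_module)
    show "dmap X \<in> mod_hom S (amb X 1) (amb X 0)" using hmf unfolding hmf_def by (elim conjE)
  qed auto
  have "dmap X x \<in> fil X 0 p" if "x \<in> fil X 1 p" for x
  proof (cases "p = 0")
    case True
    then show ?thesis using that fil_0 d.zero by simp
  next
    case False
    then have "p \<in> {1..c}" using p by auto
    with hmf have "dmap X ` fil X 1 p \<subseteq> fil X 0 p"
      unfolding hmf_def by (elim conjE) (drule bspec, assumption)+
    then show ?thesis using that by auto
  qed
  then show ?thesis
    using fil_carrier[of 1 p] p
    by (intro linI) (auto intro!: smod.axioms A_module)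
qed

lemma h_lin:
  assumes p: "p \<in> {1..c}"
  shows "lin S (A 0 p) (A 1 p) (hcomp c X p)"
proof -
  have H: "lin S (hsource c X) (amb X 1) (hmap X)"
  proof (intro lin.intro lin_axioms.intro amb_module)
    show "hmap X \<in> mod_hom S (hsource c X) (amb X 1)" using hmf unfolding hmf_def by (elim conjE)
    show "smod S (hsource c X)"
      unfolding hsource_def by (intro smodI direct_sum_module S smod.axioms[OF A_module]) auto
  qed auto
  have "lin S (A 0 p) (hsource c X) (single {1..c} (Afil X 0) p)"
    unfolding hsource_def using p by (intro lin_single S smod.axioms A_module) auto
  from lin_comp[OF this H] have l: "lin S (A 0 p) (amb X 1) (\<lambda>x. hmap X (single {1..c} (Afil X 0) p x))" .
  have eq: "hmap X (single {1..c} (Afil X 0) p x) = hcomp c X p x" for x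
    by (simp add: hcomp_def single_def cong: if_cong)
  interpret h: lin S "A 0 p" "amb X 1" "hcomp c X p" using l by (simp add: eq)
  have "hcomp c X p x \<in> fil X 1 p" if x: "x \<in> fil X 0 p" for x
  proof -
    let ?y = "\<lambda>q\<in>{1..c}. if q = p then x else \<zero>\<^bsub>amb X 0\<^esub>"
    have "?y \<in> carrier (hsource c X)"
      using x smod.submodule_zero_mem[OF amb_module fil_submodule, of 0] by (auto simp: hsource_def)
    moreover have "\<forall>q\<in>{p<..c}. ?y q = \<zero>\<^bsub>amb X 0\<^esub>" using p by auto
    ultimately show ?thesis using hmf p unfolding hmf_def hcomp_def by blast
  qed
  then show ?thesis
    using p h.add h.smult by (intro linI) (auto intro!: smod.axioms A_module)
qed

lemma condition_a:
  "p \<in> {1..c} \<Longrightarrow> x \<in> fil X 0 p \<Longrightarrow>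
   dmap X (hcomp c X p x) \<ominus>\<^bsub>A 0 p\<^esub> (f p \<odot>\<^bsub>amb X 0\<^esub> x) \<in> ideal_mod S (I (p - 1)) (A 0 p)"
  using hmf unfolding hmf_def by simp

lemma condition_b:
  assumes p: "p \<in> {1..c}" and x: "x \<in> fil X 1 p"
  shows "compB X B 1 p (hcomp c X p (dmap X x)) \<ominus>\<^bsub>Bm 1 p\<^esub> f p \<odot>\<^bsub>amb X 1\<^esub> compB X B 1 p x
    \<in> ideal_mod S (I (p - 1)) (Bm 1 p)"
proof -
  have p': "p \<le> c" "p - 1 \<le> c" using p by auto
  obtain \<beta> where \<beta>: "lin S (Bquot X 1 p) (Bm 1 p) \<beta>"
    and \<beta>x: "\<And>x. x \<in> fil X 1 p \<Longrightarrow> \<beta> (proj_quot X 1 p x) = compB X B 1 p x"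
    and pr: "lin S (A 1 p) (Bquot X 1 p) (proj_quot X 1 p)"
    by (rule quotient_of_splitting[of 1 p]) (use p in auto)
  interpret \<beta>: lin S "Bquot X 1 p" "Bm 1 p" \<beta> by (rule \<beta>)
  let ?y = "hcomp c X p (dmap X x)"
  have y: "?y \<in> fil X 1 p"
    using lin.closed[OF lin_comp[OF d_lin[OF p'(1)] h_lin[OF p]], of x] x by simp
  have fp: "f p \<in> carrier S" using p by (intro f_closed[OF _ p'(1)]) auto
  have px: "proj_quot X 1 p x \<in> carrier (Bquot X 1 p)" "proj_quot X 1 p ?y \<in> carrier (Bquot X 1 p)"
    using lin.closed[OF pr] x y by simp_all
  have "proj_quot X 1 p ?y \<ominus>\<^bsub>Bquot X 1 p\<^esub> (f p \<odot>\<^bsub>Bquot X 1 p\<^esub> proj_quot X 1 p x)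
      \<in> ideal_mod S (I (p - 1)) (Bquot X 1 p)"
    using hmf p x unfolding hmf_def by blast
  from \<beta>.ideal_mod_image[OF I_subset[OF p'(2)] this]
  show ?thesis using px fp x y by (simp add: \<beta>x)
qed

lemma Bcplx_simps [simp]:
  "cmod (Bcplx X B p) = Bterm X B p"
  "bdry (Bcplx X B p) i x = (if i = 1 then compB X B 0 p (dmap X x) else \<zero>\<^bsub>Bterm X B p (i - 1)\<^esub>)"
  by (simp_all add: Bcplx_def)

lemma Bterm_simps [simp]:
  "Bterm X B p 0 = Bm 0 p" "Bterm X B p 1 = Bm 1 p"
  "i \<noteq> 0 \<Longrightarrow> i \<noteq> 1 \<Longrightarrow> Bterm X B p i = sub_mod (amb X 0) {\<zero>\<^bsub>amb X 0\<^esub>}"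
  by (simp_all add: Bterm_def)

lemma b_lin:
  assumes p: "p \<in> {1..c}"
  shows "lin S (Bm 1 p) (Bm 0 p) (\<lambda>x. compB X B 0 p (dmap X x))"
  using p by (intro lin_comp[OF B_lin_inclusion lin_comp[OF d_lin comp_lin(2)]]) auto

lemma Bcplx_two_term:
  assumes p: "p \<in> {1..c}" and q: "q \<le> c"
  shows "two_term S f q (Bcplx X B p)"
proof -
  have z: "module S (sub_mod (amb X 0) {\<zero>\<^bsub>amb X 0\<^esub>})"
    by (intro smod.sub_mod_module smod.singleton_zero_submodule amb_module) auto
  have free: "fg_free S (Bterm X B p i)" for i
    using B_free[OF _ p] fg_free_trivial[OF z] by (cases "i = 0 \<or> i = 1") auto
  have "is_complex S (Bcplx X B p)"
  proof (rule complexI)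
    fix i
    show l: "lin S (cmod (Bcplx X B p) i) (cmod (Bcplx X B p) (i - 1)) (bdry (Bcplx X B p) i)" for i
    proof (cases "i = 1")
      case True
      then show ?thesis using b_lin[OF p] by (simp add: Bcplx_def)
    next
      case False
      then have "bdry (Bcplx X B p) i = (\<lambda>x. \<zero>\<^bsub>Bterm X B p (i - 1)\<^esub>)" by (rule_tac ext) simp
      then show ?thesis using lin_zero_map[OF fg_free_module[OF free] fg_free_module[OF free]] by simp
    qed
    fix x assume "x \<in> carrier (cmod (Bcplx X B p) i)"
    show "bdry (Bcplx X B p) (i - 1) (bdry (Bcplx X B p) i x) = \<zero>\<^bsub>cmod (Bcplx X B p) (i - 2)\<^esub>"
    proof (cases "i - 1 = 1")
      case True
      then have "i = 2" by simp
      then show ?thesis using lin.zero[OF l[of 1]] by simp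
    next
      case False
      then show ?thesis by simp
    qed
  qed
  then show ?thesis
    using free f_closed[OF _ q]
    by (intro two_term.intro koszul_tensor_complex.intro two_term_axioms.intro S) auto
qed

end

section \<open>The inductive step\<close>

context hmf_construction
begin

text \<open>
  The kernel of the projection of \<open>A\<^sub>0(p)\<close> onto \<open>M(p)\<close>.
\<close>

definition relations :: "nat \<Rightarrow> 'm set" where
  "relations p = {dmap X y \<oplus>\<^bsub>amb X 0\<^esub> u | y u. y \<in> fil X 1 p \<and> u \<in> ideal_mod S (I p) (A 0 p)}"

lemma relations_subset: "p \<le> c \<Longrightarrow> relations p \<subseteq> fil X 0 p"
proof
  fix x assume p: "p \<le> c" and "x \<in> relations p"
  then obtain y u where y: "y \<in> fil X 1 p" and u: "u \<in> ideal_mod S (I p) (A 0 p)" and x: "x = dmap X y \<oplus>\<^bsub>amb X 0\<^esub> u"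
    unfolding relations_def by blast
  interpret A0: smod S "A 0 p" by (rule A_module) (use p in auto)
  have "u \<in> fil X 0 p" using A0.ideal_mod_closed[OF I_subset[OF p] u] by simp
  moreover have "dmap X y \<in> fil X 0 p" using lin.closed[OF d_lin[OF p]] y by simp
  ultimately show "x \<in> fil X 0 p" using A0.a_closed[of "dmap X y" u] by (simp add: x)
qed

text \<open>
  By condition (a), \<open>f\<^sub>p A\<^sub>0(p)\<close> lies in \<open>d A\<^sub>1(p) + (f\<^sub>1, \<dots>, f\<^bsub>p-1\<^esub>) A\<^sub>0(p)\<close>, so
  \<open>M(p)\<close> is already the cokernel of \<open>d\<^sub>p\<close> modulo \<open>f\<^sub>1, \<dots>, f\<^bsub>p-1\<^esub>\<close>.
\<close>

lemma relations_eq: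
  assumes p: "Suc p \<le> c"
  shows "relations (Suc p) =
    {dmap X y \<oplus>\<^bsub>amb X 0\<^esub> u | y u. y \<in> fil X 1 (Suc p) \<and> u \<in> ideal_mod S (I p) (A 0 (Suc p))}"
    (is "_ = ?R")
proof
  interpret d: lin S "A 1 (Suc p)" "A 0 (Suc p)" "dmap X" by (rule d_lin[OF p])
  have q: "Suc p \<in> {1..c}" using p by auto
  have p': "p \<le> c" using p by simp
  interpret h: lin S "A 0 (Suc p)" "A 1 (Suc p)" "hcomp c X (Suc p)" by (rule h_lin[OF q])
  note Ip = I_subset[OF p']
  have fq: "f (Suc p) \<in> carrier S" using f_closed[of "Suc p" "Suc p"] p by simp
  show "?R \<subseteq> relations (Suc p)"
    using d.N.ideal_mod_mono[OF seq_ideal_mono[of S "Suc p" f p, OF S f_closed[OF _ p]]]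
    unfolding relations_def by auto
  show "relations (Suc p) \<subseteq> ?R"
  proof
    fix x assume "x \<in> relations (Suc p)"
    then obtain y u where y: "y \<in> fil X 1 (Suc p)" and u: "u \<in> ideal_mod S (I (Suc p)) (A 0 (Suc p))"
      and x: "x = dmap X y \<oplus>\<^bsub>amb X 0\<^esub> u" unfolding relations_def by blast
    obtain w v where w: "w \<in> ideal_mod S (I p) (A 0 (Suc p))" and v: "v \<in> carrier (A 0 (Suc p))"
      and uwv: "u = w \<oplus>\<^bsub>A 0 (Suc p)\<^esub> f (Suc p) \<odot>\<^bsub>A 0 (Suc p)\<^esub> v"
      by (rule d.N.ideal_mod_seq_Suc[of p f u, OF f_closed[OF _ p] u])
    let ?fv = "f (Suc p) \<odot>\<^bsub>A 0 (Suc p)\<^esub> v" and ?hv = "hcomp c X (Suc p) v"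
    define r where "r = dmap X ?hv \<ominus>\<^bsub>A 0 (Suc p)\<^esub> ?fv"
    have r: "r \<in> ideal_mod S (I p) (A 0 (Suc p))"
      using condition_a[OF q, of v] v by (simp add: r_def)
    have hv: "?hv \<in> carrier (A 1 (Suc p))" using v by (rule h.closed)
    have yc: "y \<in> carrier (A 1 (Suc p))" using y by simp
    have fv: "?fv \<in> carrier (A 0 (Suc p))" by (rule d.N.smult_closed[OF fq v])
    have dhv: "dmap X ?hv \<in> carrier (A 0 (Suc p))" by (rule d.closed[OF hv])
    note cl = d.closed[OF yc] dhv fv d.N.ideal_mod_closed[OF Ip w] d.N.a_inv_closed[OF fv] d.N.a_inv_closed[OF dhv]
    have "dmap X (y \<oplus>\<^bsub>A 1 (Suc p)\<^esub> ?hv) \<oplus>\<^bsub>A 0 (Suc p)\<^esub> (w \<ominus>\<^bsub>A 0 (Suc p)\<^esub> r) = dmap X y \<oplus>\<^bsub>A 0 (Suc p)\<^esub> u"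
      unfolding uwv r_def d.add[OF yc hv] a_minus_def
      using cl by (simp add: d.N.minus_add d.N.a_ac d.N.r_neg1 d.N.r_neg2 d.N.add_cancel del: A_simps)
    moreover have "y \<oplus>\<^bsub>A 1 (Suc p)\<^esub> ?hv \<in> fil X 1 (Suc p)" using d.M.a_closed[OF yc hv] by simp
    moreover have "w \<ominus>\<^bsub>A 0 (Suc p)\<^esub> r \<in> ideal_mod S (I p) (A 0 (Suc p))"
      by (rule d.N.ideal_mod_diff[OF Ip w r])
    ultimately show "x \<in> ?R" unfolding x by auto metis
  qed
qed

text \<open>
  The statement of the induction. It is sharper than being a free resolution of \<open>M(p)\<close>, as the
  augmentation has to be the one that comes from the identification of \<open>L\<^sub>0\<close> with \<open>A\<^sub>0(p)\<close>:
  this is what the next attaching map \<open>\<psi>\<close> refers to.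
\<close>

definition resolves :: "nat \<Rightarrow> ('a, (nat set \<Rightarrow> 'm) list) cplx \<Rightarrow> bool" where
  "resolves p L \<longleftrightarrow> free_acyclic S L \<and> lin S (A 0 p) (cmod L 0) (ident0 X B p) \<and>
     bij_betw (ident0 X B p) (fil X 0 p) (carrier (cmod L 0)) \<and>
     ident0 X B p ` relations p = bdry L 1 ` carrier (cmod L 1)"

lemma resolvesD:
  assumes "resolves p L"
  shows "free_acyclic S L" "lin S (A 0 p) (cmod L 0) (ident0 X B p)"
    "bij_betw (ident0 X B p) (fil X 0 p) (carrier (cmod L 0))"
    "ident0 X B p ` relations p = bdry L 1 ` carrier (cmod L 1)"
  using assms unfolding resolves_def by blast+

lemma resolves_boundary_iff:
  assumes L: "resolves p L" and p: "p \<le> c" and x: "x \<in> fil X 0 p"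
  shows "ident0 X B p x \<in> bdry L 1 ` carrier (cmod L 1) \<longleftrightarrow> x \<in> relations p"
proof -
  have "inj_on (ident0 X B p) (fil X 0 p)" using resolvesD(3)[OF L] by (simp add: bij_betw_def)
  from inj_on_image_mem_iff[OF this x relations_subset[OF p]] show ?thesis
    by (simp add: resolvesD(4)[OF L])
qed

lemma resolves_kill:
  assumes L: "resolves p L" and p: "p \<le> c" and j: "j \<in> {1..p}" and y: "y \<in> carrier (cmod L 0)"
  shows "f j \<odot>\<^bsub>cmod L 0\<^esub> y \<in> bdry L 1 ` carrier (cmod L 1)"
proof -
  interpret i0: lin S "A 0 p" "cmod L 0" "ident0 X B p" by (rule resolvesD(2)[OF L])
  interpret d: lin S "A 1 p" "A 0 p" "dmap X" by (rule d_lin[OF p])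
  have fj: "f j \<in> carrier S" by (rule f_closed[OF j p])
  obtain x where x: "x \<in> fil X 0 p" and yx: "y = ident0 X B p x"
    using resolvesD(3)[OF L] y by (auto simp: bij_betw_def)
  have fx: "f j \<odot>\<^bsub>A 0 p\<^esub> x \<in> ideal_mod S (I p) (A 0 p)"
    using x by (intro i0.M.ideal_mod_smult f_mem_I j p) simp
  have fxc: "f j \<odot>\<^bsub>A 0 p\<^esub> x \<in> carrier (A 0 p)" using fj x by (intro i0.M.smult_closed) auto
  have "dmap X \<zero>\<^bsub>A 1 p\<^esub> \<oplus>\<^bsub>A 0 p\<^esub> f j \<odot>\<^bsub>A 0 p\<^esub> x = f j \<odot>\<^bsub>A 0 p\<^esub> x"
    using fxc by (simp only: d.zero i0.M.l_zero)
  moreover have "\<zero>\<^bsub>A 1 p\<^esub> \<in> fil X 1 p" using d.M.zero_closed by simp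
  ultimately have "f j \<odot>\<^bsub>A 0 p\<^esub> x \<in> relations p"
    using fx unfolding relations_def by (auto intro: exI[of _ "\<zero>\<^bsub>A 1 p\<^esub>"]) metis
  moreover have "f j \<odot>\<^bsub>cmod L 0\<^esub> y = ident0 X B p (f j \<odot>\<^bsub>A 0 p\<^esub> x)"
    using fj x by (simp add: yx del: A_simps(4))
  ultimately show ?thesis using resolvesD(4)[OF L] by (metis imageI)
qed

lemma psi_lin:
  assumes L: "resolves p L" and p: "Suc p \<le> c"
  shows "lin S (Bm 1 (Suc p)) (cmod L 0) (psi' X B (Suc p) L 0)"
proof -
  have q: "Suc p \<in> {1..c}" using p by auto
  have "lin S (Bm 1 (Suc p)) (cmod L 0) (\<lambda>x. ident0 X B p (compA X B 0 (Suc p) (dmap X x)))"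
    using q p resolvesD(2)[OF L] comp_lin(1)[of 0 "Suc p"]
    by (intro lin_comp[OF lin_comp[OF lin_comp[OF B_lin_inclusion d_lin]]]) auto
  moreover have "psi' X B (Suc p) L 0 = (\<lambda>x. ident0 X B p (compA X B 0 (Suc p) (dmap X x)))"
    by (rule ext) (simp add: psi'_def)
  ultimately show ?thesis by simp
qed

lemma extension_exists:
  assumes L: "resolves p L" and p: "Suc p \<le> c"
  shows "\<exists>\<Psi>. koszul_extension S f p (Bcplx X B (Suc p)) L (psi' X B (Suc p) L) \<Psi>"
proof -
  have q: "Suc p \<in> {1..c}" and p': "p \<le> c" using p by auto
  interpret T: two_term S f p "Bcplx X B (Suc p)" by (rule Bcplx_two_term[OF q p'])
  obtain \<Phi> where "chain_map S (shift (koszul_tensor f p (in_degree_one (cmod L 0)))) L \<Phi>"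
    and "\<Phi> 0 = (\<lambda>x. x {})"
    by (rule koszul_map_extending_identity[OF S one_not_zero T.f resolvesD(1)[OF L] resolves_kill[OF L p']])
  from T.koszul_extension_from_identity[OF free_acyclicD(1)[OF resolvesD(1)[OF L]] this, of "psi' X B (Suc p) L"]
    psi_lin[OF L p]
  show ?thesis by (auto simp: psi'_def)
qed

text \<open>
  With \<open>A\<^sub>s(0) = 0\<close> the induction can start at \<open>p = 0\<close>, and \<open>L(1)\<close> needs no separate treatment.
\<close>

lemma resolves_zero: "resolves 0 zero_list_cplx"
proof -
  let ?Z = "zero_list_cplx :: ('a, (nat set \<Rightarrow> 'm) list) cplx"
  have z: "carrier (cmod ?Z i) = {[]}" "\<zero>\<^bsub>cmod ?Z i\<^esub> = []" "bdry ?Z i u = []" for i u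
    by (simp_all add: zero_list_cplx_def)
  have m: "module S (cmod ?Z i)" for i
  proof (rule moduleI[OF S])
    show "abelian_group (cmod ?Z i)"
      by (rule abelian_groupI) (auto simp: zero_list_cplx_def)
  qed (auto simp: zero_list_cplx_def)
  have cx: "is_complex S ?Z"
    by (rule complexI, rule linI[OF m m]) (auto simp: zero_list_cplx_def)
  have fr: "fg_free S (cmod ?Z i)" for i
    by (rule fg_free_trivial[OF m]) (simp add: z)
  have fa: "free_acyclic S ?Z"
    unfolding free_acyclic_def left_complex_def using cx fr by (auto simp: z)
  interpret d: lin S "A 1 0" "A 0 0" "dmap X" by (rule d_lin) simp
  have f0: "fil X 0 0 = {\<zero>\<^bsub>amb X 0\<^esub>}" by (rule fil_0) simp
  have "lin S (A 0 0) (cmod ?Z 0) (ident0 X B 0)"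
    by (rule linI[OF d.N.module_axioms m]) (auto simp: zero_list_cplx_def)
  moreover have "relations 0 \<noteq> {}"
    using d.M.zero_closed d.N.ideal_mod_zero[OF I_subset] unfolding relations_def by auto
  then have "ident0 X B 0 ` relations 0 = {[]}" by auto
  ultimately show ?thesis
    using fa unfolding resolves_def by (simp add: f0 bij_betw_def z)
qed

end

text \<open>
  The passage from \<open>L = L(p)\<close> to \<open>L(q)\<close>, \<open>q = p + 1\<close>.
\<close>

locale resolution_step = hmf_construction S f c X B
  for S :: "('a, 'b) ring_scheme" and f c and X :: "('a, 'm) hmf_data" and B +
  fixes p :: nat and L :: "('a, (nat set \<Rightarrow> 'm) list) cplx" and \<Psi>
  assumes p: "Suc p \<le> c" and L: "resolves p L"
    and \<Psi>: "koszul_extension S f p (Bcplx X B (Suc p)) L (psi' X B (Suc p) L) \<Psi>"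
begin

abbreviation q where "q \<equiv> Suc p"
abbreviation Bc where "Bc \<equiv> Bcplx X B (Suc p)"

lemma q: "q \<in> {1..c}" and p': "p \<le> c" using p by auto

sublocale T: two_term S f p Bc by (rule Bcplx_two_term[OF q p'])

lemma L_free_acyclic: "free_acyclic S L" and L_complex: "is_complex S L"
  using resolvesD(1)[OF L] free_acyclicD(1) by blast+

sublocale cone: mapping_cone S L T.K \<Psi>
  using \<Psi> unfolding koszul_extension_def by (intro mapping_cone.intro L_complex T.K_complex) blast

sublocale A0q: smod S "A 0 q" by (rule A_module) (use p in auto)
sublocale A0p: smod S "A 0 p" by (rule A_module) (use p' in auto)
sublocale dq: lin S "A 1 q" "A 0 q" "dmap X" by (rule d_lin[OF p])
sublocale dp: lin S "A 1 p" "A 0 p" "dmap X" by (rule d_lin[OF p'])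
sublocale cA: lin S "A 0 q" "A 0 p" "compA X B 0 q" using comp_lin(1)[of 0 q] q by simp
sublocale cB: lin S "A 0 q" "Bm 0 q" "compB X B 0 q" using comp_lin(2)[of 0 q] q by simp
sublocale id0: lin S "A 0 p" "cmod L 0" "ident0 X B p" by (rule resolvesD(2)[OF L])

lemma up0: "x \<in> fil X 0 p \<Longrightarrow> x \<in> fil X 0 q" and up1: "x \<in> fil X 1 p \<Longrightarrow> x \<in> fil X 1 q"
  using fil_subset[of 0 q] fil_subset[of 1 q] q by auto

lemma B0: "b \<in> B 0 q \<Longrightarrow> b \<in> fil X 0 q" and B1: "b \<in> B 1 q \<Longrightarrow> b \<in> fil X 1 q"
  using B_subset_fil q by auto

lemma comp0:
  assumes "x \<in> fil X 0 q"
  shows "compA X B 0 q x \<in> fil X 0 p" "compB X B 0 q x \<in> B 0 q"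
    "compA X B 0 q x \<oplus>\<^bsub>amb X 0\<^esub> compB X B 0 q x = x"
  using components(1)[of 0 q x] q assms by auto

lemma comp0_add:
  assumes "y \<in> fil X 0 p" "b \<in> B 0 q"
  shows "compA X B 0 q (y \<oplus>\<^bsub>amb X 0\<^esub> b) = y" "compB X B 0 q (y \<oplus>\<^bsub>amb X 0\<^esub> b) = b"
  using components(2)[of 0 q y b] q assms by auto

lemma B_zero: "\<zero>\<^bsub>cmod Bc i\<^esub> \<in> carrier (cmod Bc i)"
  using complex_module[OF T.B, of i] by (simp add: module_def abelian_groupE(2))

lemma degree_one_bdry:
  assumes w: "w \<in> carrier (cmod T.K 1)"
  shows "bdry T.K 1 w {} = koszul_diff (Bm 0 q) f p w {} \<oplus>\<^bsub>amb X 0\<^esub> compB X B 0 q (dmap X (w {}))"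
    and "w {} \<in> B 1 q" and "\<And>j. j \<in> {1..p} \<Longrightarrow> w {j} \<in> B 0 q"
    and "koszul_diff (Bm 0 q) f p w {} \<in> ideal_mod S (I p) (Bm 0 q)"
proof -
  show "bdry T.K 1 w {} = koszul_diff (Bm 0 q) f p w {} \<oplus>\<^bsub>amb X 0\<^esub> compB X B 0 q (dmap X (w {}))"
    using T.bdry_at[of "{}" 1 0 w] by (simp add: signed_def)
  show "w {} \<in> B 1 q" using T.K_component[OF w, of "{}" 1] by simp
  show wj: "w {j} \<in> B 0 q" if "j \<in> {1..p}" for j using T.K_component[OF w, of "{j}" 0] that by simp
  interpret k: koszul S "Bm 0 q" f p using T.B_koszul[of 0] by simp
  show "koszul_diff (Bm 0 q) f p w {} \<in> ideal_mod S (I p) (Bm 0 q)"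
    using wj by (intro k.kd_mem_ideal_mod I_subset f_mem_I p') auto
qed

lemma Psi0: "w \<in> carrier (cmod T.K 1) \<Longrightarrow> \<Psi> 0 w = ident0 X B p (compA X B 0 q (dmap X (w {})))"
  using T.koszul_extension_degree_zero[OF L_complex \<Psi>, of w] by (simp add: psi'_def)

text \<open>
  The connecting map from the first homology of \<open>K \<otimes> B(q)\<close> to \<open>M(p)\<close> is injective. If \<open>x\<close>
  represents a class in its kernel, some \<open>z \<in> A\<^sub>1(p)\<close> satisfies \<open>d(x - z) \<in> (f\<^sub>1, \<dots>, f\<^sub>p)A\<^sub>0(q)\<close>.
  Applying \<open>h\<^sub>q\<close>, condition (b) yields \<open>f\<^sub>q x \<in> (f\<^sub>1, \<dots>, f\<^sub>p)B\<^sub>1(q)\<close>, and \<open>f\<^sub>q\<close> can be cancelled.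
\<close>

lemma connecting_map_injective:
  assumes w: "w \<in> carrier (cmod T.K 1)" and dw: "bdry T.K 1 w = \<zero>\<^bsub>cmod T.K 0\<^esub>"
    and im: "\<Psi> 0 w \<in> bdry L 1 ` carrier (cmod L 1)"
  shows "w {} \<in> ideal_mod S (I p) (Bm 1 q)"
proof -
  note Ip = I_subset[OF p']
  define x where "x = w {}"
  have x: "x \<in> B 1 q" unfolding x_def by (rule degree_one_bdry(2)[OF w])
  have xf: "x \<in> fil X 1 q" by (rule B1[OF x])
  have dx: "dmap X x \<in> fil X 0 q" using dq.closed xf by simp
  let ?a = "compA X B 0 q (dmap X x)" and ?b = "compB X B 0 q (dmap X x)"
  note ab = comp0[OF dx]
  have "koszul_diff (Bm 0 q) f p w {} \<oplus>\<^bsub>Bm 0 q\<^esub> ?b = \<zero>\<^bsub>Bm 0 q\<^esub>"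
    using degree_one_bdry(1)[OF w] dw by (simp add: x_def)
  then have "koszul_diff (Bm 0 q) f p w {} = \<ominus>\<^bsub>Bm 0 q\<^esub> ?b"
    using cB.N.ideal_mod_closed[OF Ip degree_one_bdry(4)[OF w]] ab(2)
    by (intro cB.N.minus_equality[symmetric]) auto
  then have "?b = \<ominus>\<^bsub>Bm 0 q\<^esub> koszul_diff (Bm 0 q) f p w {}" using ab(2) by simp
  then have b: "?b \<in> ideal_mod S (I p) (Bm 0 q)"
    using cB.N.ideal_mod_neg[OF Ip degree_one_bdry(4)[OF w]] by simp
  have "?a \<in> relations p"
    using im Psi0[OF w] resolves_boundary_iff[OF L p' ab(1)] by (simp add: x_def)
  then obtain z u where z: "z \<in> fil X 1 p" and u: "u \<in> ideal_mod S (I p) (A 0 p)"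
    and a: "?a = dmap X z \<oplus>\<^bsub>amb X 0\<^esub> u" unfolding relations_def by blast
  have zq: "z \<in> fil X 1 q" by (rule up1[OF z])
  have uA: "u \<in> ideal_mod S (I p) (A 0 q)"
    using lin.ideal_mod_image[OF A_lin_inclusion[of 0 q] Ip] u q by simp
  have bA: "?b \<in> ideal_mod S (I p) (A 0 q)"
    using lin.ideal_mod_image[OF B_lin_inclusion[of 0 q] Ip b] q by simp
  have dz: "dmap X z \<in> carrier (A 0 q)" using dq.closed zq by simp
  \<comment> \<open>Now \<open>d x = d z + u + b x\<close>, where \<open>b x\<close> is \<open>?b\<close>, so that \<open>d\<close> maps \<open>x - z\<close> into \<open>(f\<^sub>1, \<dots>, f\<^sub>p)A\<^sub>0(q)\<close>.\<close>
  define t where "t = x \<ominus>\<^bsub>A 1 q\<^esub> z"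
  have t: "t \<in> fil X 1 q" using dq.M.minus_closed[of x z] xf zq by (simp add: t_def)
  have "dmap X t = u \<oplus>\<^bsub>A 0 q\<^esub> ?b"
  proof -
    have "dmap X t = dmap X x \<ominus>\<^bsub>A 0 q\<^esub> dmap X z"
      using dq.diff[of x z] xf zq by (simp add: t_def)
    also have "dmap X x = (dmap X z \<oplus>\<^bsub>A 0 q\<^esub> u) \<oplus>\<^bsub>A 0 q\<^esub> ?b"
      using ab(3) by (simp add: a)
    also have "\<dots> \<ominus>\<^bsub>A 0 q\<^esub> dmap X z = u \<oplus>\<^bsub>A 0 q\<^esub> ?b"
      using dz A0q.ideal_mod_closed[OF Ip uA] A0q.ideal_mod_closed[OF Ip bA]
      by (simp add: a_minus_def A0q.a_ac A0q.r_neg1 A0q.r_neg2 A0q.add_cancel del: A_simps)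
    finally show ?thesis .
  qed
  then have dt: "dmap X t \<in> ideal_mod S (I p) (A 0 q)"
    using A0q.ideal_mod_add[OF Ip uA bA] by simp
  have cB1: "lin S (A 1 q) (Bm 1 q) (compB X B 1 q)" using comp_lin(2)[of 1 q] q by simp
  interpret cB1: lin S "A 1 q" "Bm 1 q" "compB X B 1 q" by (rule cB1)
  have hdt: "compB X B 1 q (hcomp c X q (dmap X t)) \<in> ideal_mod S (I p) (Bm 1 q)"
    by (rule lin.ideal_mod_image[OF lin_comp[OF h_lin[OF q] cB1] Ip dt])
  have "compB X B 1 q t = x"
  proof -
    have "compB X B 1 q x = x" "compB X B 1 q z = \<zero>\<^bsub>Bm 1 q\<^esub>"
      using comp_B[of 1 q x] comp_fil(2)[of 1 q z] q x z by auto
    then show ?thesis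
      using cB1.diff[of x z] xf zq x cB1.N.diff_zero[of x] by (simp add: t_def)
  qed
  then have "compB X B 1 q (hcomp c X q (dmap X t)) \<ominus>\<^bsub>Bm 1 q\<^esub> f q \<odot>\<^bsub>Bm 1 q\<^esub> x \<in> ideal_mod S (I p) (Bm 1 q)"
    using condition_b[OF q t] by simp
  from cB1.N.ideal_mod_diff[OF Ip hdt this]
  have fqx: "f q \<odot>\<^bsub>Bm 1 q\<^esub> x \<in> ideal_mod S (I p) (Bm 1 q)"
  proof -
    assume m: "compB X B 1 q (hcomp c X q (dmap X t)) \<ominus>\<^bsub>Bm 1 q\<^esub>
      (compB X B 1 q (hcomp c X q (dmap X t)) \<ominus>\<^bsub>Bm 1 q\<^esub> f q \<odot>\<^bsub>Bm 1 q\<^esub> x) \<in> ideal_mod S (I p) (Bm 1 q)"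
    have fq: "f q \<in> carrier S" using f_closed[of q q] p by simp
    have k: "compB X B 1 q (hcomp c X q (dmap X t)) \<in> carrier (Bm 1 q)"
      by (rule cB1.N.ideal_mod_closed[OF Ip hdt])
    have fx: "f q \<odot>\<^bsub>Bm 1 q\<^esub> x \<in> carrier (Bm 1 q)"
      using fq x by (intro cB1.N.smult_closed) auto
    have "g \<ominus>\<^bsub>Bm 1 q\<^esub> (g \<ominus>\<^bsub>Bm 1 q\<^esub> e) = e" if "g \<in> carrier (Bm 1 q)" "e \<in> carrier (Bm 1 q)" for g e
      using that by (simp add: a_minus_def cB1.N.minus_add cB1.N.r_neg2 del: sub_mod_simps)
    from this[OF k fx] m show ?thesis by simp
  qed
  have "fg_free S (Bm 1 q)" by (rule B_free) (use q in auto)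
  from regular_on_free[OF regular_upto[OF p] this lessI _ fqx] x
  show ?thesis by (simp add: x_def)
qed

lemma step_acyclic: "free_acyclic S cone.C"
proof (rule cone.cone_acyclic[OF one_not_zero L_free_acyclic T.K_free[OF one_not_zero]])
  fix i :: int
  show "carrier (cmod T.K i) = {\<zero>\<^bsub>cmod T.K i\<^esub>}" if "i < 0"
  proof -
    have "x = \<zero>\<^bsub>cmod T.K i\<^esub>" if "x \<in> carrier (cmod T.K i)" for x
    proof (rule extensionalityI[of _ "Pow {1..p}"])
      show "x J = \<zero>\<^bsub>cmod T.K i\<^esub> J" if J: "J \<in> Pow {1..p}" for J
      proof -
        have "x J \<in> carrier (cmod Bc (i - int (card J)))" using \<open>x \<in> carrier (cmod T.K i)\<close> J by auto
        then show ?thesis using \<open>i < 0\<close> J T.B_trivial[of "i - int (card J)"] by auto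
      qed
    qed (use that in \<open>auto simp: PiE_iff\<close>)
    moreover have "\<zero>\<^bsub>cmod T.K i\<^esub> \<in> carrier (cmod T.K i)" using B_zero by auto
    ultimately show ?thesis by blast
  qed
  fix w assume i: "0 < i" and w: "w \<in> carrier (cmod T.K i)" and dw: "bdry T.K i w = \<zero>\<^bsub>cmod T.K (i - 1)\<^esub>"
    and im: "i = 1 \<Longrightarrow> \<Psi> 0 w \<in> bdry L 1 ` carrier (cmod L 1)"
  show "\<exists>v\<in>carrier (cmod T.K (i + 1)). bdry T.K (i + 1) v = w"
  proof (rule T.two_term_exact[OF regular_upto[OF p'] w _ dw])
    assume i1: "i = 1"
    show "w {} \<in> ideal_mod S (I p) (cmod Bc 1)"
      using connecting_map_injective[of w] w dw im i1 by simp
  qed (use i in simp)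
qed

lemma unit_lin: "lin S (Bm 0 q) (cmod T.K 0) (koszul_unit p Bc 0)"
proof -
  have "koszul_unit p Bc 0 = single (Pow {1..p}) (\<lambda>J. cmod Bc (0 - int (card J))) {}"
    by (rule ext) (simp add: koszul_unit_def single_def cong: if_cong)
  then show ?thesis
    using lin_single[of S "Pow {1..p}" "\<lambda>J. cmod Bc (0 - int (card J))" "{}", OF S complex_module[OF T.B]]
    by simp
qed

lemma unit_component: "koszul_unit p Bc 0 b {} = b"
  by (simp add: koszul_unit_def)

lemma degree_zero_unit:
  assumes w: "w \<in> carrier (cmod T.K 0)"
  shows "w = koszul_unit p Bc 0 (w {})"
proof (rule extensionalityI[of _ "Pow {1..p}"])
  fix J assume J: "J \<in> Pow {1..p}"
  show "w J = koszul_unit p Bc 0 (w {}) J"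
  proof (cases "J = {}")
    case False
    have "finite J" using J by (auto intro: finite_subset)
    then have "carrier (cmod Bc (0 - int (card J))) = {\<zero>\<^bsub>cmod Bc (0 - int (card J))\<^esub>}"
      using False by (intro T.B_trivial) auto
    then show ?thesis using False J T.K_component[OF w, of J] by (auto simp: koszul_unit_def)
  qed (simp add: koszul_unit_def)
qed (use w in \<open>auto simp: PiE_iff koszul_unit_def\<close>)

lemma step_ident0_lin: "lin S (A 0 q) (cmod cone.C 0) (ident0 X B q)"
proof (rule lin_cong)
  show "lin S (A 0 q) (cmod cone.C 0) (\<lambda>x. (koszul_unit p Bc 0 (compB X B 0 q x) # \<zero>\<^bsub>cmod L 0\<^esub>)
      \<oplus>\<^bsub>cmod cone.C 0\<^esub> (\<zero>\<^bsub>cmod T.K 0\<^esub> # ident0 X B p (compA X B 0 q x)))"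
    by (rule lin_add_map[OF lin_comp[OF lin_comp[OF cB.lin_axioms unit_lin] cone.lin_in_W]
          lin_comp[OF lin_comp[OF cA.lin_axioms id0.lin_axioms] cone.lin_in_Y]])
  fix x assume x: "x \<in> carrier (A 0 q)"
  have 1: "koszul_unit p Bc 0 (compB X B 0 q x) \<in> carrier (cmod T.K 0)"
    by (rule lin.closed[OF unit_lin cB.closed[OF x]])
  have 2: "ident0 X B p (compA X B 0 q x) \<in> carrier (cmod L 0)" by (rule id0.closed[OF cA.closed[OF x]])
  have "ident0 X B q x \<in> carrier (cmod cone.C 0)" using 1 2 by (auto simp del: koszul_tensor_cmod)
  from cone.cone_split[OF this] show "ident0 X B q x = (koszul_unit p Bc 0 (compB X B 0 q x) # \<zero>\<^bsub>cmod L 0\<^esub>)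
      \<oplus>\<^bsub>cmod cone.C 0\<^esub> (\<zero>\<^bsub>cmod T.K 0\<^esub> # ident0 X B p (compA X B 0 q x))" by simp
qed

lemma step_ident0_bij: "bij_betw (ident0 X B q) (fil X 0 q) (carrier (cmod cone.C 0))"
proof -
  have bij: "inj_on (ident0 X B p) (fil X 0 p)" "ident0 X B p ` fil X 0 p = carrier (cmod L 0)"
    using resolvesD(3)[OF L] by (auto simp: bij_betw_def)
  have "inj_on (ident0 X B q) (fil X 0 q)"
  proof (rule inj_onI)
    fix x y assume x: "x \<in> fil X 0 q" and y: "y \<in> fil X 0 q" and eq: "ident0 X B q x = ident0 X B q y"
    then have eqs: "koszul_unit p Bc 0 (compB X B 0 q x) = koszul_unit p Bc 0 (compB X B 0 q y)"
      "ident0 X B p (compA X B 0 q x) = ident0 X B p (compA X B 0 q y)" by simp_all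
    have "compB X B 0 q x = compB X B 0 q y"
      using unit_component[of "compB X B 0 q x"] unit_component[of "compB X B 0 q y"] eqs(1) by metis
    moreover have "compA X B 0 q x = compA X B 0 q y"
      by (rule inj_onD[OF bij(1) eqs(2) comp0(1)[OF x] comp0(1)[OF y]])
    ultimately show "x = y" using comp0(3)[OF x] comp0(3)[OF y] by metis
  qed
  moreover have "ident0 X B q ` fil X 0 q = carrier (cmod cone.C 0)"
  proof (intro equalityI subsetI)
    show "v \<in> carrier (cmod cone.C 0)" if "v \<in> ident0 X B q ` fil X 0 q" for v
      using that lin.closed[OF step_ident0_lin] by auto
    fix v assume "v \<in> carrier (cmod cone.C 0)"
    then obtain w y where v: "v = w # y" and w: "w \<in> carrier (cmod T.K 0)" and y: "y \<in> carrier (cmod L 0)"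
      by (auto simp del: koszul_tensor_cmod)
    obtain a where a: "a \<in> fil X 0 p" "y = ident0 X B p a" using bij(2) y by auto
    have b: "w {} \<in> B 0 q" using T.K_component[OF w, of "{}" 0] by simp
    have "a \<oplus>\<^bsub>amb X 0\<^esub> w {} \<in> fil X 0 q"
      using A0q.a_closed[of a "w {}"] up0[OF a(1)] B0[OF b] by simp
    moreover have "ident0 X B q (a \<oplus>\<^bsub>amb X 0\<^esub> w {}) = v"
      using comp0_add[OF a(1) b] degree_zero_unit[OF w] by (simp add: v a(2))
    ultimately show "v \<in> ident0 X B q ` fil X 0 q" by (metis imageI)
  qed
  ultimately show ?thesis by (simp add: bij_betw_def)
qed

text \<open>
  A boundary of the cone has a \<open>B\<^sub>1(q)\<close>-part \<open>x\<close> and a \<open>K\<^sub>1 \<otimes> B\<^sub>0(q)\<close>-part, and one from \<open>L\<^sub>1\<close>. The first is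
  mapped to \<open>b(x) + \<psi>(x) = d(x)\<close>, the second fills \<open>(f\<^sub>1, \<dots>, f\<^sub>p)B\<^sub>0(q)\<close>, and the third gives the
  relations of \<open>M(p)\<close>. Together they make up \<open>d A\<^sub>1(q) + (f\<^sub>1, \<dots>, f\<^sub>p)A\<^sub>0(q)\<close>.
\<close>

lemma step_relations: "ident0 X B q ` relations q = bdry cone.C 1 ` carrier (cmod cone.C 1)"
proof (intro equalityI subsetI)
  note Ip = I_subset[OF p']
  fix v assume "v \<in> ident0 X B q ` relations q"
  then obtain y u where y: "y \<in> fil X 1 q" and u: "u \<in> ideal_mod S (I p) (A 0 q)"
    and v: "v = ident0 X B q (dmap X y \<oplus>\<^bsub>amb X 0\<^esub> u)"
    unfolding relations_eq[OF p] by blast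
  define y1 y2 where "y1 = compA X B 1 q y" and "y2 = compB X B 1 q y"
  have y12: "y1 \<in> fil X 1 p" "y2 \<in> B 1 q" "y = y1 \<oplus>\<^bsub>amb X 1\<^esub> y2"
    using components(1)[of 1 q y] q y by (auto simp: y1_def y2_def)
  have dy1: "dmap X y1 \<in> fil X 0 p" using dp.closed y12 by simp
  have dy2: "dmap X y2 \<in> fil X 0 q" using dq.closed B1[OF y12(2)] by simp
  have dy: "dmap X y = dmap X y1 \<oplus>\<^bsub>amb X 0\<^esub> dmap X y2"
    using dq.add[of y1 y2] up1[OF y12(1)] B1[OF y12(2)] y12(3) by simp
  have uc: "u \<in> fil X 0 q" using A0q.ideal_mod_closed[OF Ip u] by simp
  have uA: "compA X B 0 q u \<in> ideal_mod S (I p) (A 0 p)" by (rule cA.ideal_mod_image[OF Ip u])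
  have uB: "compB X B 0 q u \<in> ideal_mod S (I p) (Bm 0 q)" by (rule cB.ideal_mod_image[OF Ip u])
  have c1: "compA X B 0 q (dmap X y1) = dmap X y1" "compB X B 0 q (dmap X y1) = \<zero>\<^bsub>amb X 0\<^esub>"
    using comp_fil[of 0 q "dmap X y1"] q dy1 by auto
  have dyc: "dmap X y1 \<in> carrier (A 0 q)" "dmap X y2 \<in> carrier (A 0 q)" "u \<in> carrier (A 0 q)"
    using up0[OF dy1] dy2 uc by simp_all
  have B2: "compB X B 0 q (dmap X y2) \<in> carrier (Bm 0 q)" by (rule cB.closed[OF dyc(2)])
  have cBx: "compB X B 0 q (dmap X y \<oplus>\<^bsub>amb X 0\<^esub> u) = compB X B 0 q u \<oplus>\<^bsub>amb X 0\<^esub> compB X B 0 q (dmap X y2)"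
  proof -
    have "compB X B 0 q (dmap X y \<oplus>\<^bsub>amb X 0\<^esub> u) =
        \<zero>\<^bsub>Bm 0 q\<^esub> \<oplus>\<^bsub>Bm 0 q\<^esub> compB X B 0 q (dmap X y2) \<oplus>\<^bsub>Bm 0 q\<^esub> compB X B 0 q u"
      using cB.add[OF A0q.a_closed[OF dyc(1,2)] dyc(3)] cB.add[OF dyc(1,2)] by (simp add: dy c1(2))
    also have "\<dots> = compB X B 0 q u \<oplus>\<^bsub>Bm 0 q\<^esub> compB X B 0 q (dmap X y2)"
      using B2 cB.closed[OF dyc(3)] by (simp only: cB.N.l_zero cB.N.a_comm)
    finally show ?thesis by simp
  qed
  have cAx: "compA X B 0 q (dmap X y \<oplus>\<^bsub>amb X 0\<^esub> u) =
      (dmap X y1 \<oplus>\<^bsub>A 0 p\<^esub> compA X B 0 q u) \<oplus>\<^bsub>A 0 p\<^esub> compA X B 0 q (dmap X y2)"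
  proof -
    have "compA X B 0 q (dmap X y \<oplus>\<^bsub>amb X 0\<^esub> u) =
        dmap X y1 \<oplus>\<^bsub>A 0 p\<^esub> compA X B 0 q (dmap X y2) \<oplus>\<^bsub>A 0 p\<^esub> compA X B 0 q u"
      using cA.add[OF A0q.a_closed[OF dyc(1,2)] dyc(3)] cA.add[OF dyc(1,2)] by (simp add: dy c1(1))
    also have "\<dots> = (dmap X y1 \<oplus>\<^bsub>A 0 p\<^esub> compA X B 0 q u) \<oplus>\<^bsub>A 0 p\<^esub> compA X B 0 q (dmap X y2)"
      using cA.closed[OF dyc(1)] cA.closed[OF dyc(2)] cA.closed[OF dyc(3)] c1(1)
      by (simp add: A0p.a_ac del: A_simps)
    finally show ?thesis .
  qed
  define r where "r = dmap X y1 \<oplus>\<^bsub>A 0 p\<^esub> compA X B 0 q u"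
  have "r \<in> relations p" using y12(1) uA unfolding relations_def r_def by auto
  then have rp: "ident0 X B p r \<in> bdry L 1 ` carrier (cmod L 1)" using resolvesD(4)[OF L] by blast
  then obtain l where l: "l \<in> carrier (cmod L 1)" and dl: "bdry L 1 l = ident0 X B p r" by (metis imageE)
  have "\<exists>z. (\<forall>J. z J \<in> carrier (Bm 0 q)) \<and> koszul_diff (Bm 0 q) f p z {} = compB X B 0 q u"
    by (rule ideal_mod_seq_koszul[OF cB.N.smod_axioms T.f uB])
  then obtain z where z: "\<And>J. z J \<in> B 0 q" and dz: "koszul_diff (Bm 0 q) f p z {} = compB X B 0 q u" by auto
  \<comment> \<open>The element \<open>1 \<otimes> y2 + (\<Sum>\<^sub>j e\<^sub>j \<otimes> z {j})\<close>, whose boundary in \<open>K \<otimes> B(q)\<close> is \<open>b y2\<close> plus the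
     \<open>B\<^sub>0(q)\<close>-component of \<open>u\<close>.\<close>
  define w where "w = (\<lambda>J\<in>Pow {1..p}. if J = {} then y2 else if card J = 1 then z J else \<zero>\<^bsub>cmod Bc (1 - int (card J))\<^esub>)"
  have w: "w \<in> carrier (cmod T.K 1)"
    unfolding koszul_tensor_cmod direct_sum_simps w_def using y12(2) z B_zero by auto
  have dw: "bdry T.K 1 w \<in> carrier (cmod T.K 0)" using lin.closed[OF T.bdry_lin w] by simp
  have "bdry T.K 1 w {} = compB X B 0 q (dmap X y \<oplus>\<^bsub>amb X 0\<^esub> u)"
  proof -
    interpret k: koszul S "Bm 0 q" f p using T.B_koszul[of 0] by simp
    have "koszul_diff (Bm 0 q) f p w {} = koszul_diff (Bm 0 q) f p z {}"
      using z by (intro k.kd_cong) (auto simp: w_def)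
    moreover have "w {} = y2" by (simp add: w_def)
    ultimately show ?thesis using degree_one_bdry(1)[OF w] by (simp add: cBx dz)
  qed
  then have "bdry T.K 1 w = koszul_unit p Bc 0 (compB X B 0 q (dmap X y \<oplus>\<^bsub>amb X 0\<^esub> u))"
    using degree_zero_unit[OF dw] by simp
  moreover have "bdry L 1 l \<oplus>\<^bsub>cmod L 0\<^esub> \<Psi> 0 w = ident0 X B p (compA X B 0 q (dmap X y \<oplus>\<^bsub>amb X 0\<^esub> u))"
  proof -
    have "r \<in> carrier (A 0 p)" unfolding r_def
      using dy1 cA.closed[OF dyc(3)] by (intro A0p.a_closed) auto
    moreover have "\<Psi> 0 w = ident0 X B p (compA X B 0 q (dmap X y2))"
      using Psi0[OF w] by (simp add: w_def)
    ultimately show ?thesis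
      unfolding cAx r_def[symmetric] dl using id0.add cA.closed[OF dyc(2)] by simp
  qed
  ultimately have "bdry cone.C 1 (w # l) = v" by (simp add: v)
  moreover have "w # l \<in> carrier (cmod cone.C 1)" using w l by simp
  ultimately show "v \<in> bdry cone.C 1 ` carrier (cmod cone.C 1)" by (metis imageI)
next
  note Ip = I_subset[OF p']
  fix v assume "v \<in> bdry cone.C 1 ` carrier (cmod cone.C 1)"
  then obtain w l where w: "w \<in> carrier (cmod T.K 1)" and l: "l \<in> carrier (cmod L 1)"
    and v: "v = bdry cone.C 1 (w # l)" by (auto simp del: koszul_tensor_cmod cone_simps(5))
  define x where "x = w {}"
  define g where "g = koszul_diff (Bm 0 q) f p w {}"
  have x: "x \<in> B 1 q" unfolding x_def by (rule degree_one_bdry(2)[OF w])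
  have xc: "x \<in> carrier (A 1 q)" using B1[OF x] by simp
  have dx: "dmap X x \<in> carrier (A 0 q)" by (rule dq.closed[OF xc])
  have g: "g \<in> ideal_mod S (I p) (Bm 0 q)" unfolding g_def by (rule degree_one_bdry(4)[OF w])
  have gB: "g \<in> B 0 q" using cB.N.ideal_mod_closed[OF Ip g] by simp
  have gA: "g \<in> ideal_mod S (I p) (A 0 q)"
    using lin.ideal_mod_image[OF B_lin_inclusion[of 0 q] Ip g] q by simp
  have "bdry L 1 l \<in> ident0 X B p ` relations p" using l resolvesD(4)[OF L] by blast
  then obtain y u where y: "y \<in> fil X 1 p" and u: "u \<in> ideal_mod S (I p) (A 0 p)"
    and dl: "bdry L 1 l = ident0 X B p (dmap X y \<oplus>\<^bsub>amb X 0\<^esub> u)"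
    unfolding relations_def by blast
  have uA: "u \<in> ideal_mod S (I p) (A 0 q)"
    using lin.ideal_mod_image[OF A_lin_inclusion[of 0 q] Ip] u q by simp
  have up: "u \<in> carrier (A 0 p)" by (rule A0p.ideal_mod_closed[OF Ip u])
  have yc: "y \<in> carrier (A 1 q)" using up1[OF y] by simp
  have dyp: "dmap X y \<in> carrier (A 0 p)" using dp.closed y by simp
  have dyu: "dmap X y \<oplus>\<^bsub>A 0 p\<^esub> u \<in> carrier (A 0 p)" by (rule A0p.a_closed[OF dyp up])
  let ?a = "compA X B 0 q (dmap X x)" and ?b = "compB X B 0 q (dmap X x)"
  have ac: "?a \<in> carrier (A 0 p)" by (rule cA.closed[OF dx])
  have bc: "?b \<in> carrier (Bm 0 q)" by (rule cB.closed[OF dx])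
  have s1: "dmap X y \<oplus>\<^bsub>A 0 p\<^esub> u \<oplus>\<^bsub>A 0 p\<^esub> ?a \<in> fil X 0 p" using A0p.a_closed[OF dyu ac] by simp
  have s2: "g \<oplus>\<^bsub>Bm 0 q\<^esub> ?b \<in> B 0 q" using cB.N.a_closed[of g ?b] gB bc by simp
  define t where "t = (dmap X y \<oplus>\<^bsub>A 0 p\<^esub> u \<oplus>\<^bsub>A 0 p\<^esub> ?a) \<oplus>\<^bsub>amb X 0\<^esub> (g \<oplus>\<^bsub>Bm 0 q\<^esub> ?b)"
  have "ident0 X B q t = v"
  proof -
    have dw: "bdry T.K 1 w \<in> carrier (cmod T.K 0)" using lin.closed[OF T.bdry_lin w] by simp
    have "koszul_unit p Bc 0 (g \<oplus>\<^bsub>Bm 0 q\<^esub> ?b) = bdry T.K 1 w"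
      using degree_zero_unit[OF dw] degree_one_bdry(1)[OF w] by (simp add: g_def x_def)
    moreover have "ident0 X B p (dmap X y \<oplus>\<^bsub>A 0 p\<^esub> u \<oplus>\<^bsub>A 0 p\<^esub> ?a) = bdry L 1 l \<oplus>\<^bsub>cmod L 0\<^esub> \<Psi> 0 w"
      using id0.add[OF dyu ac] dl Psi0[OF w] by (simp add: x_def)
    ultimately show ?thesis using comp0_add[OF s1 s2] by (simp add: v t_def)
  qed
  moreover have "t \<in> relations q"
  proof -
    have cl: "dmap X y \<in> carrier (A 0 q)" "u \<in> carrier (A 0 q)" "?a \<in> carrier (A 0 q)" "?b \<in> carrier (A 0 q)"
      "g \<in> carrier (A 0 q)"
      using dyp up ac bc gB up0 B0 by auto
    have "t = (dmap X y \<oplus>\<^bsub>A 0 q\<^esub> u \<oplus>\<^bsub>A 0 q\<^esub> ?a) \<oplus>\<^bsub>A 0 q\<^esub> (g \<oplus>\<^bsub>A 0 q\<^esub> ?b)" by (simp add: t_def)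
    also have "\<dots> = (dmap X y \<oplus>\<^bsub>A 0 q\<^esub> (?a \<oplus>\<^bsub>A 0 q\<^esub> ?b)) \<oplus>\<^bsub>A 0 q\<^esub> (u \<oplus>\<^bsub>A 0 q\<^esub> g)"
      using cl by (simp add: A0q.a_ac del: A_simps)
    also have "?a \<oplus>\<^bsub>A 0 q\<^esub> ?b = dmap X x" using comp0(3)[of "dmap X x"] dx by simp
    also have "dmap X y \<oplus>\<^bsub>A 0 q\<^esub> dmap X x = dmap X (y \<oplus>\<^bsub>A 1 q\<^esub> x)" by (rule dq.add[OF yc xc, symmetric])
    finally have t: "t = dmap X (y \<oplus>\<^bsub>A 1 q\<^esub> x) \<oplus>\<^bsub>amb X 0\<^esub> (u \<oplus>\<^bsub>A 0 q\<^esub> g)" by simp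
    have "y \<oplus>\<^bsub>A 1 q\<^esub> x \<in> fil X 1 q" using dq.M.a_closed[OF yc xc] by simp
    with t A0q.ideal_mod_add[OF Ip uA gA] show ?thesis unfolding relations_eq[OF p] by blast
  qed
  ultimately show "v \<in> ident0 X B q ` relations q" by blast
qed

lemma step_resolves: "resolves q cone.C"
  unfolding resolves_def using step_acyclic step_ident0_lin step_ident0_bij step_relations by blast

end

section \<open>The module that is resolved\<close>

text \<open>
  The two successive quotients that define the cokernel of \<open>S/J \<otimes> \<phi>\<close> collapse into one, by
  \<open>\<phi>M + JN\<close>.
\<close>

lemma (in lin) cokernel_of_base_change:
  assumes J: "J \<subseteq> carrier S"
  defines "Q \<equiv> coker (base_change S J M) (base_change S J N) (base_change_map S J N \<phi>)"
  obtains \<pi> where "lin S N Q \<pi>" "\<pi> ` carrier N = carrier Q"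
    "\<And>x. x \<in> carrier N \<Longrightarrow> \<pi> x = \<zero>\<^bsub>Q\<^esub> \<longleftrightarrow> (\<exists>y u. y \<in> carrier M \<and> u \<in> ideal_mod S J N \<and> x = \<phi> y \<oplus>\<^bsub>N\<^esub> u)"
proof -
  let ?JM = "ideal_mod S J M" and ?JN = "ideal_mod S J N"
  have JM: "submodule ?JM S M" and JN: "submodule ?JN S N"
    by (rule M.ideal_mod_submodule[OF J], rule N.ideal_mod_submodule[OF J])
  have bcM: "base_change S J M = quot_mod M ?JM" and bcN: "base_change S J N = quot_mod N ?JN"
    by (simp_all add: base_change_def)
  interpret p: lin S N "base_change S J N" "\<lambda>x. ?JN +>\<^bsub>N\<^esub> x" unfolding bcN by (rule N.lin_proj[OF JN])
  have map: "base_change_map S J N \<phi> (?JM +>\<^bsub>M\<^esub> x) = ?JN +>\<^bsub>N\<^esub> \<phi> x" if x: "x \<in> carrier M" for x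
  proof -
    have "?JN +>\<^bsub>N\<^esub> \<phi> y = ?JN +>\<^bsub>N\<^esub> \<phi> x" if y: "y \<in> ?JM +>\<^bsub>M\<^esub> x" for y
    proof -
      note yx = M.coset_memE[OF JM x y]
      have "\<phi> (y \<ominus>\<^bsub>M\<^esub> x) \<in> ?JN" by (rule ideal_mod_image[OF J yx(2)])
      then show ?thesis using N.coset_eq_iff[OF JN, of "\<phi> y" "\<phi> x"] yx(1) x by simp
    qed
    then have "(\<Union>y\<in>?JM +>\<^bsub>M\<^esub> x. ?JN +>\<^bsub>N\<^esub> \<phi> y) = (\<Union>y\<in>?JM +>\<^bsub>M\<^esub> x. ?JN +>\<^bsub>N\<^esub> \<phi> x)"
      by (intro SUP_cong) simp_all
    also have "\<dots> = ?JN +>\<^bsub>N\<^esub> \<phi> x"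
      using M.coset_self[OF JM x] by (subst UN_constant) (metis empty_iff)
    finally show ?thesis by (simp only: base_change_map_def)
  qed
  let ?H = "base_change_map S J N \<phi> ` carrier (base_change S J M)"
  have H: "?H = (\<lambda>y. ?JN +>\<^bsub>N\<^esub> \<phi> y) ` carrier M"
    unfolding bcM M.quot_mod_simps(1)[OF JM] image_image using map by (intro image_cong) simp_all
  have sub: "submodule ?H S (base_change S J N)"
    unfolding H
    by (rule lin.image_submodule[OF lin_comp[OF lin_axioms p.lin_axioms] M.carrier_is_submodule])
  have Q: "Q = quot_mod (base_change S J N) ?H" by (simp add: Q_def coker_def)
  interpret r: lin S "base_change S J N" Q "\<lambda>x. ?H +>\<^bsub>base_change S J N\<^esub> x"
    unfolding Q by (rule p.N.lin_proj[OF sub])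
  show thesis
  proof (rule that)
    show "lin S N Q (\<lambda>x. ?H +>\<^bsub>base_change S J N\<^esub> (?JN +>\<^bsub>N\<^esub> x))"
      by (rule lin_comp[OF p.lin_axioms r.lin_axioms])
    show "(\<lambda>x. ?H +>\<^bsub>base_change S J N\<^esub> (?JN +>\<^bsub>N\<^esub> x)) ` carrier N = carrier Q"
      unfolding Q p.N.quot_mod_simps(1)[OF sub] unfolding bcN N.quot_mod_simps(1)[OF JN] image_image ..
    fix x assume x: "x \<in> carrier N"
    have "?H +>\<^bsub>base_change S J N\<^esub> (?JN +>\<^bsub>N\<^esub> x) = \<zero>\<^bsub>Q\<^esub> \<longleftrightarrow> ?JN +>\<^bsub>N\<^esub> x \<in> ?H"
      unfolding Q p.N.quot_mod_simps(2)[OF sub] by (rule p.N.coset_zero_iff[OF sub p.closed[OF x]])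
    also have "\<dots> \<longleftrightarrow> (\<exists>y\<in>carrier M. ?JN +>\<^bsub>N\<^esub> x = ?JN +>\<^bsub>N\<^esub> \<phi> y)"
      unfolding H by (rule image_iff)
    also have "\<dots> \<longleftrightarrow> (\<exists>y\<in>carrier M. x \<ominus>\<^bsub>N\<^esub> \<phi> y \<in> ?JN)"
      by (intro bex_cong refl N.coset_eq_iff[OF JN x] closed)
    also have "\<dots> \<longleftrightarrow> (\<exists>y u. y \<in> carrier M \<and> u \<in> ?JN \<and> x = \<phi> y \<oplus>\<^bsub>N\<^esub> u)"
    proof
      assume "\<exists>y\<in>carrier M. x \<ominus>\<^bsub>N\<^esub> \<phi> y \<in> ?JN"
      then obtain y where y: "y \<in> carrier M" and u: "x \<ominus>\<^bsub>N\<^esub> \<phi> y \<in> ?JN" by blast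
      have "x = \<phi> y \<oplus>\<^bsub>N\<^esub> (x \<ominus>\<^bsub>N\<^esub> \<phi> y)" using x y by (simp add: a_minus_def N.add_cancel)
      with y u show "\<exists>y u. y \<in> carrier M \<and> u \<in> ?JN \<and> x = \<phi> y \<oplus>\<^bsub>N\<^esub> u" by blast
    next
      assume "\<exists>y u. y \<in> carrier M \<and> u \<in> ?JN \<and> x = \<phi> y \<oplus>\<^bsub>N\<^esub> u"
      then obtain y u where y: "y \<in> carrier M" and u: "u \<in> ?JN" and xyu: "x = \<phi> y \<oplus>\<^bsub>N\<^esub> u" by blast
      have "x \<ominus>\<^bsub>N\<^esub> \<phi> y = u"
        using y N.ideal_mod_closed[OF J u] by (simp add: xyu a_minus_def N.a_assoc N.add_cancel)
      with y u show "\<exists>y\<in>carrier M. x \<ominus>\<^bsub>N\<^esub> \<phi> y \<in> ?JN" by blast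
    qed
    finally show "?H +>\<^bsub>base_change S J N\<^esub> (?JN +>\<^bsub>N\<^esub> x) = \<zero>\<^bsub>Q\<^esub> \<longleftrightarrow>
      (\<exists>y u. y \<in> carrier M \<and> u \<in> ?JN \<and> x = \<phi> y \<oplus>\<^bsub>N\<^esub> u)" .
  qed
qed

context hmf_construction
begin

lemma resolves_free_resolution:
  assumes p: "p \<le> c" and L: "resolves p L"
  shows "free_resolution S L (hmf_module S f X p)"
proof -
  interpret d: lin S "A 1 p" "A 0 p" "dmap X" by (rule d_lin[OF p])
  interpret i0: lin S "A 0 p" "cmod L 0" "ident0 X B p" by (rule resolvesD(2)[OF L])
  let ?Q = "hmf_module S f X p" and ?i = "the_inv_into (fil X 0 p) (ident0 X B p)"
  obtain \<pi> where \<pi>: "lin S (A 0 p) ?Q \<pi>" and onto: "\<pi> ` carrier (A 0 p) = carrier ?Q"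
    and ker: "\<And>x. x \<in> carrier (A 0 p) \<Longrightarrow> \<pi> x = \<zero>\<^bsub>?Q\<^esub> \<longleftrightarrow>
      (\<exists>y u. y \<in> carrier (A 1 p) \<and> u \<in> ideal_mod S (I p) (A 0 p) \<and> x = dmap X y \<oplus>\<^bsub>A 0 p\<^esub> u)"
    unfolding hmf_module_def by (rule d.cokernel_of_base_change[OF I_subset[OF p]]) blast
  have bij: "bij_betw (ident0 X B p) (fil X 0 p) (carrier (cmod L 0))" by (rule resolvesD(3)[OF L])
  have inj: "inj_on (ident0 X B p) (fil X 0 p)" and img: "ident0 X B p ` fil X 0 p = carrier (cmod L 0)"
    using bij by (auto simp: bij_betw_def)
  have i: "lin S (cmod L 0) (A 0 p) ?i" using i0.inverse_lin bij by simp
  have ii: "?i (ident0 X B p x) = x" if "x \<in> fil X 0 p" for x by (rule the_inv_into_f_f[OF inj that])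
  have \<epsilon>: "lin S (cmod L 0) ?Q (\<lambda>v. \<pi> (?i v))" by (rule lin_comp[OF i \<pi>])
  have "(\<lambda>v. \<pi> (?i v)) ` carrier (cmod L 0) = carrier ?Q"
    using ii onto by (simp add: image_image flip: img)
  moreover have "{v \<in> carrier (cmod L 0). \<pi> (?i v) = \<zero>\<^bsub>?Q\<^esub>} = bdry L 1 ` carrier (cmod L 1)"
  proof -
    have rel: "\<pi> x = \<zero>\<^bsub>?Q\<^esub> \<longleftrightarrow> x \<in> relations p" if "x \<in> fil X 0 p" for x
      using ker[of x] that unfolding relations_def by auto
    have "{v \<in> carrier (cmod L 0). \<pi> (?i v) = \<zero>\<^bsub>?Q\<^esub>} = ident0 X B p ` {x \<in> fil X 0 p. \<pi> x = \<zero>\<^bsub>?Q\<^esub>}"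
      using ii by (auto simp flip: img)
    also have "{x \<in> fil X 0 p. \<pi> x = \<zero>\<^bsub>?Q\<^esub>} = relations p"
      using rel relations_subset[OF p] by blast
    finally show ?thesis using resolvesD(4)[OF L] by simp
  qed
  ultimately have "\<exists>\<epsilon>\<in>mod_hom S (cmod L 0) ?Q. \<epsilon> ` carrier (cmod L 0) = carrier ?Q \<and>
      {v \<in> carrier (cmod L 0). \<epsilon> v = \<zero>\<^bsub>?Q\<^esub>} = bdry L 1 ` carrier (cmod L 1)"
    using lin.hom[OF \<epsilon>] by (intro bexI[of _ "\<lambda>v. \<pi> (?i v)"] conjI)
  then show ?thesis
    using resolvesD(1)[OF L] unfolding free_resolution_def free_acyclic_def by blast
qed

lemma zero_extension:
  assumes "1 \<le> c"
  shows "koszul_extension S f 0 (Bcplx X B (Suc 0)) zero_list_cplx (psi' X B (Suc 0) zero_list_cplx) (\<lambda>i w. [])"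
proof -
  have "Suc 0 \<in> {1..c}" using assms by simp
  from Bcplx_two_term[OF this, of 0] interpret T: two_term S f 0 "Bcplx X B (Suc 0)" by simp
  let ?Z = "zero_list_cplx :: ('a, (nat set \<Rightarrow> 'm) list) cplx"
  have Z: "is_complex S ?Z" by (rule free_acyclicD(1)[OF resolvesD(1)[OF resolves_zero]])
  have z: "\<zero>\<^bsub>cmod ?Z i\<^esub> = []" "bdry ?Z i u = []" for i u by (simp_all add: zero_list_cplx_def)
  have "lin S (cmod (shift T.K) i) (cmod ?Z i) (\<lambda>w. [])" for i
    using lin_zero_map[OF complex_module[OF shift_complex[OF T.K_complex]] complex_module[OF Z], of i i] by (simp add: z)
  then have "chain_map S (shift T.K) ?Z (\<lambda>i w. [])" by (intro chain_mapI) (simp_all add: z)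
  then show ?thesis unfolding koszul_extension_def by (simp add: z psi'_def)
qed

lemma hmf_cplx_resolves:
  assumes "hmf_cplx S f X B p L"
  shows "1 \<le> p \<and> (p \<le> c \<longrightarrow> resolves p L)"
  using assms
proof induction
  case first
  have "resolves (Suc 0) (cone zero_list_cplx (koszul_tensor f 0 (Bcplx X B (Suc 0))) (\<lambda>i w. []))" if "1 \<le> c"
  proof (rule resolution_step.step_resolves)
    show "resolution_step S f c X B 0 zero_list_cplx (\<lambda>i w. [])"
      by (intro resolution_step.intro hmf_construction_axioms resolution_step_axioms.intro
          resolves_zero zero_extension that) (use that in simp)
  qed
  then show ?case by (simp add: One_nat_def)
next
  case (step p L \<Psi>)
  have "resolves (Suc p) (cone L (koszul_tensor f p (Bcplx X B (Suc p))) \<Psi>)" if "Suc p \<le> c"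
  proof (rule resolution_step.step_resolves)
    show "resolution_step S f c X B p L \<Psi>"
      using that step by (intro resolution_step.intro hmf_construction_axioms resolution_step_axioms.intro)
        (simp_all flip: Suc_eq_plus1)
  qed
  then show ?case by (simp flip: Suc_eq_plus1)
qed

lemma hmf_cplx_extension:
  assumes "hmf_cplx S f X B p L" and "p < c"
  shows "\<exists>\<Psi>. koszul_extension S f p (Bcplx X B (p + 1)) L (psi' X B (p + 1) L) \<Psi>"
proof -
  have "resolves p L" using hmf_cplx_resolves[OF assms(1)] assms(2) by simp
  from extension_exists[OF this] assms(2) show ?thesis by (simp only: Suc_eq_plus1 Suc_leI)
qed

lemma hmf_cplx_exists: "p \<in> {1..c} \<Longrightarrow> \<exists>L. hmf_cplx S f X B p L"
proof (induction p)
  case (Suc p)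
  show ?case
  proof (cases "p = 0")
    case True
    then show ?thesis using hmf_cplx.first[of S f X B] by (auto simp: One_nat_def)
  next
    case False
    then have "p \<in> {1..c}" "p < c" using Suc.prems by auto
    from Suc.IH[OF this(1)] obtain L where L: "hmf_cplx S f X B p L" by (rule exE)
    obtain \<Psi> where "koszul_extension S f p (Bcplx X B (p + 1)) L (psi' X B (p + 1) L) \<Psi>"
      using hmf_cplx_extension[OF L \<open>p < c\<close>] by (rule exE)
    from hmf_cplx.step[OF L this] have "\<exists>L. hmf_cplx S f X B (p + 1) L" by (rule exI)
    then show ?thesis by (simp only: Suc_eq_plus1)
  qed
qed simp

end

section \<open>Minimality\<close>

text \<open>
  In a Noetherian ring the union of a nonempty chain of ideals belongs to the chain, so unions of
  chains of proper ideals are proper.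
\<close>

lemma (in noetherian_ring) proper_ideal_in_maximal:
  assumes J: "ideal J R" and proper: "J \<noteq> carrier R"
  obtains M where "maximalideal M R" "J \<subseteq> M"
proof -
  let ?A = "{K. ideal K R \<and> J \<subseteq> K \<and> K \<noteq> carrier R}"
  have "\<exists>M\<in>?A. \<forall>K\<in>?A. M \<subseteq> K \<longrightarrow> K = M"
  proof (rule subset_Zorn_nonempty)
    show "?A \<noteq> {}" using assms by blast
    fix C assume C: "C \<noteq> {}" "subset.chain ?A C"
    then have "subset.chain {K. ideal K R} C" unfolding subset.chain_def by blast
    with C(1) have "\<Union>C \<in> C" by (rule ideal_chain_is_trivial)
    then show "\<Union>C \<in> ?A" using C(2) unfolding subset.chain_def by blast
  qed
  then obtain M where MA: "M \<in> ?A" and mx: "\<forall>K\<in>?A. M \<subseteq> K \<longrightarrow> K = M" by (rule bexE)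
  from MA have M: "ideal M R" "J \<subseteq> M" "M \<noteq> carrier R" by simp_all
  have max: "K = M" if "ideal K R" "J \<subseteq> K" "K \<noteq> carrier R" "M \<subseteq> K" for K
    using mx that by simp
  have "maximalideal M R"
  proof (rule maximalidealI[OF M(1)])
    show "carrier R \<noteq> M" using M(3) by simp
    show "K = M \<or> K = carrier R" if "ideal K R" "M \<subseteq> K" for K
      using max[OF that(1) subset_trans[OF M(2) that(2)] _ that(2)] by auto
  qed
  from that[OF this M(2)] show thesis .
qed

context hmf_construction
begin

lemma retraction_onto_fil:
  assumes "q \<le> r" "r \<le> c"
  shows "\<exists>P. lin S (A 0 r) (A 0 q) P \<and> (\<forall>x\<in>fil X 0 q. P x = x)"
  using assms
proof (induction r rule: dec_induct)
  case base
  have "smod S (A 0 q)" by (rule A_module) (use base in auto)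
  then show ?case using lin_id[of S "A 0 q"] by (auto simp: smod_def)
next
  case (step r)
  then obtain P where P: "lin S (A 0 r) (A 0 q) P" "\<And>x. x \<in> fil X 0 q \<Longrightarrow> P x = x" by auto
  have r: "Suc r \<in> {1..c}" using step by auto
  have "lin S (A 0 (Suc r)) (A 0 r) (compA X B 0 (Suc r))" using comp_lin(1)[of 0 "Suc r"] r by simp
  from lin_comp[OF this P(1)] have "lin S (A 0 (Suc r)) (A 0 q) (\<lambda>x. P (compA X B 0 (Suc r) x))" .
  moreover have "P (compA X B 0 (Suc r) x) = x" if x: "x \<in> fil X 0 q" for x
  proof -
    have "fil X 0 q \<subseteq> fil X 0 r"
      using step(1,2) step.prems
    proof (induction r rule: dec_induct)
      case (step r)
      then show ?case using fil_subset[of 0 "Suc r"] by auto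
    qed simp
    then have "compA X B 0 (Suc r) x = x" using comp_fil(1)[of 0 "Suc r" x] r x by auto
    then show ?thesis using P(2)[OF x] by simp
  qed
  ultimately show ?case by blast
qed

text \<open>As \<open>A\<^sub>0(q)\<close> is a direct summand of \<open>A\<^sub>0\<close>, one has \<open>A\<^sub>0(q) \<inter> JA\<^sub>0 = JA\<^sub>0(q)\<close>.\<close>

lemma dmap_minimal:
  assumes J: "J \<subseteq> carrier S" and d: "dmap X ` carrier (amb X 1) \<subseteq> ideal_mod S J (amb X 0)"
    and q: "q \<le> c" and x: "x \<in> fil X 1 q"
  shows "dmap X x \<in> ideal_mod S J (A 0 q)"
proof -
  obtain P where P: "lin S (A 0 c) (A 0 q) P" and Px: "\<And>x. x \<in> fil X 0 q \<Longrightarrow> P x = x"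
    using retraction_onto_fil[OF q order_refl] by blast
  have full: "fil X 0 c = carrier (amb X 0)"
    using filtration[of 0] unfolding free_filtration_def by simp
  have "lin S (amb X 0) (A 0 c) (\<lambda>x. x)"
    using amb_module[of 0] A_module[of 0 c] by (intro linI) (auto simp: full smod_def)
  from lin_comp[OF this P] have l: "lin S (amb X 0) (A 0 q) P" by simp
  have "dmap X x \<in> ideal_mod S J (amb X 0)"
    using d fil_carrier[of 1 q x] q x by auto
  from lin.ideal_mod_image[OF l J this] have "P (dmap X x) \<in> ideal_mod S J (A 0 q)" .
  moreover have "dmap X x \<in> fil X 0 q" using lin.closed[OF d_lin[OF q]] x by simp
  ultimately show ?thesis using Px by simp
qed

end

lemma (in resolution_step) step_minimal:
  assumes J: "J \<subseteq> carrier S" and fJ: "\<And>j. j \<in> {1..p} \<Longrightarrow> f j \<in> J"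
    and d: "dmap X ` carrier (amb X 1) \<subseteq> ideal_mod S J (amb X 0)" and Lmin: "minimal_complex S J L"
  shows "minimal_complex S J cone.C"
proof -
  note dJ = dmap_minimal[OF J d p]
  have Bmin: "minimal_complex S J Bc"
    unfolding minimal_complex_def
  proof (intro allI subsetI)
    fix i y assume "y \<in> bdry Bc i ` carrier (cmod Bc i)"
    then obtain x where x: "x \<in> carrier (cmod Bc i)" and y: "y = bdry Bc i x" by blast
    show "y \<in> ideal_mod S J (cmod Bc (i - 1))"
    proof (cases "i = 1")
      case True
      then show ?thesis using x cB.ideal_mod_image[OF J dJ[OF B1]] by (simp add: y)
    next
      case False
      interpret N: smod S "cmod Bc (i - 1)" by (rule smodI[OF complex_module[OF T.B]])
      show ?thesis using False N.ideal_mod_zero[OF J] by (simp add: y)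
    qed
  qed
  have \<psi>: "psi' X B q L 0 b \<in> ideal_mod S J (cmod L 0)" if "b \<in> carrier (cmod Bc 1)" for b
    using id0.ideal_mod_image[OF J cA.ideal_mod_image[OF J dJ[OF B1]]] that by (simp add: psi'_def)
  have lin: "lin S (cmod Bc 1) (cmod L 0) (psi' X B q L 0)" using psi_lin[OF L p] by simp
  have zero: "psi' X B q L i b = \<zero>\<^bsub>cmod L i\<^esub>" if "i \<noteq> 0" for i b using that by (simp add: psi'_def)
  show ?thesis
    by (rule cone.cone_minimal[OF J Lmin T.K_minimal[OF J fJ Bmin]
          T.koszul_extension_minimal[where \<psi> = "psi' X B q L", OF one_not_zero L_free_acyclic
            resolves_kill[OF L p'] lin zero \<Psi> J fJ Bmin Lmin \<psi>]])
qed

context hmf_construction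
begin

lemma hmf_cplx_minimal:
  assumes J: "J \<subseteq> carrier S" and fJ: "\<And>j. j \<in> {1..c} \<Longrightarrow> f j \<in> J"
    and d: "dmap X ` carrier (amb X 1) \<subseteq> ideal_mod S J (amb X 0)"
    and L: "hmf_cplx S f X B p L"
  shows "p \<le> c \<longrightarrow> minimal_complex S J L"
  using L
proof induction
  case first
  have z: "minimal_complex S J (zero_list_cplx :: ('a, (nat set \<Rightarrow> 'm) list) cplx)"
  proof -
    have "[] \<in> ideal_mod S J (cmod (zero_list_cplx :: ('a, (nat set \<Rightarrow> 'm) list) cplx) i)" for i
      using smod.ideal_mod_zero[OF smodI[OF complex_module[OF free_acyclicD(1)[OF resolvesD(1)[OF resolves_zero]]]] J, of i]
      by (simp add: zero_list_cplx_def)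
    then show ?thesis unfolding minimal_complex_def by (auto simp: zero_list_cplx_def)
  qed
  have "minimal_complex S J (cone zero_list_cplx (koszul_tensor f 0 (Bcplx X B (Suc 0))) (\<lambda>i w. []))" if "1 \<le> c"
  proof (rule resolution_step.step_minimal[OF _ J _ d z])
    show "resolution_step S f c X B 0 zero_list_cplx (\<lambda>i w. [])"
      by (intro resolution_step.intro hmf_construction_axioms resolution_step_axioms.intro
          resolves_zero zero_extension that) (use that in simp)
  qed simp
  then show ?case by (simp add: One_nat_def)
next
  case (step p L \<Psi>)
  have "minimal_complex S J (cone L (koszul_tensor f p (Bcplx X B (Suc p))) \<Psi>)" if "Suc p \<le> c"
  proof (rule resolution_step.step_minimal[OF _ J _ d])
    show "resolution_step S f c X B p L \<Psi>"
      using that step hmf_cplx_resolves[OF step.hyps(1)]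
      by (intro resolution_step.intro hmf_construction_axioms resolution_step_axioms.intro)
        (simp_all flip: Suc_eq_plus1)
  qed (use that step fJ in auto)
  then show ?case by (simp flip: Suc_eq_plus1)
qed

end

theorem theorem3p4:
  fixes S :: "('a, 'b) ring_scheme" and f :: "nat \<Rightarrow> 'a" and c :: nat
    and X :: "('a, 'm) hmf_data" and B :: "nat \<Rightarrow> nat \<Rightarrow> 'm set"
  assumes "cring S" and "noetherian_ring S"
    and "regular_sequence S f c"
    and "hmf S f c X"
    and "splitting S c X B"
  shows "(\<forall>p\<in>{1..c}.
            (\<exists>L. hmf_cplx S f X B p L) \<and>
            (\<forall>L. hmf_cplx S f X B p L \<longrightarrow> free_resolution S L (hmf_module S f X p))) \<and>
         (\<forall>p\<in>{1..<c}. \<forall>L. hmf_cplx S f X B p L \<longrightarrow>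
            (\<exists>\<Psi>. koszul_extension S f p (Bcplx X B (p + 1)) L (psi' X B (p + 1) L) \<Psi>)) \<and>
         (\<forall>\<mm>. local_ring_with S \<mm> \<and> minimal_hmf S \<mm> c X \<longrightarrow>
            (\<forall>p\<in>{1..c}. \<forall>L. hmf_cplx S f X B p L \<longrightarrow> minimal_complex S \<mm> L))"
proof -
  interpret H: hmf_construction S f c X B by (rule hmf_construction.intro) fact+
  have "minimal_complex S \<mm> L"
    if "local_ring_with S \<mm>" and m: "minimal_hmf S \<mm> c X" and p: "p \<in> {1..c}" and L: "hmf_cplx S f X B p L" for \<mm> p L
  proof -
    interpret m: maximalideal \<mm> S using that(1) by (simp add: local_ring_with_def)
    have f: "f j \<in> \<mm>" if "j \<in> {1..c}" for j
    proof -
      have "ideal (H.I c) S" by (rule seq_ideal_ideal[of S c f, OF assms(1) H.f_closed[OF _ order_refl]])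
      moreover have "H.I c \<noteq> carrier S" using assms(3) by (simp add: regular_sequence_def)
      ultimately obtain M where "maximalideal M S" "H.I c \<subseteq> M"
        by (rule noetherian_ring.proper_ideal_in_maximal[OF assms(2)])
      moreover from this have "M = \<mm>" using \<open>local_ring_with S \<mm>\<close> by (simp add: local_ring_with_def)
      ultimately show ?thesis using H.f_mem_I[OF that order_refl] by blast
    qed
    have "dmap X ` carrier (amb X 1) \<subseteq> ideal_mod S \<mm> (amb X 0)"
      using m by (simp add: minimal_hmf_def)
    from H.hmf_cplx_minimal[OF m.a_subset f this L] show ?thesis using p by simp
  qed
  then show ?thesis
    using H.hmf_cplx_exists H.hmf_cplx_resolves H.resolves_free_resolution H.hmf_cplx_extension by auto
qed

end
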